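(* Let $m,n\in\mathbb N$ with $m\ge 2$, let $1<p_1,\ldots,p_m<\infty$, and let $f_j\in h^{p_j}(\mathbb U^n)$ for $j=1,\ldots,m$. Then $$\int_{\mathbb U^n}\prod_{j=1}^m |f_j(z)|^{p_j}\,d\mu_{\mathbf{m-2}}(z)\le \prod_{j=1}^m\Gamma_{p_j,m,n}^{p_j}\ \prod_{j=1}^m\|f_j\|_{h^{p_j}(\mathbb U^n)}^{p_j}.$$
   Context: $\mathbb U$ is the open unit disc in $\mathbb C$, $\mathbb T$ the unit circle, $\mathbb U^n$ the unit polydisc, and $dm_n$ is normalized Haar measure on $\mathbb T^n$. A complex-valued $f\in C^2(\mathbb U^n)$ is pluriharmonic if $\partial^2 f/\partial z_j\partial\overline z_k=0$ for all $1\le j,k\le n$. For $0<p<\infty$, $h^p(\mathbb U^n)$ is the set of complex-valued pluriharmonic $f$ on $\mathbb U^n$ with $$\|f\|_{h^p(\mathbb U^n)}=\sup_{0<r<1}\Big(\int_{\mathbb T^n}|f(r\omega)|^p\,dm_n(\omega)\Big)^{1/p}<\infty.$$ For an integer $m\ge2$, $$d\mu_{\mathbf{m-2}}(z)=\frac{(m-1)^n}{\pi^n}\prod_{k=1}^n(1-|z_k|^2)^{m-2}\,dx_k\,dy_k,\qquad z_k=x_k+iy_k,$$ a probability measure on $\mathbb U^n$. Constants: $D_k=\sqrt2\cos\left(\frac{\pi}{4k}\right)$ for $k\in\mathbb N$; for $1<p<\infty$, $$R_{p,m}=\frac{\sqrt2\cos\left(\frac{\pi}{2mp}\right)}{\sqrt{1-|\cos(\pi/p)|}};$$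 and $\Gamma_{p,m,n}=R_{p,m}$ if $1<p\le2$, $\Gamma_{p,m,n}=\min\{R_{p,m},D_m^{2n/p}\}$ if $p>2$. *)

theory Defs
  imports "HOL-Analysis.Analysis"
begin

text \<open>Points of complex \<open>n\<close>-space are vectors of type \<^typ>\<open>complex ^ 'n\<close>, with
  \<open>n = CARD('n)\<close>. Functions on the polydisc are total functions on this type; every notion below
  depends only on their values on the polydisc.\<close>

definition polydisc :: "(complex ^ 'n) set" where
  "polydisc = {z. \<forall>k. norm (z $ k) < 1}"

definition torus :: "(complex ^ 'n) set" where
  "torus = {z. \<forall>k. norm (z $ k) = 1}"

text \<open>Normalized Haar measure on the torus, as the image of the uniform distribution on
  \<open>[0, 2\<pi>]\<^sup>n\<close> under \<open>\<theta> \<mapsto> (exp (\<i> \<theta>\<^sub>1), \<dots>, exp (\<i> \<theta>\<^sub>n))\<close>. The underlying space is the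
  torus itself, so integrands need only be measurable there.\<close>

definition torus_haar :: "(complex ^ 'n) measure" where
  "torus_haar = distr (uniform_measure lborel {\<theta> :: real ^ 'n. \<forall>k. 0 \<le> \<theta> $ k \<and> \<theta> $ k \<le> 2 * pi})
     (restrict_space borel torus) (\<lambda>\<theta>. \<chi> k. cis (\<theta> $ k))"

text \<open>Real differentiability classes; all derivatives are over the reals. On an open set \<open>S\<close>
  only the values of \<open>f\<close> on \<open>S\<close> matter.\<close>

definition C1_on :: "'a::euclidean_space set \<Rightarrow> ('a \<Rightarrow> 'b::real_normed_vector) \<Rightarrow> bool" where
  "C1_on S f \<longleftrightarrow> (\<forall>z\<in>S. f differentiable (at z)) \<and>
     (\<forall>v. continuous_on S (\<lambda>z. frechet_derivative f (at z) v))"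

definition C2_on :: "'a::euclidean_space set \<Rightarrow> ('a \<Rightarrow> 'b::real_normed_vector) \<Rightarrow> bool" where
  "C2_on S f \<longleftrightarrow> C1_on S f \<and> (\<forall>v. C1_on S (\<lambda>z. frechet_derivative f (at z) v))"

text \<open>Wirtinger derivatives: with \<open>z\<^sub>k = x\<^sub>k + \<i> y\<^sub>k\<close>, the vectors \<^term>\<open>axis k 1\<close> and
  \<^term>\<open>axis k \<i>\<close> are the directions of \<open>\<partial>/\<partial>x\<^sub>k\<close> and \<open>\<partial>/\<partial>y\<^sub>k\<close>.\<close>

definition d_z :: "'n::finite \<Rightarrow> (complex ^ 'n \<Rightarrow> complex) \<Rightarrow> complex ^ 'n \<Rightarrow> complex" where
  "d_z k f z = (frechet_derivative f (at z) (axis k 1)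
     - \<i> * frechet_derivative f (at z) (axis k \<i>)) / 2"

definition d_zbar :: "'n::finite \<Rightarrow> (complex ^ 'n \<Rightarrow> complex) \<Rightarrow> complex ^ 'n \<Rightarrow> complex" where
  "d_zbar k f z = (frechet_derivative f (at z) (axis k 1)
     + \<i> * frechet_derivative f (at z) (axis k \<i>)) / 2"

definition pluriharmonic_on :: "(complex ^ 'n) set \<Rightarrow> (complex ^ 'n \<Rightarrow> complex) \<Rightarrow> bool" where
  "pluriharmonic_on S f \<longleftrightarrow> C2_on S f \<and> (\<forall>j k. \<forall>z\<in>S. d_z j (d_zbar k f) z = 0)"

definition hp_mean :: "real \<Rightarrow> (complex ^ 'n \<Rightarrow> complex) \<Rightarrow> real \<Rightarrow> real" where
  "hp_mean p f r = (\<integral>\<omega>. norm (f (r *\<^sub>R \<omega>)) powr p \<partial>torus_haar) powr (1 / p)"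

text \<open>The supremum is real-valued, so it is the norm only for members of \<open>hp_space p\<close>.\<close>

definition hp_norm :: "real \<Rightarrow> (complex ^ 'n \<Rightarrow> complex) \<Rightarrow> real" where
  "hp_norm p f = (SUP r\<in>{0<..<1}. hp_mean p f r)"

definition hp_space :: "real \<Rightarrow> (complex ^ 'n \<Rightarrow> complex) set" where
  "hp_space p = {f. pluriharmonic_on polydisc f \<and> bdd_above (hp_mean p f ` {0<..<1})}"

text \<open>The argument is the number \<open>m \<ge> 2\<close>; the exponent of the weight is \<open>m - 2\<close>. As
  \<^typ>\<open>complex ^ 'n\<close> is a real Euclidean space of dimension \<open>2n\<close>, \<^const>\<open>lborel\<close> is the measure
  \<open>dx\<^sub>1 dy\<^sub>1 \<dots> dx\<^sub>n dy\<^sub>n\<close>.\<close>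

definition weighted_measure :: "nat \<Rightarrow> (complex ^ 'n) measure" where
  "weighted_measure m = density (restrict_space lborel polydisc)
     (\<lambda>z. ennreal ((real m - 1) ^ CARD('n) / pi ^ CARD('n) *
        (\<Prod>k\<in>UNIV. (1 - (norm (z $ k))\<^sup>2) ^ (m - 2))))"

definition const_D :: "nat \<Rightarrow> real" where
  "const_D k = sqrt 2 * cos (pi / (4 * real k))"

definition const_R :: "real \<Rightarrow> nat \<Rightarrow> real" where
  "const_R p m = sqrt 2 * cos (pi / (2 * real m * p)) / sqrt (1 - \<bar>cos (pi / p)\<bar>)"

definition const_Gamma :: "real \<Rightarrow> nat \<Rightarrow> nat \<Rightarrow> real" where
  "const_Gamma p m n =
     (if p \<le> 2 then const_R p m else min (const_R p m) (const_D m powr (2 * real n / p)))"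

end

theory Submission
  imports Defs "HOL-Complex_Analysis.Complex_Analysis" "HOL-Probability.Probability"
begin

text \<open>By the inequality of arithmetic and geometric means it suffices to bound
  \<open>\<integral> |f|\<^sup>m\<^sup>p d\<mu>\<close> by \<open>(\<Gamma>\<^sup>p \<parallel>f\<parallel>\<^sup>p)\<^sup>m\<close> for a single function \<open>f\<close>, and by dilation and Fatou's lemma for
  one that is continuous up to the boundary. Write \<open>f = g + cnj h\<close> with \<open>g\<close>, \<open>h\<close> holomorphic and
  \<open>h 0 = 0\<close>, and let \<open>N = |g|\<^sup>2 + |h|\<^sup>2\<close>, so that \<open>|f|\<^sup>2 = N + 2 Re (g h)\<close>. Elementary trigonometric
  inequalities give \<open>|f|\<^sup>m\<^sup>p \<le> (\<surd>2 cos (\<pi>/2mp))\<^sup>m\<^sup>p N\<^sup>m\<^sup>p\<^sup>/\<^sup>2 - c \<Phi> (g h)\<close> and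
  \<open>(1 - |cos (\<pi>/p)|)\<^sup>p\<^sup>/\<^sup>2 N\<^sup>p\<^sup>/\<^sup>2 \<le> |f|\<^sup>p - c' \<Psi> (\<plusminus> g h)\<close> with homogeneous subharmonic functions \<open>\<Phi>\<close>, \<open>\<Psi>\<close>.
  As \<open>g h\<close> vanishes at \<open>0\<close>, the integrals of \<open>\<Phi> (g h)\<close> and \<open>\<Psi> (\<plusminus> g h)\<close> are nonnegative, and the constant
  \<open>R\<close> results from Carleman's inequality \<open>\<integral> N\<^sup>m\<^sup>p\<^sup>/\<^sup>2 d\<mu> \<le> (\<integral> N\<^sup>p\<^sup>/\<^sup>2)\<^sup>m\<close>. In one variable the latter holds
  because \<open>log N\<close> is subharmonic: on the disc \<open>N\<^sup>p\<^sup>/\<^sup>2\<close> is dominated by some \<open>|exp P|\<^sup>2\<close>, \<open>P\<close> a polynomial, that is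
  close to it on the circle, and for \<open>|exp P|\<^sup>2\<close> one compares Taylor coefficients. It passes to several
  variables by Minkowski's inequality.

  For \<open>p \<ge> 2\<close> the function \<open>|f|\<^sup>p\<^sup>/\<^sup>2\<close> is subharmonic in each variable, hence dominated by a harmonic
  function that is close to it on the circle. The case \<open>p = 2\<close> of the inequality with \<open>R\<close>, where
  \<open>R = D\<close>, then gives the constant \<open>D\<^sup>2\<^sup>/\<^sup>p\<close> in each variable.\<close>

section \<open>Pointwise inequalities\<close>

text \<open>For \<open>a = g z\<close> and \<open>b = h z\<close> everything depends on
  \<open>w = 2 a b / (|a|^2 + |b|^2)\<close>, a point of the closed unit disc, and
  \<open>|a + cnj b|\<close> sees only its real part; so each pointwise inequality reduces to one in
  \<open>cos t\<close> on a half circle. The constants arise at the angle where the homogeneous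
  correction vanishes, since both sides touch there. For exponent \<open>2 s\<close> this angle is
  \<open>pi / (2 s)\<close>; \<open>s = m p / 2\<close> gives the numerator of \<open>R\<close> and
  \<open>s = p / 2\<close> its denominator. The corrections are not smooth and take negative values,
  so subharmonicity is used in a weak form: at each point either the real part of a holomorphic
  function touches from below, or the mean over some small circle is strictly larger. The second
  alternative serves the zeros of \<open>g h\<close>, where a minorant may fail to exist.
  \<open>R\<close> does not depend on the dimension because only Carleman's inequality, whose
  constant is \<open>1\<close>, and the sub-mean inequalities at the origin are carried over
  coordinate by coordinate; the pointwise bounds with their constants are applied once, on the whole
  polydisc.\<close>

lemma minimum_of_monotone_factor:
  fixes h p M :: "real \<Rightarrow> real"
  assumes "0 < v" "v < b" and h: "continuous_on {0..b} h"
    and der: "\<And>u. 0 < u \<Longrightarrow> u < b \<Longrightarrow> (h has_real_derivative p u * (M u - M v)) (at u)"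
    and p: "\<And>u. 0 < u \<Longrightarrow> u < b \<Longrightarrow> 0 \<le> p u"
    and M: "\<And>x y. 0 < x \<Longrightarrow> x \<le> y \<Longrightarrow> y < b \<Longrightarrow> M x \<le> M y"
    and u: "0 \<le> u" "u \<le> b"
  shows "h v \<le> h u"
proof (cases "u \<le> v")
  case True
  show ?thesis
  proof (rule DERIV_nonpos_imp_decreasing_open[OF True])
    fix x assume x: "u < x" "x < v"
    then have "p x * (M x - M v) \<le> 0"
      using p[of x] M[of x v] assms(2) u by (intro mult_nonneg_nonpos) auto
    then show "\<exists>y. (h has_real_derivative y) (at x) \<and> y \<le> 0"
      using der[of x] x u assms(2) by (intro exI[of _ "p x * (M x - M v)"]) auto
  qed (use assms in \<open>auto intro: continuous_on_subset\<close>)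
next
  case False
  then have vu: "v \<le> u" by simp
  show ?thesis
  proof (rule DERIV_nonneg_imp_increasing_open[OF vu])
    fix x assume x: "v < x" "x < u"
    then have "p x * (M x - M v) \<ge> 0"
      using p[of x] M[of v x] assms(1) u by (intro mult_nonneg_nonneg) auto
    then show "\<exists>y. (h has_real_derivative y) (at x) \<and> 0 \<le> y"
      using der[of x] x u assms(1) by (intro exI[of _ "p x * (M x - M v)"]) auto
  qed (use assms in \<open>auto intro: continuous_on_subset\<close>)
qed

text \<open>\<open>N\<close> vanishes at \<open>0\<close>, and its derivative
  \<open>(k\<^sup>2 - 1) * (sin u * sin (k * u))\<close> has the sign of \<open>k - 1\<close> on the
  given range. \<open>N\<close> is the numerator of the derivative in
  \<open>powr_quotient_deriv_cos\<close>, so the two cases give the two directions of monotonicity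
  used there.\<close>

lemma sin_mult_cos_compare:
  fixes k u :: real
  assumes "0 \<le> u" "u \<le> pi / 2" "0 \<le> k" "k * u \<le> pi"
  shows "k \<ge> 1 \<Longrightarrow> k * sin u * cos (k * u) \<le> sin (k * u) * cos u"
    and "k \<le> 1 \<Longrightarrow> sin (k * u) * cos u \<le> k * sin u * cos (k * u)"
proof -
  define N where "N u = sin (k * u) * cos u - k * sin u * cos (k * u)" for u
  have der: "(N has_real_derivative (k\<^sup>2 - 1) * (sin u * sin (k * u))) (at u)" for u
    unfolding N_def
    by (auto intro!: derivative_eq_intros simp: power2_eq_square algebra_simps)
  have nn: "0 \<le> sin x * sin (k * x)" if "0 \<le> x" "x \<le> u" for x
  proof (intro mult_nonneg_nonneg sin_ge_zero)
    show "k * x \<le> pi" using assms that mult_left_mono[of x u k] by linarith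
  qed (use assms that in auto)
  show "k * sin u * cos (k * u) \<le> sin (k * u) * cos u" if "k \<ge> 1"
  proof -
    have "N 0 \<le> N u"
    proof (rule DERIV_nonneg_imp_nondecreasing[OF assms(1)])
      fix x assume "0 \<le> x" "x \<le> u"
      then show "\<exists>y. (N has_real_derivative y) (at x) \<and> 0 \<le> y"
        using der[of x] nn[of x] that
        by (intro exI[of _ "(k\<^sup>2 - 1) * (sin x * sin (k * x))"]) (auto simp: one_le_power)
    qed
    then show ?thesis by (simp add: N_def)
  qed
  show "sin (k * u) * cos u \<le> k * sin u * cos (k * u)" if "k \<le> 1"
  proof -
    have "N u \<le> N 0"
    proof (rule DERIV_nonpos_imp_nonincreasing[OF assms(1)])
      fix x assume "0 \<le> x" "x \<le> u"
      moreover have "k\<^sup>2 - 1 \<le> 0" using that assms(3) by (simp add: power_le_one)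
      ultimately show "\<exists>y. (N has_real_derivative y) (at x) \<and> y \<le> 0"
        using der[of x] nn[of x]
        by (intro exI[of _ "(k\<^sup>2 - 1) * (sin x * sin (k * x))"]) (auto intro: mult_nonpos_nonneg)
    qed
    then show ?thesis by (simp add: N_def)
  qed
qed

text \<open>With \<open>k = r - 1\<close> this quotient is what remains of the derivative of
  \<open>cos u powr r\<close> after division by \<open>- r * sin (r * u)\<close>. It is, up to sign,
  the function \<open>M\<close> of the tangent lemmas for the cosine.\<close>

lemma powr_quotient_deriv_cos:
  fixes k u :: real
  assumes "0 < cos u" "sin ((k + 1) * u) \<noteq> 0"
  shows "((\<lambda>u. cos u powr k * sin u / sin ((k + 1) * u)) has_real_derivative
     cos u powr (k - 1) * (sin (k * u) * cos u - k * sin u * cos (k * u)) / (sin ((k + 1) * u))\<^sup>2) (at u)"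
proof -
  define C S P where "C = cos (k * u)" and "S = sin (k * u)" and "P = cos u powr (k - 1)"
  have pw: "cos u powr k = P * cos u"
    using assms powr_mult_base[of "cos u" "k - 1"] by (simp add: P_def mult.commute)
  have sr: "sin ((k + 1) * u) = S * cos u + C * sin u" and cr: "cos ((k + 1) * u) = C * cos u - S * sin u"
    unfolding S_def C_def
    using sin_add[of "k * u" u] cos_add[of "k * u" u] by (simp_all add: algebra_simps)
  have cs: "cos u * cos u = 1 - sin u * sin u"
    using sin_cos_squared_add[of u] by (simp add: power2_eq_square algebra_simps)
  have d1: "((\<lambda>u. cos u powr k * sin u) has_real_derivative
      (k * P * (- sin u)) * sin u + cos u * (P * cos u)) (at u)"
    using DERIV_mult[OF DERIV_fun_powr[OF DERIV_cos assms(1), of k] DERIV_sin]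
    by (simp add: P_def[symmetric] pw)
  have d2: "((\<lambda>u. sin ((k + 1) * u)) has_real_derivative cos ((k + 1) * u) * (k + 1)) (at u)"
    by (auto intro!: derivative_eq_intros)
  have "(((k * P * (- sin u)) * sin u + cos u * (P * cos u)) * sin ((k + 1) * u)
      - (cos u powr k * sin u) * (cos ((k + 1) * u) * (k + 1))) / (sin ((k + 1) * u) * sin ((k + 1) * u))
     = P * (S * cos u - k * sin u * C) / (sin ((k + 1) * u))\<^sup>2"
  proof -
    have "((k * P * (- sin u)) * sin u + cos u * (P * cos u)) * sin ((k + 1) * u)
      - (cos u powr k * sin u) * (cos ((k + 1) * u) * (k + 1)) = P * (S * cos u - k * sin u * C)"
      unfolding sr cr pw using cs by algebra
    then show ?thesis by (simp add: power2_eq_square)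
  qed
  then show ?thesis
    using DERIV_divide[OF d1 d2 assms(2)] by (simp add: P_def S_def C_def)
qed

lemma powr_quotient_deriv_sin:
  fixes k u :: real
  assumes "0 < sin u" "sin ((k + 1) * u) \<noteq> 0"
  shows "((\<lambda>u. sin u powr k * cos u / sin ((k + 1) * u)) has_real_derivative
     sin u powr (k - 1) * (k * sin (k * u) * cos u - sin u * cos (k * u)) / (sin ((k + 1) * u))\<^sup>2) (at u)"
proof -
  define C S P where "C = cos (k * u)" and "S = sin (k * u)" and "P = sin u powr (k - 1)"
  have pw: "sin u powr k = P * sin u"
    using assms powr_mult_base[of "sin u" "k - 1"] by (simp add: P_def mult.commute)
  have sr: "sin ((k + 1) * u) = S * cos u + C * sin u" and cr: "cos ((k + 1) * u) = C * cos u - S * sin u"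
    unfolding S_def C_def
    using sin_add[of "k * u" u] cos_add[of "k * u" u] by (simp_all add: algebra_simps)
  have cs: "cos u * cos u = 1 - sin u * sin u"
    using sin_cos_squared_add[of u] by (simp add: power2_eq_square algebra_simps)
  have d1: "((\<lambda>u. sin u powr k * cos u) has_real_derivative
      (k * P * cos u) * cos u + (- sin u) * (P * sin u)) (at u)"
    using DERIV_mult[OF DERIV_fun_powr[OF DERIV_sin assms(1), of k] DERIV_cos]
    by (simp add: P_def[symmetric] pw)
  have d2: "((\<lambda>u. sin ((k + 1) * u)) has_real_derivative cos ((k + 1) * u) * (k + 1)) (at u)"
    by (auto intro!: derivative_eq_intros)
  have "(((k * P * cos u) * cos u + (- sin u) * (P * sin u)) * sin ((k + 1) * u)
      - (sin u powr k * cos u) * (cos ((k + 1) * u) * (k + 1))) / (sin ((k + 1) * u) * sin ((k + 1) * u))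
     = P * (k * S * cos u - sin u * C) / (sin ((k + 1) * u))\<^sup>2"
  proof -
    have "((k * P * cos u) * cos u + (- sin u) * (P * sin u)) * sin ((k + 1) * u)
      - (sin u powr k * cos u) * (cos ((k + 1) * u) * (k + 1)) = P * (k * S * cos u - sin u * C)"
      unfolding sr cr pw using cs by algebra
    then show ?thesis by (simp add: power2_eq_square)
  qed
  then show ?thesis
    using DERIV_divide[OF d1 d2 assms(2)] by (simp add: P_def S_def C_def)
qed

lemma continuous_on_cos_powr:
  assumes "0 < r" "b \<le> pi / 2"
  shows "continuous_on {0..b} (\<lambda>u. cos u powr r)"
  using assms by (intro continuous_on_powr') (auto intro!: continuous_intros cos_ge_zero)

lemma continuous_on_sin_powr:
  assumes "0 < r" "b \<le> pi"
  shows "continuous_on {0..b} (\<lambda>u. sin u powr r)"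
  using assms by (intro continuous_on_powr') (auto intro!: continuous_intros sin_ge_zero)

text \<open>Both sides agree to first order at \<open>v = pi / (2 * r)\<close>, where
  \<open>cos (r * v) = 0\<close> and \<open>sin (r * v) = 1\<close>; this fixes the coefficient
  \<open>e\<close>. The difference \<open>h\<close> has derivative
  \<open>r * sin (r * u) * (M u - M v)\<close> with \<open>M\<close> nondecreasing, so
  \<open>v\<close> is a global minimum of \<open>h\<close>.\<close>

lemma cos_powr_tangent_upper:
  fixes r u :: real
  assumes r: "2 \<le> r" and u: "0 \<le> u" "u \<le> pi / r"
  shows "cos u powr r \<le> cos (pi / (2 * r)) powr r
     + cos (pi / (2 * r)) powr (r - 1) * sin (pi / (2 * r)) * cos (r * u)"
proof -
  define v where "v = pi / (2 * r)"
  define e where "e = cos v powr (r - 1) * sin v"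
  define h where "h u = e * cos (r * u) - cos u powr r" for u
  define M where "M u = cos u powr (r - 1) * sin u / sin (r * u)" for u
  have b: "pi / r \<le> pi / 2" using r by (intro divide_left_mono) auto
  have rv: "r * v = pi / 2" using r by (simp add: v_def)
  have Mv: "M v = e" by (simp add: M_def e_def rv)
  have pos: "cos x > 0" "sin (r * x) > 0" "sin x > 0" "(r - 1) * x \<le> pi" "x \<le> pi / 2"
    if "0 < x" "x < pi / r" for x
  proof -
    have "r * x < pi" using that r by (simp add: field_simps)
    then show "sin (r * x) > 0" using that r by (intro sin_gt_zero) auto
    show "(r - 1) * x \<le> pi" using \<open>r * x < pi\<close> that by (simp add: algebra_simps)
    have "x < pi / 2" "- (pi / 2) < x" using that b pi_gt_zero by linarith+
    then show "cos x > 0" "x \<le> pi / 2" by (auto intro: cos_gt_zero_pi)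
    show "sin x > 0" using that b pi_gt_zero by (intro sin_gt_zero) linarith+
  qed
  have "h v \<le> h u"
  proof (rule minimum_of_monotone_factor[where h = h and v = v and u = u and p = "\<lambda>u. r * sin (r * u)" and M = M and b = "pi / r"])
    show "0 < v" "v < pi / r" using r by (auto simp: v_def field_simps)
    show "continuous_on {0..pi / r} h"
      unfolding h_def using r b by (intro continuous_intros continuous_on_cos_powr) auto
    fix x assume x: "0 < x" "x < pi / r"
    show "0 \<le> r * sin (r * x)" using pos[OF x] r by simp
    have "((\<lambda>u. cos u powr r) has_real_derivative r * cos x powr (r - 1) * (- sin x)) (at x)"
      using DERIV_fun_powr[OF DERIV_cos pos(1)[OF x], of r] by simp
    then have "(h has_real_derivative e * (- sin (r * x) * r) - r * cos x powr (r - 1) * (- sin x)) (at x)"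
      unfolding h_def using pos[OF x] by (auto intro!: derivative_eq_intros)
    moreover have "e * (- sin (r * x) * r) - r * cos x powr (r - 1) * (- sin x) = r * sin (r * x) * (M x - M v)"
      using pos[OF x] unfolding Mv by (simp add: M_def field_simps)
    ultimately show "(h has_real_derivative r * sin (r * x) * (M x - M v)) (at x)" by simp
  next
    fix x y assume xy: "0 < x" "x \<le> y" "y < pi / r"
    show "M x \<le> M y"
    proof (rule DERIV_nonneg_imp_nondecreasing[OF xy(2)])
      fix z assume z: "x \<le> z" "z \<le> y"
      then have z': "0 < z" "z < pi / r" using xy by auto
      have "(M has_real_derivative cos z powr (r - 1 - 1) *
         (sin ((r - 1) * z) * cos z - (r - 1) * sin z * cos ((r - 1) * z)) / (sin (r * z))\<^sup>2) (at z)"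
        using powr_quotient_deriv_cos[of z "r - 1"] pos[OF z'] by (simp add: M_def[abs_def])
      moreover have "0 \<le> cos z powr (r - 1 - 1) *
         (sin ((r - 1) * z) * cos z - (r - 1) * sin z * cos ((r - 1) * z)) / (sin (r * z))\<^sup>2"
        using sin_mult_cos_compare(1)[of z "r - 1"] pos[OF z'] z' r
        by (intro divide_nonneg_nonneg mult_nonneg_nonneg) auto
      ultimately show "\<exists>D. (M has_real_derivative D) (at z) \<and> 0 \<le> D" by blast
    qed
  qed (use u in auto)
  then show ?thesis by (simp add: h_def e_def rv v_def[symmetric])
qed

text \<open>Same tangency at \<open>pi / (2 * r)\<close>, but now \<open>r - 1 \<le> 1\<close>, so
  the quotient of \<open>powr_quotient_deriv_cos\<close> is nonincreasing and the inequality turns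
  round. It reaches up to \<open>pi / 2\<close> because \<open>r * u\<close> stays at most
  \<open>pi\<close>.\<close>

lemma cos_powr_tangent_lower:
  fixes r u :: real
  assumes r: "1 < r" "r \<le> 2" and u: "0 \<le> u" "u \<le> pi / 2"
  shows "cos (pi / (2 * r)) powr r
     + cos (pi / (2 * r)) powr (r - 1) * sin (pi / (2 * r)) * cos (r * u) \<le> cos u powr r"
proof -
  define v where "v = pi / (2 * r)"
  define e where "e = cos v powr (r - 1) * sin v"
  define h where "h u = cos u powr r - e * cos (r * u)" for u
  define M where "M u = - (cos u powr (r - 1) * sin u / sin (r * u))" for u
  have rv: "r * v = pi / 2" using r by (simp add: v_def)
  have Mv: "M v = - e" by (simp add: M_def e_def rv)
  have pos: "cos x > 0" "sin (r * x) > 0" "sin x > 0" "(r - 1) * x \<le> pi"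
    if "0 < x" "x < pi / 2" for x :: real
  proof -
    have "r * x < 2 * (pi / 2)" using that r by (intro mult_le_less_imp_less) auto
    then have "r * x < pi" by simp
    then show "sin (r * x) > 0" using that r by (intro sin_gt_zero) auto
    show "(r - 1) * x \<le> pi" using \<open>r * x < pi\<close> that by (simp add: algebra_simps)
    show "cos x > 0" using that by (auto intro!: cos_gt_zero_pi)
    show "sin x > 0" using that by (intro sin_gt_zero) auto
  qed
  have "h v \<le> h u"
  proof (rule minimum_of_monotone_factor[where h = h and v = v and u = u and p = "\<lambda>u. r * sin (r * u)" and M = M and b = "pi / 2"])
    show "0 < v" "v < pi / 2" using r by (auto simp: v_def field_simps)
    show "continuous_on {0..pi / 2} h"
      unfolding h_def using r by (intro continuous_intros continuous_on_cos_powr) auto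
    fix x :: real assume x: "0 < x" "x < pi / 2"
    show "0 \<le> r * sin (r * x)" using pos[OF x] r by simp
    have "((\<lambda>u. cos u powr r) has_real_derivative r * cos x powr (r - 1) * (- sin x)) (at x)"
      using DERIV_fun_powr[OF DERIV_cos pos(1)[OF x], of r] by simp
    then have "(h has_real_derivative r * cos x powr (r - 1) * (- sin x) - e * (- sin (r * x) * r)) (at x)"
      unfolding h_def using pos[OF x] by (auto intro!: derivative_eq_intros)
    moreover have "r * cos x powr (r - 1) * (- sin x) - e * (- sin (r * x) * r) = r * sin (r * x) * (M x - M v)"
      using pos[OF x] unfolding Mv by (simp add: M_def field_simps)
    ultimately show "(h has_real_derivative r * sin (r * x) * (M x - M v)) (at x)" by simp
  next
    fix x y :: real assume xy: "0 < x" "x \<le> y" "y < pi / 2"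
    show "M x \<le> M y"
    proof (rule DERIV_nonneg_imp_nondecreasing[OF xy(2)])
      fix z assume z: "x \<le> z" "z \<le> y"
      then have z': "0 < z" "z < pi / 2" using xy by auto
      have "(M has_real_derivative - (cos z powr (r - 1 - 1) *
         (sin ((r - 1) * z) * cos z - (r - 1) * sin z * cos ((r - 1) * z)) / (sin (r * z))\<^sup>2)) (at z)"
        using DERIV_minus[OF powr_quotient_deriv_cos[of z "r - 1"]] pos[OF z'] by (simp add: M_def[abs_def])
      moreover have "cos z powr (r - 1 - 1) *
         (sin ((r - 1) * z) * cos z - (r - 1) * sin z * cos ((r - 1) * z)) / (sin (r * z))\<^sup>2 \<le> 0"
        using sin_mult_cos_compare(2)[of z "r - 1"] pos[OF z'] z' r
        by (intro divide_nonpos_nonneg mult_nonneg_nonpos) auto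
      ultimately show "\<exists>D. (M has_real_derivative D) (at z) \<and> 0 \<le> D"
        by (meson neg_0_le_iff_le)
    qed
  qed (use u in auto)
  then show ?thesis by (simp add: h_def e_def rv v_def[symmetric])
qed

lemma sin_powr_tangent_lower:
  fixes r u :: real
  assumes r: "2 \<le> r" and u: "0 \<le> u" "u \<le> pi / r"
  shows "sin (pi / (2 * r)) powr r
     - sin (pi / (2 * r)) powr (r - 1) * cos (pi / (2 * r)) * cos (r * u) \<le> sin u powr r"
proof -
  define v where "v = pi / (2 * r)"
  define e where "e = sin v powr (r - 1) * cos v"
  define h where "h u = sin u powr r + e * cos (r * u)" for u
  define M where "M u = sin u powr (r - 1) * cos u / sin (r * u)" for u
  have b: "pi / r \<le> pi / 2" using r by (intro divide_left_mono) auto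
  have rv: "r * v = pi / 2" using r by (simp add: v_def)
  have Mv: "M v = e" by (simp add: M_def e_def rv)
  have pos: "cos x > 0" "sin (r * x) > 0" "sin x > 0" "(r - 1) * x \<le> pi" "x \<le> pi / 2"
      "(r - 2) * x \<le> pi"
    if "0 < x" "x < pi / r" for x
  proof -
    have "r * x < pi" using that r by (simp add: field_simps)
    then show "sin (r * x) > 0" using that r by (intro sin_gt_zero) auto
    show "(r - 1) * x \<le> pi" "(r - 2) * x \<le> pi" using \<open>r * x < pi\<close> that by (simp_all add: algebra_simps)
    have "x < pi / 2" "- (pi / 2) < x" using that b pi_gt_zero by linarith+
    then show "cos x > 0" "x \<le> pi / 2" by (auto intro: cos_gt_zero_pi)
    show "sin x > 0" using that b pi_gt_zero by (intro sin_gt_zero) linarith+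
  qed
  have "h v \<le> h u"
  proof (rule minimum_of_monotone_factor[where h = h and v = v and u = u and p = "\<lambda>u. r * sin (r * u)" and M = M and b = "pi / r"])
    show "0 < v" "v < pi / r" using r by (auto simp: v_def field_simps)
    show "continuous_on {0..pi / r} h"
      unfolding h_def using r b pi_gt_zero
      by (intro continuous_on_add continuous_on_sin_powr continuous_intros) linarith+
    fix x assume x: "0 < x" "x < pi / r"
    show "0 \<le> r * sin (r * x)" using pos[OF x] r by simp
    have "((\<lambda>u. sin u powr r) has_real_derivative r * sin x powr (r - 1) * cos x) (at x)"
      using DERIV_fun_powr[OF DERIV_sin pos(3)[OF x], of r] by simp
    then have "(h has_real_derivative r * sin x powr (r - 1) * cos x + e * (- sin (r * x) * r)) (at x)"
      unfolding h_def using pos[OF x] by (auto intro!: derivative_eq_intros)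
    moreover have "r * sin x powr (r - 1) * cos x + e * (- sin (r * x) * r) = r * sin (r * x) * (M x - M v)"
      using pos[OF x] unfolding Mv by (simp add: M_def field_simps)
    ultimately show "(h has_real_derivative r * sin (r * x) * (M x - M v)) (at x)" by simp
  next
    fix x y assume xy: "0 < x" "x \<le> y" "y < pi / r"
    show "M x \<le> M y"
    proof (rule DERIV_nonneg_imp_nondecreasing[OF xy(2)])
      fix z assume z: "x \<le> z" "z \<le> y"
      then have z': "0 < z" "z < pi / r" using xy by auto
      have "(M has_real_derivative sin z powr (r - 1 - 1) *
         ((r - 1) * sin ((r - 1) * z) * cos z - sin z * cos ((r - 1) * z)) / (sin (r * z))\<^sup>2) (at z)"
        using powr_quotient_deriv_sin[of z "r - 1"] pos[OF z'] by (simp add: M_def[abs_def])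
      moreover have "0 \<le> (r - 1) * sin ((r - 1) * z) * cos z - sin z * cos ((r - 1) * z)"
      proof -
        \<comment> \<open>With the factor \<open>r - 1\<close> lowered to \<open>1\<close>, the
          numerator becomes \<open>sin ((r - 1) * z - z)\<close> by the addition theorem.\<close>
        have "0 \<le> sin ((r - 2) * z)" using pos[OF z'] z' r by (intro sin_ge_zero) auto
        also have "(r - 2) * z = (r - 1) * z - z" by (simp add: algebra_simps)
        finally have "sin z * cos ((r - 1) * z) \<le> 1 * (sin ((r - 1) * z) * cos z)"
          by (simp add: sin_diff mult.commute)
        also have "\<dots> \<le> (r - 1) * (sin ((r - 1) * z) * cos z)"
          using pos[OF z'] z' r
          by (intro mult_right_mono mult_nonneg_nonneg sin_ge_zero) auto
        finally show ?thesis by (simp add: mult.assoc)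
      qed
      then have "0 \<le> sin z powr (r - 1 - 1) *
         ((r - 1) * sin ((r - 1) * z) * cos z - sin z * cos ((r - 1) * z)) / (sin (r * z))\<^sup>2"
        by (intro divide_nonneg_nonneg mult_nonneg_nonneg) auto
      ultimately show "\<exists>D. (M has_real_derivative D) (at z) \<and> 0 \<le> D" by blast
    qed
  qed (use u in auto)
  then show ?thesis by (simp add: h_def e_def rv v_def[symmetric])
qed

section \<open>Angular profiles and their monotonicity along vertical lines\<close>

definition angle :: "complex \<Rightarrow> real" where
  "angle w = arccos (Re w / norm w)"

text \<open>For \<open>s \<ge> 1\<close> the homogeneous extension is \<open>- Re (w powr s)\<close>
  in the sector of half-angle \<open>pi / s\<close> around the positive axis and
  \<open>norm w powr s\<close> outside. The pieces meet at \<open>s * t = pi\<close> with equal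
  value and equal slope, so the cap preserves subharmonicity.\<close>

definition phi_hi :: "real \<Rightarrow> real \<Rightarrow> real" where
  "phi_hi s t = - cos (min (s * t) pi)"

text \<open>The extension is \<open>Re (w powr s)\<close> for the principal power. For
  \<open>0 < s \<le> 1\<close> its crease along the negative axis opens upwards, as subharmonicity
  demands.\<close>

definition phi_lo :: "real \<Rightarrow> real \<Rightarrow> real" where
  "phi_lo s t = cos (s * t)"

text \<open>\<open>\<phi>\<close> as a function of the angle; the homogeneous extension is nondecreasing along vertical
  segments of the upper half plane, so a point of the disc can be moved to the unit circle without
  changing its real part.\<close>

definition vertical_mono :: "real \<Rightarrow> (real \<Rightarrow> real) \<Rightarrow> bool" where
  "vertical_mono s \<phi> \<longleftrightarrow> (\<forall>x t. 0 \<le> x \<longrightarrow> x \<le> 1 \<longrightarrow> 0 \<le> t \<longrightarrow> t \<le> pi \<longrightarrow>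
     x powr s * \<phi> t \<le> \<phi> (arccos (x * cos t)))"

text \<open>On a vertical line the modulus of a point of angle \<open>t\<close> is proportional to
  \<open>1 / \<bar>cos t\<bar>\<close>, so this function is, up to a constant factor, the extension
  of \<open>cos (s * t)\<close> along that line. The direction of monotonicity depends only on the
  sign of \<open>sin ((s - 1) * t)\<close> and on the side of the imaginary axis.\<close>

lemma cos_mult_div_powr_deriv:
  fixes s t :: real
  assumes "cos t \<noteq> 0"
  shows "((\<lambda>t. cos (s * t) * \<bar>cos t\<bar> powr - s) has_real_derivative
     - (s * sgn (cos t) * \<bar>cos t\<bar> powr (- s - 1) * sin ((s - 1) * t))) (at t)"
proof -
  define P where "P = \<bar>cos t\<bar> powr (- s - 1)"
  have pw: "\<bar>cos t\<bar> powr - s = P * \<bar>cos t\<bar>"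
    using assms powr_mult_base[of "\<bar>cos t\<bar>" "- s - 1"] by (simp add: P_def mult.commute)
  have dabs: "((\<lambda>t. \<bar>cos t\<bar>) has_real_derivative sgn (cos t) * (- sin t)) (at t)"
  proof (rule has_field_derivative_transform_within_open)
    show "((\<lambda>x. sgn (cos t) * cos x) has_real_derivative sgn (cos t) * (- sin t)) (at t)"
      by (auto intro!: derivative_eq_intros)
    show "open {x. 0 < sgn (cos t) * cos x}"
      by (intro open_Collect_less continuous_intros)
    show "t \<in> {x. 0 < sgn (cos t) * cos x}"
      using assms by (simp flip: abs_sgn[of "cos t"] mult.commute)
    show "sgn (cos t) * cos x = \<bar>cos x\<bar>" if "x \<in> {x. 0 < sgn (cos t) * cos x}" for x
      using that by (auto simp: sgn_real_def split: if_splits)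
  qed
  have "((\<lambda>t. cos (s * t) * \<bar>cos t\<bar> powr - s) has_real_derivative
     (- sin (s * t) * s) * \<bar>cos t\<bar> powr - s
       + (- s * \<bar>cos t\<bar> powr (- s - 1) * (sgn (cos t) * (- sin t))) * cos (s * t)) (at t)"
    using DERIV_fun_powr[OF dabs, of "- s"] assms
    by (auto intro!: derivative_eq_intros dabs)
  moreover have "(- sin (s * t) * s) * \<bar>cos t\<bar> powr - s
       + (- s * \<bar>cos t\<bar> powr (- s - 1) * (sgn (cos t) * (- sin t))) * cos (s * t)
     = - (s * sgn (cos t) * P * (sin (s * t) * cos t - cos (s * t) * sin t))"
    unfolding pw P_def[symmetric] by (simp add: abs_sgn[of "cos t"] algebra_simps)
  moreover have "sin (s * t) * cos t - cos (s * t) * sin t = sin ((s - 1) * t)"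
    by (simp add: sin_diff left_diff_distrib)
  ultimately show ?thesis by (simp add: P_def)
qed

lemma cos_div_powr_mono_left:
  assumes s: "1 \<le> s" and t: "0 \<le> t" "t \<le> t'" "t' < pi / 2" "s * t' \<le> pi"
  shows "cos (s * t') * \<bar>cos t'\<bar> powr - s \<le> cos (s * t) * \<bar>cos t\<bar> powr - s"
proof (rule DERIV_nonpos_imp_nonincreasing[OF t(2)])
  fix x assume x: "t \<le> x" "x \<le> t'"
  have c: "cos x > 0" using x t by (intro cos_gt_zero_pi) auto
  have "s * x \<le> pi" using x t s mult_left_mono[of x t' s] by linarith
  then have "(s - 1) * x \<le> pi" using x t by (simp add: left_diff_distrib)
  moreover have "0 \<le> (s - 1) * x" using x t s by (intro mult_nonneg_nonneg) auto
  ultimately have "- (s * sgn (cos x) * \<bar>cos x\<bar> powr (- s - 1) * sin ((s - 1) * x)) \<le> 0"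
    using c s by (simp add: sin_ge_zero)
  then show "\<exists>y. ((\<lambda>a. cos (s * a) * \<bar>cos a\<bar> powr - s) has_real_derivative y) (at x) \<and> y \<le> 0"
    using cos_mult_div_powr_deriv[of x s] c by force
qed

lemma cos_div_powr_mono_right:
  assumes s: "1 \<le> s" and t: "pi / 2 < t'" "t' \<le> t" "t \<le> pi" "s * t \<le> pi"
  shows "cos (s * t') * \<bar>cos t'\<bar> powr - s \<le> cos (s * t) * \<bar>cos t\<bar> powr - s"
proof (rule DERIV_nonneg_imp_nondecreasing[OF t(2)])
  fix x assume x: "t' \<le> x" "x \<le> t"
  have "0 < cos (pi - x)" using x t by (intro cos_gt_zero_pi) auto
  then have c: "cos x < 0" by simp
  have x0: "0 < x" using x t pi_gt_zero by linarith
  have "s * x \<le> pi" using x t s mult_left_mono[of x t s] by linarith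
  then have "(s - 1) * x \<le> pi" using x0 by (simp add: left_diff_distrib)
  moreover have "0 \<le> (s - 1) * x" using x0 s by (intro mult_nonneg_nonneg) auto
  ultimately have "0 \<le> - (s * sgn (cos x) * \<bar>cos x\<bar> powr (- s - 1) * sin ((s - 1) * x))"
    using c s by (simp add: sin_ge_zero)
  then show "\<exists>y. ((\<lambda>a. cos (s * a) * \<bar>cos a\<bar> powr - s) has_real_derivative y) (at x) \<and> 0 \<le> y"
    using cos_mult_div_powr_deriv[of x s] c by force
qed

lemma sin_nonpos_of_le_one:
  fixes s x :: real
  assumes "0 < s" "s \<le> 1" "0 \<le> x" "x \<le> pi"
  shows "sin ((s - 1) * x) \<le> 0"
proof -
  have "(1 - s) * x \<le> 1 * x" using assms by (intro mult_right_mono) auto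
  then have "0 \<le> sin ((1 - s) * x)"
    using assms by (intro sin_ge_zero mult_nonneg_nonneg) auto
  moreover have "(s - 1) * x = - ((1 - s) * x)" by (simp add: algebra_simps)
  ultimately show ?thesis by simp
qed

lemma cos_div_powr_mono_left_lo:
  assumes s: "0 < s" "s \<le> 1" and t: "0 \<le> t" "t \<le> t'" "t' < pi / 2"
  shows "cos (s * t) * \<bar>cos t\<bar> powr - s \<le> cos (s * t') * \<bar>cos t'\<bar> powr - s"
proof (rule DERIV_nonneg_imp_nondecreasing[OF t(2)])
  fix x assume x: "t \<le> x" "x \<le> t'"
  have c: "cos x > 0" using x t by (intro cos_gt_zero_pi) auto
  have "sin ((s - 1) * x) \<le> 0" using x t s by (intro sin_nonpos_of_le_one) auto
  then have "0 \<le> - (s * sgn (cos x) * \<bar>cos x\<bar> powr (- s - 1) * sin ((s - 1) * x))"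
    using c s by (simp add: mult_nonneg_nonpos)
  then show "\<exists>y. ((\<lambda>a. cos (s * a) * \<bar>cos a\<bar> powr - s) has_real_derivative y) (at x) \<and> 0 \<le> y"
    using cos_mult_div_powr_deriv[of x s] c by force
qed

lemma cos_div_powr_mono_right_lo:
  assumes s: "0 < s" "s \<le> 1" and t: "pi / 2 < t'" "t' \<le> t" "t \<le> pi"
  shows "cos (s * t) * \<bar>cos t\<bar> powr - s \<le> cos (s * t') * \<bar>cos t'\<bar> powr - s"
proof (rule DERIV_nonpos_imp_nonincreasing[OF t(2)])
  fix x assume x: "t' \<le> x" "x \<le> t"
  have "0 < cos (pi - x)" using x t by (intro cos_gt_zero_pi) auto
  then have c: "cos x < 0" by simp
  have x0: "0 < x" using x t pi_gt_zero by linarith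
  have "sin ((s - 1) * x) \<le> 0" using x0 x t s by (intro sin_nonpos_of_le_one) auto
  then have "- (s * sgn (cos x) * \<bar>cos x\<bar> powr (- s - 1) * sin ((s - 1) * x)) \<le> 0"
    using c s by (simp add: mult_nonneg_nonpos)
  then show "\<exists>y. ((\<lambda>a. cos (s * a) * \<bar>cos a\<bar> powr - s) has_real_derivative y) (at x) \<and> y \<le> 0"
    using cos_mult_div_powr_deriv[of x s] c by force
qed

text \<open>With \<open>x cos t = cos t'\<close>, the factor \<open>x\<^sup>s\<close> is a quotient of powers of cosines.\<close>

lemma vertical_monoI:
  assumes s: "0 < s" and half: "0 \<le> \<phi> (pi / 2)"
    and left: "\<And>t t'. 0 \<le> t \<Longrightarrow> t \<le> t' \<Longrightarrow> t' < pi / 2 \<Longrightarrow>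
       (cos t' / cos t) powr s * \<phi> t \<le> \<phi> t'"
    and right: "\<And>t t'. pi / 2 < t' \<Longrightarrow> t' \<le> t \<Longrightarrow> t \<le> pi \<Longrightarrow>
       (cos t' / cos t) powr s * \<phi> t \<le> \<phi> t'"
  shows "vertical_mono s \<phi>"
  unfolding vertical_mono_def
proof (intro allI impI)
  fix x t :: real assume x: "0 \<le> x" "x \<le> 1" and t: "0 \<le> t" "t \<le> pi"
  define t' where "t' = arccos (x * cos t)"
  have "\<bar>x * cos t\<bar> \<le> 1 * 1" unfolding abs_mult using x by (intro mult_mono) auto
  then have b: "-1 \<le> x * cos t" "x * cos t \<le> 1" by linarith+
  then have ct': "cos t' = x * cos t" and t': "0 \<le> t'" "t' \<le> pi"
    by (auto simp: t'_def intro: arccos_lbound arccos_ubound)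
  show "x powr s * \<phi> t \<le> \<phi> (arccos (x * cos t))"
  proof (cases "x = 0 \<or> cos t = 0")
    case True
    then have "t' = pi / 2" by (auto simp: t'_def)
    moreover have "x powr s * \<phi> t \<le> \<phi> (pi / 2)"
    proof (cases "x = 0")
      case False
      with True have "cos t = cos (pi / 2)" by simp
      then have t2: "t = pi / 2" using t cos_inj_pi[of t "pi / 2"] by auto
      have "x powr s \<le> 1" using x s by (simp add: powr_le1)
      then show ?thesis unfolding t2 using half mult_right_mono[of "x powr s" 1 "\<phi> (pi / 2)"] by simp
    qed (use half in simp)
    ultimately show ?thesis unfolding t'_def[symmetric] by (simp only:)
  next
    case False
    then have xc: "x = cos t' / cos t" "x > 0" "cos t \<noteq> 0" using ct' x by auto
    show ?thesis
    proof (cases "cos t > 0")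
      case True
      then have "cos t' > 0" using xc(2) ct' by (simp add: zero_less_mult_iff)
      moreover have "cos t' \<le> 0" if "pi / 2 \<le> t'"
        using t' that cos_monotone_0_pi_le[of "pi / 2" t'] by simp
      ultimately have "t' < pi / 2" by linarith
      moreover have "t \<le> t'"
      proof (rule ccontr)
        assume "\<not> t \<le> t'"
        then have "cos t < cos t'" using t t' by (intro cos_monotone_0_pi) auto
        then show False using ct' True x mult_right_mono[of x 1 "cos t"] by simp
      qed
      ultimately have "(cos t' / cos t) powr s * \<phi> t \<le> \<phi> t'" using t by (intro left)
      then show ?thesis by (simp only: t'_def[symmetric] xc(1)[symmetric])
    next
      case f: False
      then have cneg: "cos t < 0" using xc by simp
      then have "cos t' < 0" using xc ct' by (simp add: mult_pos_neg)
      moreover have "cos t' \<ge> 0" if "t' \<le> pi / 2"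
        using t' that by (intro cos_ge_zero) auto
      ultimately have "pi / 2 < t'" by linarith
      moreover have "t' \<le> t"
      proof (rule ccontr)
        assume "\<not> t' \<le> t"
        then have "cos t' < cos t" using t t' by (intro cos_monotone_0_pi) auto
        then show False using ct' cneg x mult_right_mono_neg[of x 1 "cos t"] by simp
      qed
      ultimately have "(cos t' / cos t) powr s * \<phi> t \<le> \<phi> t'" using t by (intro right)
      then show ?thesis by (simp only: t'_def[symmetric] xc(1)[symmetric])
    qed
  qed
qed

lemma powr_ratio_le_iff:
  fixes a b s A B :: real
  assumes "a \<noteq> 0" "b \<noteq> 0" "0 < a / b"
  shows "(a / b) powr s * A \<le> B \<longleftrightarrow> A * \<bar>b\<bar> powr - s \<le> B * \<bar>a\<bar> powr - s"
proof -
  have "(a / b) powr s = \<bar>a\<bar> powr s / \<bar>b\<bar> powr s"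
    using assms by (metis abs_divide abs_ge_zero abs_of_pos powr_divide)
  moreover have "\<bar>a\<bar> powr s > 0" "\<bar>b\<bar> powr s > 0" using assms by auto
  ultimately show ?thesis
    by (simp only: powr_minus) (simp add: field_simps)
qed

lemma vertical_mono_phi_lo:
  assumes s: "0 < s" "s \<le> 1"
  shows "vertical_mono s (phi_lo s)"
proof (rule vertical_monoI[OF s(1)])
  have "s * (pi / 2) \<le> 1 * (pi / 2)" using s by (intro mult_right_mono) auto
  then show "0 \<le> phi_lo s (pi / 2)"
    unfolding phi_lo_def using s by (intro cos_ge_zero) (auto intro: order_trans[of _ 0])
next
  fix t t' :: real assume t: "0 \<le> t" "t \<le> t'" "t' < pi / 2"
  then have "cos t > 0" "cos t' > 0" by (auto intro!: cos_gt_zero_pi)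
  then show "(cos t' / cos t) powr s * phi_lo s t \<le> phi_lo s t'"
    using cos_div_powr_mono_left_lo[OF s t] by (subst powr_ratio_le_iff) (auto simp: phi_lo_def)
next
  fix t t' :: real assume t: "pi / 2 < t'" "t' \<le> t" "t \<le> pi"
  then have "cos (pi - t) > 0" "cos (pi - t') > 0" by (intro cos_gt_zero_pi; linarith)+
  then show "(cos t' / cos t) powr s * phi_lo s t \<le> phi_lo s t'"
    using cos_div_powr_mono_right_lo[OF s t]
    by (subst powr_ratio_le_iff) (auto simp: phi_lo_def divide_neg_neg)
qed

lemma phi_hi_le_one: "phi_hi s t \<le> 1"
  by (simp add: phi_hi_def minus_le_iff)

lemma phi_hi_eq_one: "pi \<le> s * t \<Longrightarrow> phi_hi s t = 1"
  by (simp add: phi_hi_def min_def)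

lemma vertical_mono_phi_hi:
  assumes s: "1 \<le> s"
  shows "vertical_mono s (phi_hi s)"
proof (rule vertical_monoI)
  show "0 < s" using s by simp
  have "1 * (pi / 2) \<le> s * (pi / 2)" using s by (intro mult_right_mono) auto
  then have "pi / 2 \<le> min (s * (pi / 2)) pi" by (simp add: min_def)
  then have "0 \<le> cos (pi - min (s * (pi / 2)) pi)"
    by (intro cos_ge_zero) linarith+
  then show "0 \<le> phi_hi s (pi / 2)" by (simp add: phi_hi_def)
next
  fix t t' :: real assume t: "0 \<le> t" "t \<le> t'" "t' < pi / 2"
  then have c: "cos t > 0" "cos t' > 0" by (auto intro!: cos_gt_zero_pi)
  have cc: "cos t' \<le> cos t" using t by (intro cos_monotone_0_pi_le) auto
  then have le1: "(cos t' / cos t) powr s \<le> 1" using c s by (intro powr_le1) auto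
  show "(cos t' / cos t) powr s * phi_hi s t \<le> phi_hi s t'"
  proof (cases "pi \<le> s * t'")
    case True
    have "(cos t' / cos t) powr s * phi_hi s t \<le> (cos t' / cos t) powr s * 1"
      by (intro mult_left_mono phi_hi_le_one) auto
    then show ?thesis using True le1 by (simp add: phi_hi_eq_one)
  next
    case False
    moreover have "s * t \<le> s * t'" using s t by (intro mult_left_mono) auto
    ultimately have "min (s * t) pi = s * t" "min (s * t') pi = s * t'" "s * t' \<le> pi" by auto
    then show ?thesis
      using c cos_div_powr_mono_left[OF s t] by (subst powr_ratio_le_iff) (auto simp: phi_hi_def)
  qed
next
  fix t t' :: real assume t: "pi / 2 < t'" "t' \<le> t" "t \<le> pi"
  have neg: "cos x < 0" if "pi / 2 < x" "x \<le> pi" for x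
    using cos_gt_zero_pi[of "pi - x"] that by auto
  have c: "cos t < 0" "cos t' < 0" using neg t by auto
  have base: "(cos t' / cos u) powr s * phi_hi s u \<le> phi_hi s t'"
    if u: "t' \<le> u" "u \<le> pi" "s * u \<le> pi" for u
  proof -
    have "s * t' \<le> s * u" using s u by (intro mult_left_mono) auto
    then have "min (s * u) pi = s * u" "min (s * t') pi = s * t'" using u by auto
    moreover have "cos u < 0" using neg[of u] u t by auto
    ultimately show ?thesis
      using c cos_div_powr_mono_right[OF s t(1) u]
      by (subst powr_ratio_le_iff) (auto simp: phi_hi_def divide_neg_neg)
  qed
  have le1: "(cos t' / cos u) powr s \<le> 1" if u: "t' \<le> u" "u \<le> pi" for u
  proof -
    have "cos u \<le> cos t'" using u t by (intro cos_monotone_0_pi_le) auto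
    moreover have "cos u < 0" using neg[of u] u t by auto
    ultimately show ?thesis using c s by (intro powr_le1) (auto simp: divide_nonpos_neg divide_le_eq)
  qed
  show "(cos t' / cos t) powr s * phi_hi s t \<le> phi_hi s t'"
  proof (cases "pi \<le> s * t'")
    case True
    have "(cos t' / cos t) powr s * phi_hi s t \<le> (cos t' / cos t) powr s * 1"
      by (intro mult_left_mono phi_hi_le_one) auto
    then show ?thesis using True le1[of t] t by (simp add: phi_hi_eq_one)
  next
    case False
    \<comment> \<open>The segment may cross the ray where \<open>phi_hi\<close> becomes constant. Up
      to the angle \<open>u\<close> the cosine formula applies; from \<open>u\<close> to
      \<open>t\<close> the profile stays \<open>1\<close>, while the factor can only shrink because
      \<open>cos t \<le> cos u < 0\<close>.\<close>
    define u where "u = min t (pi / s)"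
    have st: "t' < pi / s" using False s by (simp add: field_simps)
    have u: "t' \<le> u" "u \<le> pi" "s * u \<le> pi" "u \<le> t" using st t s by (auto simp: u_def field_simps min_def)
    have "phi_hi s u = phi_hi s t" using s by (auto simp: u_def phi_hi_def min_def field_simps)
    have cu: "cos u < 0" "cos t \<le> cos u"
      using neg[of u] u t cos_monotone_0_pi_le[of u t] by auto
    show ?thesis
    proof (cases "s * t \<le> pi")
      case True then show ?thesis using base[of t] t by simp
    next
      case f: False
      then have p1: "phi_hi s t = 1" by (intro phi_hi_eq_one) simp
      have "cos t' / cos t \<le> cos t' / cos u"
        using divide_left_mono[of "- cos u" "- cos t" "- cos t'"] c cu by (simp add: mult_neg_neg)
      then have "(cos t' / cos t) powr s \<le> (cos t' / cos u) powr s"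
        using c cu s by (intro powr_mono2) (auto simp: divide_nonpos_neg)
      with base[OF u(1-3)] show ?thesis using p1 \<open>phi_hi s u = phi_hi s t\<close> by simp
    qed
  qed
qed

definition homog :: "real \<Rightarrow> (real \<Rightarrow> real) \<Rightarrow> complex \<Rightarrow> real" where
  "homog s \<phi> w = norm w powr s * \<phi> (angle w)"

lemma abs_Re_div_norm_le_one: "\<bar>Re w / norm w\<bar> \<le> 1"
  by (cases "w = 0") (auto simp: abs_Re_le_cmod divide_le_eq)

lemma Re_div_norm_bounds: "-1 \<le> Re w / norm w" "Re w / norm w \<le> 1"
  using abs_Re_div_norm_le_one[of w] by linarith+

lemma angle_bounds: "0 \<le> angle w" "angle w \<le> pi"
  unfolding angle_def by (intro arccos_lbound arccos_ubound Re_div_norm_bounds)+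

lemma cos_angle: "cos (angle w) = Re w / norm w"
  unfolding angle_def by (intro cos_arccos Re_div_norm_bounds)

lemma norm_mult_cos_angle: "norm w * cos (angle w) = Re w"
  by (cases "w = 0") (auto simp: cos_angle)

lemma angle_scale: "0 < r \<Longrightarrow> angle (of_real r * w) = angle w"
  by (simp add: angle_def norm_mult)

lemma homog_scale:
  "0 \<le> r \<Longrightarrow> homog s \<phi> (of_real r * w) = r powr s * homog s \<phi> w"
  by (cases "r = 0") (auto simp: homog_def angle_scale norm_mult powr_mult)

lemma homog_zero [simp]: "homog s \<phi> 0 = 0"
  by (simp add: homog_def)

text \<open>The bound \<open>G\<close> depends on the real part only, and moving \<open>w\<close>
  vertically to the unit circle does not decrease the extension; so the circle is the worst
  case.\<close>

lemma le_disc_of_le_circle: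
  assumes "vertical_mono s \<phi>" "0 \<le> c"
    and G: "\<And>t. 0 \<le> t \<Longrightarrow> t \<le> pi \<Longrightarrow> c * \<phi> t \<le> G (cos t)"
    and w: "norm w \<le> 1"
  shows "c * homog s \<phi> w \<le> G (Re w)"
proof -
  define x where "x = norm w * cos (angle w)"
  have "\<bar>x\<bar> \<le> 1" using w abs_Re_le_cmod[of w] by (simp add: x_def norm_mult_cos_angle)
  then have x: "-1 \<le> x" "x \<le> 1" by linarith+
  have "homog s \<phi> w \<le> \<phi> (arccos x)"
    using assms(1) w angle_bounds[of w] by (auto simp: vertical_mono_def homog_def x_def)
  then have "c * homog s \<phi> w \<le> c * \<phi> (arccos x)" using assms(2) by (rule mult_left_mono)
  also have "\<dots> \<le> G (cos (arccos x))" using x by (intro G arccos_lbound arccos_ubound)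
  also have "cos (arccos x) = Re w" using x by (simp add: x_def norm_mult_cos_angle)
  finally show ?thesis .
qed

section \<open>Two-sided pointwise bounds for powers of \<open>norm (a + cnj b)\<close>\<close>

lemma sq_powr: "0 \<le> x \<Longrightarrow> (x\<^sup>2) powr s = x powr (2 * s)"
  for x :: real
  by (cases "x = 0") (auto simp: powr_powr simp flip: powr_numeral)

lemma one_plus_cos_powr:
  assumes "0 \<le> t" "t \<le> pi"
  shows "(1 + cos t) powr s = 2 powr s * cos (t / 2) powr (2 * s)"
proof -
  have "1 + cos t = 2 * (cos (t / 2))\<^sup>2" using cos_double_cos[of "t / 2"] by simp
  moreover have "cos (t / 2) \<ge> 0" using assms by (intro cos_ge_zero) auto
  ultimately show ?thesis by (simp add: powr_mult sq_powr)
qed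

lemma one_minus_cos_powr:
  assumes "0 \<le> t" "t \<le> pi"
  shows "(1 - cos t) powr s = 2 powr s * sin (t / 2) powr (2 * s)"
proof -
  have "1 - cos t = 2 * (sin (t / 2))\<^sup>2" using cos_double_sin[of "t / 2"] by simp
  moreover have "sin (t / 2) \<ge> 0" using assms by (intro sin_ge_zero) auto
  ultimately show ?thesis by (simp add: powr_mult sq_powr)
qed

text \<open>With \<open>t = 2 * u\<close> and \<open>r = 2 * s\<close> this is
  \<open>cos_powr_tangent_upper\<close> as long as \<open>s * t \<le> pi\<close>; equality holds at
  \<open>t = pi / (2 * s)\<close>, where the profile vanishes. Beyond that range
  \<open>phi_hi\<close> stays \<open>1\<close> while \<open>cos (t / 2)\<close> decreases, so the
  value at the end of the range suffices.\<close>

lemma one_plus_cos_powr_upper: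
  assumes s: "1 \<le> s"
  obtains c where "0 \<le> c" "\<And>t. 0 \<le> t \<Longrightarrow> t \<le> pi \<Longrightarrow>
     c * phi_hi s t \<le> (1 + cos (pi / (2 * s))) powr s - (1 + cos t) powr s"
proof
  define v where "v = pi / (2 * (2 * s))"
  define e where "e = cos v powr (2 * s - 1) * sin v"
  have v: "0 \<le> v" "v \<le> pi / 2" using s by (auto simp: v_def field_simps)
  have pv: "0 \<le> pi / (2 * s)" "pi / (2 * s) \<le> pi" using s by (auto simp: field_simps)
  have e: "e \<ge> 0" unfolding e_def using v by (intro mult_nonneg_nonneg sin_ge_zero) auto
  then show "0 \<le> 2 powr s * e" by simp
  have tan: "cos u powr (2 * s) \<le> cos v powr (2 * s) + e * cos (2 * s * u)" if "0 \<le> u" "u \<le> pi / (2 * s)" for u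
    using cos_powr_tangent_upper[of "2 * s" u] s that by (simp add: v_def e_def)
  have K: "(1 + cos (pi / (2 * s))) powr s = 2 powr s * cos v powr (2 * s)"
    using one_plus_cos_powr[OF pv, of s] by (simp add: v_def)
  fix t :: real assume t: "0 \<le> t" "t \<le> pi"
  have "e * phi_hi s t \<le> cos v powr (2 * s) - cos (t / 2) powr (2 * s)"
  proof (cases "s * t \<le> pi")
    case True
    then show ?thesis using tan[of "t / 2"] s t by (simp add: phi_hi_def field_simps)
  next
    case False
    then have "pi / (2 * s) \<le> t / 2" using s by (simp add: field_simps)
    then have "cos (t / 2) \<le> cos (pi / (2 * s))" using t pv by (intro cos_monotone_0_pi_le) auto
    moreover have "0 \<le> cos (t / 2)" using t by (intro cos_ge_zero) auto
    ultimately have "cos (t / 2) powr (2 * s) \<le> cos (pi / (2 * s)) powr (2 * s)"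
      using s by (intro powr_mono2) auto
    also have "\<dots> \<le> cos v powr (2 * s) - e"
      using tan[of "pi / (2 * s)"] s by simp
    finally show ?thesis using False by (simp add: phi_hi_eq_one)
  qed
  then have "2 powr s * (e * phi_hi s t) \<le> 2 powr s * (cos v powr (2 * s) - cos (t / 2) powr (2 * s))"
    by (rule mult_left_mono) simp
  then show "2 powr s * e * phi_hi s t \<le> (1 + cos (pi / (2 * s))) powr s - (1 + cos t) powr s"
    unfolding K one_plus_cos_powr[OF t] by (simp add: algebra_simps)
qed

text \<open>Half-angle form of \<open>sin_powr_tangent_lower\<close>. It is applied at
  \<open>- w\<close>, which turns \<open>1 - cos t\<close> into the \<open>1 + Re w\<close> that
  \<open>norm_add_cnj_powr_lower_hi\<close> asks for.\<close>

lemma one_minus_cos_powr_lower: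
  assumes s: "1 \<le> s"
  obtains c where "0 \<le> c" "\<And>t. 0 \<le> t \<Longrightarrow> t \<le> pi \<Longrightarrow>
     c * phi_hi s t \<le> (1 - cos t) powr s - (1 - cos (pi / (2 * s))) powr s"
proof
  define v where "v = pi / (2 * (2 * s))"
  define e where "e = sin v powr (2 * s - 1) * cos v"
  have v: "0 \<le> v" "v \<le> pi / 2" using s by (auto simp: v_def field_simps)
  have pv: "0 \<le> pi / (2 * s)" "pi / (2 * s) \<le> pi / 2" using s by (auto simp: field_simps)
  have e: "e \<ge> 0" unfolding e_def using v by (intro mult_nonneg_nonneg cos_ge_zero) auto
  then show "0 \<le> 2 powr s * e" by simp
  have tan: "sin v powr (2 * s) - e * cos (2 * s * u) \<le> sin u powr (2 * s)" if "0 \<le> u" "u \<le> pi / (2 * s)" for u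
    using sin_powr_tangent_lower[of "2 * s" u] s that by (simp add: v_def e_def)
  have K: "(1 - cos (pi / (2 * s))) powr s = 2 powr s * sin v powr (2 * s)"
    using one_minus_cos_powr[of "pi / (2 * s)" s] pv by (simp add: v_def)
  fix t :: real assume t: "0 \<le> t" "t \<le> pi"
  have "e * phi_hi s t \<le> sin (t / 2) powr (2 * s) - sin v powr (2 * s)"
  proof (cases "s * t \<le> pi")
    case True
    then show ?thesis using tan[of "t / 2"] s t by (simp add: phi_hi_def field_simps)
  next
    case False
    then have "pi / (2 * s) \<le> t / 2" using s by (simp add: field_simps)
    then have "sin (pi / (2 * s)) \<le> sin (t / 2)" using t pv by (intro sin_monotone_2pi_le) auto
    moreover have "0 \<le> sin (pi / (2 * s))" using pv by (intro sin_ge_zero) auto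
    ultimately have "sin (pi / (2 * s)) powr (2 * s) \<le> sin (t / 2) powr (2 * s)"
      using s by (intro powr_mono2) auto
    moreover have "sin v powr (2 * s) + e \<le> sin (pi / (2 * s)) powr (2 * s)"
      using tan[of "pi / (2 * s)"] s by simp
    ultimately show ?thesis using False by (simp add: phi_hi_eq_one)
  qed
  then have "2 powr s * (e * phi_hi s t) \<le> 2 powr s * (sin (t / 2) powr (2 * s) - sin v powr (2 * s))"
    by (rule mult_left_mono) simp
  then show "2 powr s * e * phi_hi s t \<le> (1 - cos t) powr s - (1 - cos (pi / (2 * s))) powr s"
    unfolding K one_minus_cos_powr[OF t] by (simp add: algebra_simps)
qed

text \<open>Half-angle form of \<open>cos_powr_tangent_lower\<close>. Here
  \<open>s * t \<le> pi\<close> for every admissible \<open>t\<close>, so the uncapped profile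
  \<open>phi_lo\<close> serves.\<close>

lemma one_plus_cos_powr_lower:
  assumes s: "1 / 2 < s" "s \<le> 1"
  obtains c where "0 \<le> c" "\<And>t. 0 \<le> t \<Longrightarrow> t \<le> pi \<Longrightarrow>
     c * phi_lo s t \<le> (1 + cos t) powr s - (1 + cos (pi / (2 * s))) powr s"
proof
  define v where "v = pi / (2 * (2 * s))"
  define e where "e = cos v powr (2 * s - 1) * sin v"
  have v: "0 \<le> v" "v \<le> pi / 2" using s by (auto simp: v_def field_simps)
  have pv: "0 \<le> pi / (2 * s)" "pi / (2 * s) \<le> pi" using s by (auto simp: field_simps)
  have e: "e \<ge> 0" unfolding e_def using v by (intro mult_nonneg_nonneg sin_ge_zero) auto
  then show "0 \<le> 2 powr s * e" by simp
  have K: "(1 + cos (pi / (2 * s))) powr s = 2 powr s * cos v powr (2 * s)"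
    using one_plus_cos_powr[OF pv, of s] by (simp add: v_def)
  fix t :: real assume t: "0 \<le> t" "t \<le> pi"
  have "cos v powr (2 * s) + e * cos (2 * s * (t / 2)) \<le> cos (t / 2) powr (2 * s)"
    using cos_powr_tangent_lower[of "2 * s" "t / 2"] s t unfolding v_def e_def by simp
  then have "e * phi_lo s t \<le> cos (t / 2) powr (2 * s) - cos v powr (2 * s)"
    by (simp add: phi_lo_def)
  then have "2 powr s * (e * phi_lo s t) \<le> 2 powr s * (cos (t / 2) powr (2 * s) - cos v powr (2 * s))"
    by (rule mult_left_mono) simp
  then show "2 powr s * e * phi_lo s t \<le> (1 + cos t) powr s - (1 + cos (pi / (2 * s))) powr s"
    unfolding K one_plus_cos_powr[OF t] by (simp add: algebra_simps)
qed

lemma norm_add_cnj_sq: "(norm (a + cnj b))\<^sup>2 = (norm a)\<^sup>2 + (norm b)\<^sup>2 + 2 * Re (a * b)"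
  by (simp only: cmod_power2) (simp add: power2_eq_square algebra_simps)

text \<open>The identity \<open>(norm (a + cnj b))\<^sup>2 = X * (1 + Re w)\<close> and homogeneity
  reduce inequalities in \<open>a\<close> and \<open>b\<close> to inequalities in \<open>w\<close>,
  which lies in the closed disc because \<open>2 * (norm a * norm b) \<le> X\<close>.\<close>

lemma pair_normalisation:
  fixes a b :: complex
  defines "X \<equiv> (norm a)\<^sup>2 + (norm b)\<^sup>2"
  assumes "X > 0" "0 < s"
  defines "w \<equiv> of_real (2 / X) * (a * b)"
  shows "norm w \<le> 1" "norm (a + cnj b) powr (2 * s) = X powr s * (1 + Re w) powr s"
    "homog s \<phi> (a * b) = (X / 2) powr s * homog s \<phi> w"
    "homog s \<phi> (- (a * b)) = (X / 2) powr s * homog s \<phi> (- w)"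
proof -
  have "2 * (norm a * norm b) \<le> X"
    unfolding X_def using sum_squares_bound[of "norm a" "norm b"] by (simp add: mult.assoc)
  then show nw: "norm w \<le> 1" using assms(2) by (simp add: w_def norm_mult norm_divide)
  have "Re w = 2 / X * Re (a * b)" by (simp add: w_def)
  then have "(norm (a + cnj b))\<^sup>2 = X * (1 + Re w)"
    using assms(2) by (simp add: norm_add_cnj_sq X_def[symmetric] field_simps)
  moreover have "0 \<le> 1 + Re w" using nw abs_Re_le_cmod[of w] by linarith
  ultimately show "norm (a + cnj b) powr (2 * s) = X powr s * (1 + Re w) powr s"
    using assms(2) by (simp add: powr_mult flip: sq_powr)
  have eq: "a * b = of_real (X / 2) * w" "- (a * b) = of_real (X / 2) * (- w)"
    using assms(2) by (simp_all add: w_def field_simps)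
  show "homog s \<phi> (a * b) = (X / 2) powr s * homog s \<phi> w"
    unfolding eq(1) using assms(2) by (intro homog_scale) simp
  show "homog s \<phi> (- (a * b)) = (X / 2) powr s * homog s \<phi> (- w)"
    unfolding eq(2) using assms(2) by (intro homog_scale) simp
qed

text \<open>Alone, \<open>norm (a + cnj b) powr (2 * s)\<close> would require the constant
  \<open>2 powr s\<close>. The correction is negative near \<open>a * b > 0\<close>, where the left
  side is largest, and lowers the constant to the value at the touching angle.\<close>

lemma norm_add_cnj_powr_upper:
  assumes s: "1 \<le> s"
  obtains c where "0 \<le> c" "\<And>a b. norm (a + cnj b) powr (2 * s) + c * homog s (phi_hi s) (a * b)
     \<le> (1 + cos (pi / (2 * s))) powr s * ((norm a)\<^sup>2 + (norm b)\<^sup>2) powr s"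
proof -
  obtain c where c: "0 \<le> c" "\<And>t. 0 \<le> t \<Longrightarrow> t \<le> pi \<Longrightarrow>
     c * phi_hi s t \<le> (1 + cos (pi / (2 * s))) powr s - (1 + cos t) powr s"
    using one_plus_cos_powr_upper[OF s] by blast
  show thesis
  proof (rule that[of "2 powr s * c"])
    show "0 \<le> 2 powr s * c" using c by simp
    fix a b :: complex
    define X where "X = (norm a)\<^sup>2 + (norm b)\<^sup>2"
    show "norm (a + cnj b) powr (2 * s) + 2 powr s * c * homog s (phi_hi s) (a * b)
       \<le> (1 + cos (pi / (2 * s))) powr s * ((norm a)\<^sup>2 + (norm b)\<^sup>2) powr s"
    proof (cases "X = 0")
      case True
      then have "a = 0" "b = 0" by (simp_all add: X_def add_nonneg_eq_0_iff)
      then show ?thesis by simp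
    next
      case False
      then have X: "X > 0" by (simp add: X_def order_less_le)
      define w where "w = of_real (2 / X) * (a * b)"
      have s0: "0 < s" using s by simp
      note n = pair_normalisation[of a b s, folded X_def, folded w_def, OF X s0]
      have "c * homog s (phi_hi s) w \<le> (1 + cos (pi / (2 * s))) powr s - (1 + Re w) powr s"
        using le_disc_of_le_circle[where G = "\<lambda>x. (1 + cos (pi / (2 * s))) powr s - (1 + x) powr s",
          OF vertical_mono_phi_hi[OF s] c n(1)] by simp
      then have "X powr s * (c * homog s (phi_hi s) w) \<le> X powr s * ((1 + cos (pi / (2 * s))) powr s - (1 + Re w) powr s)"
        by (rule mult_left_mono) simp
      moreover have "2 powr s * (X / 2) powr s = X powr s" using X by (simp flip: powr_mult)
      ultimately show ?thesis unfolding n(2,3) X_def[symmetric] by (simp add: algebra_simps)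
    qed
  qed
qed

text \<open>Since \<open>a + cnj b\<close> can vanish, a positive lower bound needs a correction
  that is negative near \<open>a * b < 0\<close>; hence the sign in the argument of
  \<open>homog\<close>.\<close>

lemma norm_add_cnj_powr_lower_hi:
  assumes s: "1 \<le> s"
  obtains c where "0 \<le> c" "\<And>a b. (1 - cos (pi / (2 * s))) powr s * ((norm a)\<^sup>2 + (norm b)\<^sup>2) powr s
     + c * homog s (phi_hi s) (- (a * b)) \<le> norm (a + cnj b) powr (2 * s)"
proof -
  obtain c where c: "0 \<le> c" "\<And>t. 0 \<le> t \<Longrightarrow> t \<le> pi \<Longrightarrow>
     c * phi_hi s t \<le> (1 - cos t) powr s - (1 - cos (pi / (2 * s))) powr s"
    using one_minus_cos_powr_lower[OF s] by blast
  show thesis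
  proof (rule that[of "2 powr s * c"])
    show "0 \<le> 2 powr s * c" using c by simp
    fix a b :: complex
    define X where "X = (norm a)\<^sup>2 + (norm b)\<^sup>2"
    show "(1 - cos (pi / (2 * s))) powr s * ((norm a)\<^sup>2 + (norm b)\<^sup>2) powr s
      + 2 powr s * c * homog s (phi_hi s) (- (a * b)) \<le> norm (a + cnj b) powr (2 * s)"
    proof (cases "X = 0")
      case True
      then have "a = 0" "b = 0" by (simp_all add: X_def add_nonneg_eq_0_iff)
      then show ?thesis by simp
    next
      case False
      then have X: "X > 0" by (simp add: X_def order_less_le)
      define w where "w = of_real (2 / X) * (a * b)"
      have s0: "0 < s" using s by simp
      note n = pair_normalisation[of a b s, folded X_def, folded w_def, OF X s0]
      have "c * homog s (phi_hi s) (- w) \<le> (1 + Re w) powr s - (1 - cos (pi / (2 * s))) powr s"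
        using le_disc_of_le_circle[where G = "\<lambda>x. (1 - x) powr s - (1 - cos (pi / (2 * s))) powr s",
          OF vertical_mono_phi_hi[OF s] c, of "- w"] n(1) by simp
      then have "X powr s * (c * homog s (phi_hi s) (- w)) \<le> X powr s * ((1 + Re w) powr s - (1 - cos (pi / (2 * s))) powr s)"
        by (rule mult_left_mono) simp
      moreover have "2 powr s * (X / 2) powr s = X powr s" using X by (simp flip: powr_mult)
      ultimately show ?thesis unfolding n(2,4) X_def[symmetric] by (simp add: algebra_simps)
    qed
  qed
qed

text \<open>Here \<open>phi_lo\<close> is used with \<open>a * b\<close> itself:
  \<open>cos (s * pi) < 0\<close> for \<open>1 / 2 < s \<le> 1\<close>, so this correction too is
  negative near \<open>a * b < 0\<close>, where the left side of the uncorrected bound is too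
  large.\<close>

lemma norm_add_cnj_powr_lower_lo:
  assumes s: "1 / 2 < s" "s \<le> 1"
  obtains c where "0 \<le> c" "\<And>a b. (1 + cos (pi / (2 * s))) powr s * ((norm a)\<^sup>2 + (norm b)\<^sup>2) powr s
     + c * homog s (phi_lo s) (a * b) \<le> norm (a + cnj b) powr (2 * s)"
proof -
  obtain c where c: "0 \<le> c" "\<And>t. 0 \<le> t \<Longrightarrow> t \<le> pi \<Longrightarrow>
     c * phi_lo s t \<le> (1 + cos t) powr s - (1 + cos (pi / (2 * s))) powr s"
    using one_plus_cos_powr_lower[OF s] by blast
  show thesis
  proof (rule that[of "2 powr s * c"])
    show "0 \<le> 2 powr s * c" using c by simp
    fix a b :: complex
    define X where "X = (norm a)\<^sup>2 + (norm b)\<^sup>2"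
    show "(1 + cos (pi / (2 * s))) powr s * ((norm a)\<^sup>2 + (norm b)\<^sup>2) powr s
      + 2 powr s * c * homog s (phi_lo s) (a * b) \<le> norm (a + cnj b) powr (2 * s)"
    proof (cases "X = 0")
      case True
      then have "a = 0" "b = 0" by (simp_all add: X_def add_nonneg_eq_0_iff)
      then show ?thesis by simp
    next
      case False
      then have X: "X > 0" by (simp add: X_def order_less_le)
      define w where "w = of_real (2 / X) * (a * b)"
      have s0: "0 < s" using s by simp
      note n = pair_normalisation[of a b s, folded X_def, folded w_def, OF X s0]
      have "c * homog s (phi_lo s) w \<le> (1 + Re w) powr s - (1 + cos (pi / (2 * s))) powr s"
        using le_disc_of_le_circle[where G = "\<lambda>x. (1 + x) powr s - (1 + cos (pi / (2 * s))) powr s",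
          OF vertical_mono_phi_lo[OF s0 s(2)] c n(1)] by simp
      then have "X powr s * (c * homog s (phi_lo s) w) \<le> X powr s * ((1 + Re w) powr s - (1 + cos (pi / (2 * s))) powr s)"
        by (rule mult_left_mono) simp
      moreover have "2 powr s * (X / 2) powr s = X powr s" using X by (simp flip: powr_mult)
      ultimately show ?thesis unfolding n(2,3) X_def[symmetric] by (simp add: algebra_simps)
    qed
  qed
qed

section \<open>The sub-mean-value property on the disc\<close>

text \<open>Carried by the unit circle but defined on the Borel sets of the plane, so that functions
  continuous on the plane are measurable as they stand.\<close>

definition circle :: "complex measure" where
  "circle = distr (uniform_measure lborel {0..2 * pi}) borel cis"

lemma cis_borel [measurable]: "cis \<in> borel_measurable borel"
  by (intro borel_measurable_continuous_onI continuous_intros)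

lemma prob_space_circle: "prob_space circle"
  unfolding circle_def
  by (intro prob_space.prob_space_distr prob_space_uniform_measure) auto

lemma sets_circle [measurable_cong, simp]: "sets circle = sets borel"
  by (simp add: circle_def)

lemma AE_circle: "AE z in circle. norm z = 1"
  unfolding circle_def by (subst AE_distr_iff) auto

lemma integrable_circle:
  fixes v :: "complex \<Rightarrow> 'b::euclidean_space"
  assumes "continuous_on UNIV v"
  shows "integrable circle v"
proof -
  interpret prob_space circle by (rule prob_space_circle)
  have [measurable]: "v \<in> borel_measurable borel"
    using assms by (rule borel_measurable_continuous_onI)
  have "compact (v ` sphere 0 1)"
    by (intro compact_continuous_image continuous_on_subset[OF assms]) auto
  then obtain B where B: "\<And>z. norm z = 1 \<Longrightarrow> norm (v z) \<le> B"
    by (force dest!: compact_imp_bounded simp: bounded_iff)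
  have "AE z in circle. norm (v z) \<le> B"
    using AE_circle by eventually_elim (rule B)
  then show ?thesis by (rule integrable_const_bound) simp
qed

lemma circle_mean_mono:
  fixes v w :: "complex \<Rightarrow> real"
  assumes "continuous_on UNIV v" "continuous_on UNIV w"
    and "\<And>z. norm z = 1 \<Longrightarrow> v z \<le> w z"
  shows "(\<integral>z. v z \<partial>circle) \<le> (\<integral>z. w z \<partial>circle)"
proof (intro integral_mono_AE integrable_circle assms(1,2))
  show "AE z in circle. v z \<le> w z"
    using AE_circle by eventually_elim (rule assms(3))
qed

lemma uniform_measure_eq_density:
  "uniform_measure lborel {0..2 * pi} = density lborel (\<lambda>x. ennreal (indicator {0..2*pi} x / (2 * pi)))"
  unfolding uniform_measure_def
  by (intro arg_cong[where f = "density lborel"] ext)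
     (simp add: divide_ennreal[symmetric] ennreal_indicator)

lemma circle_mean_power:
  "(\<integral>z. z ^ k \<partial>circle) = (if k = 0 then 1 else 0)"
proof (cases "k = 0")
  case True
  interpret prob_space circle by (rule prob_space_circle)
  show ?thesis using True prob_space by simp
next
  case False
  have 1: "(\<integral>z. z ^ k \<partial>circle) = (\<integral>x. cis x ^ k \<partial>uniform_measure lborel {0..2 * pi})"
    unfolding circle_def by (rule integral_distr) auto
  have 2: "\<dots> = (\<integral>x. indicator {0..2*pi} x *\<^sub>R (cis (k * x)) \<partial>lborel) / (2 * pi)"
    unfolding uniform_measure_eq_density
    by (subst integral_density) (auto simp: Complex.DeMoivre scaleR_conv_of_real divide_simps
        simp flip: integral_divide_zero intro!: Bochner_Integration.integral_cong split: split_indicator)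
  have der: "((\<lambda>x. cis (k * x) / (\<i> * k)) has_vector_derivative cis (k * x)) (at x within S)"
    for x :: real and S
    using False
    by (auto simp: has_vector_derivative_def intro!: derivative_eq_intros)
       (auto simp: scaleR_conv_of_real fun_eq_iff mult.left_commute[of _ \<i>])
  have "(LBINT x:{0..2*pi}. cis (k * x)) = cis (k * (2*pi)) / (\<i> * k) - cis (k * 0) / (\<i> * k)"
    unfolding set_lebesgue_integral_def
    by (subst integral_FTC_Icc[of 0 "2*pi" "\<lambda>x. cis (k * x) / (\<i> * k)", OF _ der])
       (auto intro!: continuous_intros)
  also have "cis (k * (2*pi)) = 1"
    using cis_multiple_2pi[of "real k"] by (simp add: mult_ac)
  finally show ?thesis
    using 1 2 False by (simp add: set_lebesgue_integral_def)
qed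

lemma circle_mean_poly: "(\<integral>z. poly P z \<partial>circle) = poly P 0"
proof -
  have "(\<integral>z. poly P z \<partial>circle) = (\<integral>z. (\<Sum>i\<le>degree P. coeff P i * z ^ i) \<partial>circle)"
    by (simp add: poly_altdef)
  also have "\<dots> = (\<Sum>i\<le>degree P. coeff P i * (\<integral>z. z ^ i \<partial>circle))"
    by (subst Bochner_Integration.integral_sum) (auto intro!: integrable_circle continuous_intros)
  also have "\<dots> = poly P 0"
    by (simp add: circle_mean_power poly_0_coeff_0 if_distrib[of "times _"] sum.delta cong: if_cong)
  finally show ?thesis .
qed

lemma circle_mean_Re_poly:
  "(\<integral>z. Re (poly P (a + b * z)) \<partial>circle) = Re (poly P a)"
proof -
  have eq: "poly P (a + b * z) = poly (pcompose P [:a, b:]) z" for z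
    by (simp add: poly_pcompose mult.commute)
  have "(\<integral>z. Re (poly Q z) \<partial>circle) = Re (poly Q 0)" for Q
    by (subst integral_Re) (auto intro!: integrable_circle continuous_intros simp: circle_mean_poly)
  from this[of "pcompose P [:a, b:]"] show ?thesis by (simp only: eq) (simp add: poly_pcompose)
qed

text \<open>These are the real trigonometric polynomials, written as boundary values of real parts
  of polynomials so that their harmonic extension to the disc is explicit.\<close>

definition circle_harmonic :: "(complex \<Rightarrow> real) \<Rightarrow> bool" where
  "circle_harmonic f \<longleftrightarrow> continuous_on (sphere 0 1) f \<and>
     (\<exists>P. \<forall>z\<in>sphere 0 1. f z = Re (poly P z))"

lemma circle_harmonic_add:
  assumes "circle_harmonic f" "circle_harmonic g"
  shows "circle_harmonic (\<lambda>x. f x + g x)"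
proof -
  from assms obtain P Q where "\<forall>z\<in>sphere 0 1. f z = Re (poly P z)" "\<forall>z\<in>sphere 0 1. g z = Re (poly Q z)"
    unfolding circle_harmonic_def by blast
  then have "\<forall>z\<in>sphere 0 1. f z + g z = Re (poly (P + Q) z)" by simp
  then show ?thesis
    using assms unfolding circle_harmonic_def by (blast intro: continuous_intros)
qed

lemma circle_harmonic_sum:
  "(\<And>i. i \<in> A \<Longrightarrow> circle_harmonic (f i)) \<Longrightarrow> circle_harmonic (\<lambda>x. \<Sum>i\<in>A. f i x)"
proof (induction A rule: infinite_finite_induct)
  case (insert x F)
  then show ?case by (simp add: circle_harmonic_add)
qed (auto simp: circle_harmonic_def intro!: exI[of _ 0])

text \<open>\<open>Re x * Re y\<close> is the real part of \<open>(x * y + x * cnj y) / 2\<close>,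
  and on the circle \<open>z ^ i * cnj z ^ j = z ^ (i - j)\<close> for \<open>j \<le> i\<close>. In
  the other case the factors are exchanged, so no negative power arises.\<close>

lemma circle_harmonic_monom_mult:
  "circle_harmonic (\<lambda>z. Re (a * z ^ i) * Re (b * z ^ j))"
proof -
  have eq: "Re x * Re y = Re ((x * y + x * cnj y) / 2)" for x y
    by (simp add: field_simps)
  have c: "continuous_on (sphere 0 1) (\<lambda>z. Re (a * z ^ i) * Re (b * z ^ j))"
    by (intro continuous_intros)
  have *: "\<exists>P. \<forall>z\<in>sphere 0 1. Re (a * z ^ i) * Re (b * z ^ j) = Re (poly P z)"
    if "j \<le> i" for i j and a b :: complex
  proof -
    define P where "P = smult (1/2) (monom (a * b) (i + j) + monom (a * cnj b) (i - j))"
    have "Re (a * z ^ i) * Re (b * z ^ j) = Re (poly P z)" if "z \<in> sphere 0 1" for z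
    proof -
      have "z * cnj z = 1" using that by (simp add: complex_norm_square[symmetric])
      then have "z ^ j * cnj z ^ j = 1" by (simp flip: power_mult_distrib)
      moreover have "z ^ i = z ^ (i - j) * z ^ j" using \<open>j \<le> i\<close> by (simp flip: power_add)
      ultimately have "z ^ i * cnj z ^ j = z ^ (i - j)" by (simp add: mult.assoc)
      moreover have "(a * z ^ i) * cnj (b * z ^ j) = a * cnj b * (z ^ i * cnj z ^ j)"
        by (simp only: complex_cnj_mult complex_cnj_power mult_ac)
      moreover have "(a * z ^ i) * (b * z ^ j) = a * b * z ^ (i + j)"
        by (simp add: power_add mult_ac)
      ultimately have "poly P z = ((a * z ^ i) * (b * z ^ j) + (a * z ^ i) * cnj (b * z ^ j)) / 2"
        by (simp only: P_def poly_smult poly_add poly_monom) (simp add: add_divide_distrib)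
      then show ?thesis by (simp only: eq)
    qed
    then show ?thesis by blast
  qed
  show ?thesis
  proof (cases "j \<le> i")
    case True
    with * c show ?thesis unfolding circle_harmonic_def by blast
  next
    case False
    with *[of i j b a] c show ?thesis unfolding circle_harmonic_def by (simp add: mult.commute)
  qed
qed

lemma circle_harmonic_mult:
  assumes "circle_harmonic f" "circle_harmonic g"
  shows "circle_harmonic (\<lambda>x. f x * g x)"
proof -
  from assms obtain P Q where PQ: "\<forall>z\<in>sphere 0 1. f z = Re (poly P z)" "\<forall>z\<in>sphere 0 1. g z = Re (poly Q z)"
    unfolding circle_harmonic_def by blast
  let ?h = "\<lambda>z. \<Sum>i\<le>degree P. \<Sum>j\<le>degree Q. Re (coeff P i * z ^ i) * Re (coeff Q j * z ^ j)"
  have "circle_harmonic ?h"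
    by (intro circle_harmonic_sum circle_harmonic_monom_mult)
  moreover have "f z * g z = ?h z" if "z \<in> sphere 0 1" for z
    using PQ that by (simp add: poly_altdef sum_product)
  moreover have "continuous_on (sphere 0 1) (\<lambda>x. f x * g x)"
    using assms unfolding circle_harmonic_def by (intro continuous_intros) auto
  ultimately show ?thesis
    unfolding circle_harmonic_def by simp
qed

text \<open>By Stone--Weierstrass: on the circle the real parts of polynomials form an algebra, because
  \<open>cnj z = 1 / z\<close> there.\<close>

lemma Re_poly_approx_circle:
  fixes v :: "complex \<Rightarrow> real"
  assumes "continuous_on (sphere 0 1) v" "0 < e"
  obtains P where "\<And>z. norm z = 1 \<Longrightarrow> \<bar>v z - Re (poly P z)\<bar> < e"
proof -
  have base: "circle_harmonic (\<lambda>z. Re (poly P z))" for P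
    unfolding circle_harmonic_def by (auto intro!: continuous_intros)
  interpret function_ring_on "Collect circle_harmonic" "sphere 0 1 :: complex set"
  proof
    show "compact (sphere 0 1 :: complex set)" by simp
  next
    fix f assume "f \<in> Collect circle_harmonic"
    then show "continuous_on (sphere 0 1) f" by (simp add: circle_harmonic_def)
  next
    fix f g assume "f \<in> Collect circle_harmonic" "g \<in> Collect circle_harmonic"
    then show "(\<lambda>x. f x + g x) \<in> Collect circle_harmonic"
      and "(\<lambda>x. f x * g x) \<in> Collect circle_harmonic"
      using circle_harmonic_add[of f g] circle_harmonic_mult[of f g] by simp_all
  next
    fix c show "(\<lambda>_. c) \<in> Collect circle_harmonic"
      using base[of "[:of_real c:]"] by simp
  next
    fix x y :: complex assume "x \<noteq> y"
    then have "Re x \<noteq> Re y \<or> Re (- \<i> * x) \<noteq> Re (- \<i> * y)" by (simp add: complex_eq_iff)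
    then show "\<exists>f\<in>Collect circle_harmonic. f x \<noteq> f y"
      using base[of "[:0, 1:]"] base[of "[:0, - \<i>:]"]
      by (auto simp: mult.commute intro!: bexI[of _ "\<lambda>z. Re (poly [:0, 1:] z)"] bexI[of _ "\<lambda>z. Re (poly [:0, - \<i>:] z)"])
  qed
  obtain g where "circle_harmonic g" "\<And>z. z \<in> sphere 0 1 \<Longrightarrow> \<bar>v z - g z\<bar> < e"
    using Stone_Weierstrass_basic[OF assms] by auto
  then show ?thesis
    using that unfolding circle_harmonic_def by (metis dist_0_norm mem_sphere)
qed

text \<open>A touching harmonic minorant at \<open>z0\<close> yields the sub-mean-value property on small circles around
  \<open>z0\<close> without any second derivatives.\<close>

definition touches_from_below :: "(complex \<Rightarrow> real) \<Rightarrow> complex \<Rightarrow> bool" where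
  "touches_from_below v z0 \<longleftrightarrow> (\<exists>\<delta>>0. \<exists>E. E holomorphic_on ball z0 \<delta> \<and>
     (\<forall>z\<in>ball z0 \<delta>. Re (E z) \<le> v z) \<and> Re (E z0) = v z0)"

text \<open>Among the points of the closed disc where \<open>v - Re P\<close> is maximal, take one
  of largest modulus. A strict sub-mean inequality contradicts maximality directly. A touching
  minorant \<open>E\<close> makes \<open>norm (exp (E - P))\<close> maximal there, hence
  \<open>exp (E - P)\<close> locally constant, and this yields a maximum point farther out.\<close>

lemma max_principle_Re_poly:
  fixes v :: "complex \<Rightarrow> real"
  assumes v: "continuous_on UNIV v"
    and local: "\<And>a. norm a < 1 \<Longrightarrow> touches_from_below v a \<or>
          (\<exists>r>0. r < 1 - norm a \<and> v a < (\<integral>\<zeta>. v (a + r * \<zeta>) \<partial>circle))"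
    and bound: "\<And>z. norm z = 1 \<Longrightarrow> v z \<le> Re (poly P z)"
    and z: "norm z \<le> 1"
  shows "v z \<le> Re (poly P z)"
proof (rule ccontr)
  define w where "w z = v z - Re (poly P z)" for z
  assume "\<not> v z \<le> Re (poly P z)"
  then have wz: "w z > 0" by (simp add: w_def)
  have w: "continuous_on A w" for A
    unfolding w_def by (intro continuous_intros continuous_on_subset[OF v]) auto
  obtain M where M: "M \<in> cball 0 1" "\<And>y. y \<in> cball 0 1 \<Longrightarrow> w y \<le> w M"
    using continuous_attains_sup[OF compact_cball _ w, of 0 1] by (auto simp del: mem_cball)
  define K where "K = {y \<in> cball 0 1. w y = w M}"
  have "closed K"
    unfolding K_def using continuous_closed_preimage_constant[OF w, of "cball 0 1" "w M"] by simp
  then have "compact K"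
    by (metis (no_types, lifting) K_def bounded_cball bounded_subset compact_eq_bounded_closed mem_Collect_eq subsetI)
  moreover have "M \<in> K" using M by (simp add: K_def)
  ultimately obtain a where a: "a \<in> K" "\<And>y. y \<in> K \<Longrightarrow> norm y \<le> norm a"
    using continuous_attains_sup[of K norm] by (auto intro: continuous_intros)
  have wa: "w a = w M" "norm a \<le> 1" using a by (auto simp: K_def)
  have "w M > 0" using M(2)[of z] z wz by auto
  then have na: "norm a < 1"
    using bound[of a] wa by (auto simp: w_def order.order_iff_strict)
  from local[OF na] show False
  proof
    assume "touches_from_below v a"
    then obtain \<delta> E where \<delta>: "\<delta> > 0" and E: "E holomorphic_on ball a \<delta>"
      "\<And>z. z \<in> ball a \<delta> \<Longrightarrow> Re (E z) \<le> v z" "Re (E a) = v a"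
      unfolding touches_from_below_def by blast
    define \<epsilon> where "\<epsilon> = min \<delta> (1 - norm a)"
    have \<epsilon>: "\<epsilon> > 0" using \<delta> na by (simp add: \<epsilon>_def)
    define G where "G z = exp (E z - poly P z)" for z
    have inb: "y \<in> ball a \<delta>" "y \<in> cball 0 1" if "y \<in> ball a \<epsilon>" for y
      using that norm_triangle_ineq2[of y a] by (auto simp: \<epsilon>_def dist_norm norm_minus_commute)
    have "G holomorphic_on ball a \<epsilon>"
      unfolding G_def by (intro holomorphic_intros holomorphic_on_subset[OF E(1)]) (use inb in auto)
    moreover have "norm (G y) \<le> norm (G a)" if "y \<in> ball a \<epsilon>" for y
      using E(2)[OF inb(1)[OF that]] E(3) M(2)[OF inb(2)[OF that]] wa
      by (simp add: G_def norm_exp_eq_Re w_def)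
    ultimately have const: "G constant_on ball a \<epsilon>"
      using maximum_modulus_principle[of G "ball a \<epsilon>" "ball a \<epsilon>" a] \<epsilon> by auto
    \<comment> \<open>A small step from \<open>a\<close> in its own direction increases the modulus;
      at the origin any direction does.\<close>
    define d where "d = (if a = 0 then 1 else sgn a)"
    have d: "norm d = 1" by (simp add: d_def norm_sgn)
    define y where "y = a + of_real (\<epsilon>/2) * d"
    have y: "y \<in> ball a \<epsilon>" using d \<epsilon> by (simp add: y_def dist_norm norm_mult)
    have "norm y > norm a"
    proof (cases "a = 0")
      case False
      have "y = of_real (norm a + \<epsilon>/2) * sgn a"
        using False by (simp add: y_def d_def sgn_eq field_simps)
      then have "norm y = norm a + \<epsilon>/2"
        using False \<epsilon> by (simp add: norm_mult norm_sgn del: of_real_add)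
      then show ?thesis using \<epsilon> by simp
    qed (use \<epsilon> in \<open>simp add: y_def d_def\<close>)
    have "norm (G y) = norm (G a)"
      using const y \<epsilon> unfolding constant_on_def by (metis centre_in_ball)
    then have "Re (E y) - Re (poly P y) = w a"
      using E(3) by (simp add: G_def norm_exp_eq_Re w_def)
    then have "w y \<ge> w M" using E(2)[OF inb(1)[OF y]] wa by (simp add: w_def)
    then have "y \<in> K" using M(2)[OF inb(2)[OF y]] inb(2)[OF y] by (simp add: K_def)
    then show False using a(2) \<open>norm y > norm a\<close> by force
  next
    assume "\<exists>r>0. r < 1 - norm a \<and> v a < (\<integral>\<zeta>. v (a + r * \<zeta>) \<partial>circle)"
    then obtain r where r: "r > 0" "r < 1 - norm a" "v a < (\<integral>\<zeta>. v (a + r * \<zeta>) \<partial>circle)"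
      by blast
    have cv: "continuous_on UNIV (\<lambda>\<zeta>::complex. v (a + r * \<zeta>))"
      by (rule continuous_on_compose2[OF v]) (auto intro: continuous_intros)
    have "(\<integral>\<zeta>. v (a + r * \<zeta>) \<partial>circle) \<le> (\<integral>\<zeta>. Re (poly P (a + r * \<zeta>)) + w M \<partial>circle)"
    proof (rule circle_mean_mono[OF cv])
      fix \<zeta> :: complex assume "norm \<zeta> = 1"
      then have "a + r * \<zeta> \<in> cball 0 1"
        using norm_triangle_ineq[of a "r * \<zeta>"] r by (auto simp: norm_mult)
      from M(2)[OF this] show "v (a + r * \<zeta>) \<le> Re (poly P (a + r * \<zeta>)) + w M"
        by (simp add: w_def)
    qed (auto intro!: continuous_intros)
    also have "\<dots> = Re (poly P a) + w M"
      using prob_space.prob_space[OF prob_space_circle]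
      by (subst Bochner_Integration.integral_add)
         (auto intro!: integrable_circle continuous_intros simp: circle_mean_Re_poly)
    also have "\<dots> = v a" using wa by (simp add: w_def)
    finally show False using r by simp
  qed
qed

text \<open>Raising a uniform approximation by \<open>e / 2\<close> gives a majorant on the circle,
  hence on the disc, and the real part of a polynomial at \<open>0\<close> equals its circle mean.
  The approximating polynomial thus replaces the solution of a Dirichlet problem.\<close>

lemma submean_circle:
  fixes v :: "complex \<Rightarrow> real"
  assumes v: "continuous_on UNIV v"
    and local: "\<And>a. norm a < 1 \<Longrightarrow> touches_from_below v a \<or>
          (\<exists>r>0. r < 1 - norm a \<and> v a < (\<integral>\<zeta>. v (a + r * \<zeta>) \<partial>circle))"
  shows "v 0 \<le> (\<integral>\<zeta>. v \<zeta> \<partial>circle)"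
proof (rule field_le_epsilon)
  fix e :: real assume e: "e > 0"
  obtain P where P: "\<And>z. norm z = 1 \<Longrightarrow> \<bar>v z - Re (poly P z)\<bar> < e / 2"
    using Re_poly_approx_circle[of v "e / 2"] continuous_on_subset[OF v] e by auto
  define Q where "Q = P + [:of_real (e / 2):]"
  have "v 0 \<le> Re (poly Q 0)"
  proof (rule max_principle_Re_poly[OF v local])
    fix z :: complex assume "norm z = 1"
    from P[OF this] have "v z - Re (poly P z) \<le> e / 2" by linarith
    then show "v z \<le> Re (poly Q z)" by (simp add: Q_def)
  qed auto
  also have "\<dots> = (\<integral>z. Re (poly Q z) \<partial>circle)"
    using circle_mean_Re_poly[of Q 0 1] by simp
  also have "\<dots> \<le> (\<integral>z. v z + e \<partial>circle)"
  proof (rule circle_mean_mono)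
    fix z :: complex assume "norm z = 1"
    from P[OF this] e have "Re (poly P z) + e / 2 \<le> v z + e" by linarith
    then show "Re (poly Q z) \<le> v z + e" by (simp add: Q_def)
  qed (auto intro!: continuous_intros v)
  also have "\<dots> = (\<integral>z. v z \<partial>circle) + e"
    using prob_space.prob_space[OF prob_space_circle]
    by (subst Bochner_Integration.integral_add) (auto intro!: integrable_circle v)
  finally show "v 0 \<le> (\<integral>\<zeta>. v \<zeta> \<partial>circle) + e" .
qed

section \<open>Homogeneous subharmonic functions\<close>

lemma continuous_on_angle: "continuous_on (- {0}) angle"
  unfolding angle_def using Re_div_norm_bounds by (intro continuous_intros) auto

lemma continuous_on_homog:
  assumes s: "0 < s" and \<phi>: "continuous_on {0..pi} \<phi>"
  shows "continuous_on UNIV (homog s \<phi>)"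
proof -
  have "bounded (\<phi> ` {0..pi})"
    by (intro compact_imp_bounded compact_continuous_image \<phi>) auto
  then obtain B where B: "\<And>t. 0 \<le> t \<Longrightarrow> t \<le> pi \<Longrightarrow> \<bar>\<phi> t\<bar> \<le> B"
    by (force simp: bounded_iff)
  have cn: "continuous_on UNIV (\<lambda>w::complex. norm w powr s)"
    using s by (intro continuous_on_powr' continuous_intros) auto
  have "continuous_on (- {0}) (homog s \<phi>)"
    unfolding homog_def
    by (intro continuous_intros continuous_on_subset[OF cn]
        continuous_on_compose2[OF \<phi> continuous_on_angle]) (auto simp: angle_bounds)
  then have nz: "isCont (homog s \<phi>) w" if "w \<noteq> 0" for w
    using that continuous_on_eq_continuous_at[of "- {0}"] by (auto simp: open_Compl)
  have "((\<lambda>w::complex. B * norm w powr s) \<longlongrightarrow> B * 0) (at 0)"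
  proof (intro tendsto_intros)
    have "isCont (\<lambda>w::complex. norm w powr s) 0"
      using cn by (simp add: continuous_on_eq_continuous_at)
    then show "((\<lambda>w::complex. norm w powr s) \<longlongrightarrow> 0) (at 0)"
      by (simp add: isCont_def)
  qed
  then have "(homog s \<phi> \<longlongrightarrow> 0) (at 0)"
  proof (intro Lim_null_comparison[of "homog s \<phi>"] always_eventually allI)
    fix w show "norm (homog s \<phi> w) \<le> B * norm w powr s"
      using B[OF angle_bounds[of w]] mult_right_mono[of "\<bar>\<phi> (angle w)\<bar>" B "norm w powr s"]
      by (simp add: homog_def abs_mult mult.commute)
  qed auto
  then have "isCont (homog s \<phi>) 0" by (simp add: isCont_def)
  with nz show ?thesis by (metis continuous_at_imp_continuous_on)
qed

text \<open>A function of the angle is trigonometrically convex if near each angle it has a minorant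
  \<open>cos (s t + \<gamma>)\<close> touching it there; its homogeneous extension then has harmonic minorants
  \<open>Re (c w\<^sup>s)\<close>.\<close>

definition trig_convex :: "real \<Rightarrow> (real \<Rightarrow> real) \<Rightarrow> bool" where
  "trig_convex s \<phi> \<longleftrightarrow> (\<forall>t\<in>{0..pi}. \<exists>\<gamma> \<epsilon>. 0 < \<epsilon> \<and> cos \<gamma> = \<phi> t \<and>
     (\<forall>b. \<bar>b\<bar> < \<epsilon> \<longrightarrow> cos (s * b + \<gamma>) \<le> \<phi> (arccos (cos (t + b)))))"

lemma arccos_cos_shift:
  fixes t b :: real
  assumes "0 \<le> t" "t \<le> pi" "\<bar>b\<bar> < pi"
  obtains "arccos (cos (t + b)) = t + b" "0 \<le> t + b" "t + b \<le> pi"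
    | "arccos (cos (t + b)) = - (t + b)" "t + b < 0"
    | "arccos (cos (t + b)) = 2 * pi - (t + b)" "pi < t + b"
proof -
  consider "t + b < 0" | "0 \<le> t + b" "t + b \<le> pi" | "pi < t + b" by linarith
  then show thesis
  proof cases
    case 1
    then have "arccos (cos (- (t + b))) = - (t + b)"
      using assms by (intro arccos_cos) auto
    then show thesis using that(2) 1 by (simp only: cos_minus)
  next
    case 2
    then show thesis using that(1) by (simp add: arccos_cos)
  next
    case 3
    have "cos (2 * pi - (t + b)) = cos (t + b)" by (simp add: cos_diff)
    moreover have "arccos (cos (2 * pi - (t + b))) = 2 * pi - (t + b)"
      using assms 3 by (intro arccos_cos) auto
    ultimately show thesis using that(3) 3 by simp
  qed
qed

lemma trig_convex_phi_hi:
  assumes s: "1 \<le> s"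
  shows "trig_convex s (phi_hi s)"
  unfolding trig_convex_def
proof
  fix t assume "t \<in> {0..pi}"
  then have t: "0 \<le> t" "t \<le> pi" by auto
  show "\<exists>\<gamma> \<epsilon>. 0 < \<epsilon> \<and> cos \<gamma> = phi_hi s t \<and>
     (\<forall>b. \<bar>b\<bar> < \<epsilon> \<longrightarrow> cos (s * b + \<gamma>) \<le> phi_hi s (arccos (cos (t + b))))"
  proof (cases "s * t < pi")
    case True
    \<comment> \<open>This radius keeps \<open>s * (t + b)\<close> strictly between
      \<open>- pi\<close> and \<open>pi\<close>, where the profile is the uncapped cosine; folding
      at \<open>pi\<close> is then impossible because \<open>s \<ge> 1\<close>.\<close>
    define \<epsilon> where "\<epsilon> = (pi - s * t) / s"
    have \<epsilon>: "0 < \<epsilon>" using True s by (simp add: \<epsilon>_def)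
    have "\<epsilon> \<le> pi"
    proof -
      have "pi \<le> s * pi" using s by simp
      then have "pi - s * t \<le> s * pi" using t s mult_nonneg_nonneg[of s t] by linarith
      then show ?thesis using s by (simp add: \<epsilon>_def divide_le_eq mult.commute)
    qed
    have "cos (s * b + (s * t + pi)) \<le> phi_hi s (arccos (cos (t + b)))" if b: "\<bar>b\<bar> < \<epsilon>" for b
    proof -
      have "s * \<bar>b\<bar> < pi - s * t" using b s by (simp add: \<epsilon>_def field_simps)
      moreover have "s * b \<le> s * \<bar>b\<bar>" "s * (- b) \<le> s * \<bar>b\<bar>" using s by (intro mult_left_mono; simp)+
      moreover have "0 \<le> s * t" using s t by simp
      moreover have "s * (t + b) = s * t + s * b" "s * (- b) = - (s * b)" by (simp_all add: distrib_left)
      ultimately have bb: "s * (t + b) < pi" "- (s * (t + b)) < pi" by linarith+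
      have "s * b + (s * t + pi) = s * (t + b) + pi" by (simp add: algebra_simps)
      then have "cos (s * b + (s * t + pi)) = - cos (s * (t + b))" by (simp only: cos_periodic_pi)
      also have "\<dots> \<le> phi_hi s (arccos (cos (t + b)))"
      proof -
        have "\<bar>b\<bar> < pi" using b \<open>\<epsilon> \<le> pi\<close> by linarith
        show ?thesis
        proof (cases rule: arccos_cos_shift[OF t \<open>\<bar>b\<bar> < pi\<close>])
          case 3
          have "0 \<le> t + b" using 3 pi_gt_zero by linarith
          then have "t + b \<le> s * (t + b)" using mult_right_mono[OF s] by simp
          with bb 3 show ?thesis by linarith
        next
          case 1 then show ?thesis using bb by (simp add: phi_hi_def)
        next
          case 2
          have "s * - (t + b) = - (s * (t + b))" by (rule mult_minus_right)
          then have "min (s * - (t + b)) pi = - (s * (t + b))" using bb(2) by linarith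
          then show ?thesis using 2 by (simp only: phi_hi_def cos_minus)
        qed
      qed
      finally show ?thesis .
    qed
    moreover have "cos (s * t + pi) = phi_hi s t" using True by (simp add: phi_hi_def)
    ultimately show ?thesis using \<epsilon> by blast
  next
    case False
    then have t0: "t > 0" using t s by (cases "t = 0") auto
    \<comment> \<open>In the capped region \<open>cos (s * b)\<close> touches the constant
      \<open>1\<close> at \<open>b = 0\<close>. The bound by \<open>t\<close> excludes folding at
      \<open>0\<close>, and the bound by \<open>pi / s\<close> keeps
      \<open>s * \<bar>b\<bar>\<close> in the range where the cosine decreases.\<close>
    define \<epsilon> where "\<epsilon> = min t (pi / s)"
    have \<epsilon>: "0 < \<epsilon>" using t0 s by (simp add: \<epsilon>_def)
    have "cos (s * b + 0) \<le> phi_hi s (arccos (cos (t + b)))" if b: "\<bar>b\<bar> < \<epsilon>" for b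
    proof -
      define a where "a = arccos (cos (t + b))"
      have "pi / s \<le> pi" using s by (simp add: divide_le_eq)
      then have bp: "\<bar>b\<bar> < pi" using b by (simp add: \<epsilon>_def)
      have sb: "s * \<bar>b\<bar> \<le> pi" using b s by (simp add: \<epsilon>_def field_simps)
      have ta: "t - a \<le> \<bar>b\<bar>"
      proof (cases rule: arccos_cos_shift[OF t bp])
        case 2
        then show ?thesis using b by (auto simp: \<epsilon>_def)
      qed (use t in \<open>auto simp: a_def\<close>)
      show ?thesis
      proof (cases "pi \<le> s * a")
        case True
        then show ?thesis by (simp add: phi_hi_eq_one a_def)
      next
        case f: False
        have "s * t - s * a \<le> s * \<bar>b\<bar>" using mult_left_mono[OF ta, of s] s by (simp add: right_diff_distrib)
        then have "pi - s * a \<le> s * \<bar>b\<bar>" using False by linarith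
        then have "cos (s * \<bar>b\<bar>) \<le> cos (pi - s * a)"
          using f sb by (intro cos_monotone_0_pi_le) auto
        moreover have "cos (s * \<bar>b\<bar>) = cos (s * b)" by (cases "b \<ge> 0") auto
        ultimately show ?thesis using f by (simp add: phi_hi_def a_def[symmetric])
      qed
    qed
    moreover have "cos 0 = phi_hi s t" using False by (simp add: phi_hi_eq_one)
    ultimately show ?thesis using \<epsilon> by blast
  qed
qed

text \<open>Folding at \<open>0\<close> leaves the cosine unchanged. Folding at \<open>pi\<close>
  increases it, because the difference is \<open>2 * sin (s * pi) * sin (s * (x - pi))\<close> and
  \<open>s \<le> 1\<close> makes both sines nonnegative.\<close>

lemma trig_convex_phi_lo:
  assumes s: "0 < s" "s \<le> 1"
  shows "trig_convex s (phi_lo s)"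
  unfolding trig_convex_def
proof
  fix t assume "t \<in> {0..pi}"
  then have t: "0 \<le> t" "t \<le> pi" by auto
  have "cos (s * b + s * t) \<le> phi_lo s (arccos (cos (t + b)))" if b: "\<bar>b\<bar> < pi" for b
  proof -
    define x where "x = t + b"
    have eq: "s * b + s * t = s * x" by (simp add: x_def algebra_simps)
    have "cos (s * x) \<le> phi_lo s (arccos (cos (t + b)))"
    proof (cases rule: arccos_cos_shift[OF t b])
      case 1 show ?thesis by (simp only: phi_lo_def x_def 1(1) order_refl)
    next
      case 2
      have "cos (s * (- x)) = cos (s * x)" by simp
      then show ?thesis unfolding phi_lo_def 2(1) x_def by simp
    next
      case 3
      have x: "pi < x" "x < 2 * pi" using 3 t b by (auto simp: x_def)
      have "s * (x - pi) \<le> 1 * (x - pi)" using s x by (intro mult_right_mono) auto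
      also have "\<dots> \<le> pi" using x by simp
      finally have "s * (x - pi) \<le> pi" .
      moreover have "s * pi \<le> pi" using s by simp
      ultimately have "0 \<le> 2 * sin (s * pi) * sin (s * (x - pi))"
        using s x by (intro mult_nonneg_nonneg sin_ge_zero) auto
      also have "\<dots> = cos (s * pi - s * (x - pi)) - cos (s * pi + s * (x - pi))"
        by (simp add: cos_diff cos_add)
      also have "s * pi - s * (x - pi) = s * (2 * pi - x)" by (simp add: algebra_simps)
      also have "s * pi + s * (x - pi) = s * x" by (simp add: algebra_simps)
      finally show ?thesis using 3 by (simp add: phi_lo_def x_def)
    qed
    then show ?thesis by (simp only: eq)
  qed
  then show "\<exists>\<gamma> \<epsilon>. 0 < \<epsilon> \<and> cos \<gamma> = phi_lo s t \<and>
     (\<forall>b. \<bar>b\<bar> < \<epsilon> \<longrightarrow> cos (s * b + \<gamma>) \<le> phi_lo s (arccos (cos (t + b))))"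
    by (intro exI[of _ "s * t"] exI[of _ pi]) (auto simp: phi_lo_def)
qed

text \<open>The minorant is written in a quotient variable \<open>z\<close> near \<open>1\<close>,
  where the principal power is holomorphic wherever \<open>w\<close> lies. The sign
  \<open>\<sigma>\<close> reflects the lower half plane to the upper one, since a profile sees only
  the unsigned angle.\<close>

lemma homog_touch:
  assumes s: "0 < s" and \<phi>: "trig_convex s \<phi>" and w: "w \<noteq> 0"
  obtains c \<delta> where "0 < \<delta>" "\<delta> \<le> 1" "Re c = homog s \<phi> w"
    "\<And>z. z \<in> ball 1 \<delta> \<Longrightarrow> Re (c * z powr of_real s) \<le> homog s \<phi> (w * z)"
proof -
  define t where "t = angle w"
  define \<sigma> :: real where "\<sigma> = (if 0 \<le> Arg w then 1 else - 1)"
  have Argw: "- pi < Arg w" "Arg w \<le> pi" by (auto simp: Arg_bounded mpi_less_Arg Arg_le_pi)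
  have wrc: "w = rcis (norm w) (Arg w)" by (simp add: rcis_cmod_Arg)
  then have "Re w = norm w * cos (Arg w)" by (metis Re_rcis)
  then have "t = arccos (cos (Arg w))" using w by (simp add: t_def angle_def)
  also have "\<dots> = arccos (cos \<bar>Arg w\<bar>)" by (cases "0 \<le> Arg w") auto
  also have "\<dots> = \<bar>Arg w\<bar>" using Argw by (intro arccos_cos) auto
  finally have tA: "Arg w = \<sigma> * t" by (simp add: \<sigma>_def abs_if)
  have t: "t \<in> {0..pi}" using angle_bounds[of w] by (simp add: t_def)
  then obtain \<gamma> \<epsilon> where \<epsilon>: "0 < \<epsilon>" and \<gamma>: "cos \<gamma> = \<phi> t"
    and le: "\<And>b. \<bar>b\<bar> < \<epsilon> \<Longrightarrow> cos (s * b + \<gamma>) \<le> \<phi> (arccos (cos (t + b)))"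
    using \<phi> unfolding trig_convex_def by blast
  have "isCont Arg 1" by (intro continuous_at_Arg) (auto simp: complex_nonpos_Reals_iff)
  then obtain \<delta>0 where \<delta>0: "0 < \<delta>0" "\<And>z. dist z 1 < \<delta>0 \<Longrightarrow> dist (Arg z) (Arg 1) < \<epsilon>"
    using \<epsilon> unfolding continuous_at_eps_delta by (metis dist_commute)
  define \<delta> where "\<delta> = min \<delta>0 1"
  define c where "c = rcis (norm w powr s) (\<sigma> * \<gamma>)"
  have c\<sigma>: "cos (\<sigma> * x) = cos x" for x by (simp add: \<sigma>_def)
  have \<sigma>\<sigma>: "\<sigma> * \<sigma> = 1" by (simp add: \<sigma>_def)
  show thesis
  proof (rule that[of \<delta> c])
    show "0 < \<delta>" "\<delta> \<le> 1" using \<delta>0 by (auto simp: \<delta>_def)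
    show "Re c = homog s \<phi> w" by (simp add: c_def homog_def c\<sigma> \<gamma> t_def)
    fix z :: complex assume z: "z \<in> ball 1 \<delta>"
    then have z0: "z \<noteq> 0" by (auto simp: \<delta>_def)
    define b where "b = \<sigma> * Arg z"
    have b: "\<bar>b\<bar> < \<epsilon>" using z \<delta>0(2)[of z] by (auto simp: b_def \<delta>_def \<sigma>_def dist_real_def dist_commute)
    have Az: "Arg z = \<sigma> * b" using \<sigma>\<sigma> by (simp add: b_def flip: mult.assoc)
    have "z = rcis (norm z) (Arg z)" by (simp add: rcis_cmod_Arg)
    then have wz: "w * z = rcis (norm w * norm z) (\<sigma> * (t + b))"
      using wrc tA Az by (metis rcis_mult distrib_left)
    have "angle (w * z) = arccos (cos (t + b))"
      unfolding angle_def wz using w z0 by (simp add: c\<sigma>)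
    then have "homog s \<phi> (w * z) = (norm w * norm z) powr s * \<phi> (arccos (cos (t + b)))"
      by (simp add: homog_def norm_mult)
    moreover have "z powr of_real s = rcis (norm z powr s) (s * Arg z)"
    proof -
      have "z powr of_real s = exp (of_real s * Ln z)" using z0 by (simp add: powr_def)
      also have "Ln z = of_real (ln (norm z)) + \<i> * of_real (Arg z)"
        using z0 by (simp add: Arg_eq_Im_Ln complex_eq_iff Re_Ln)
      also have "exp (of_real s * (of_real (ln (norm z)) + \<i> * of_real (Arg z)))
          = exp (of_real (s * ln (norm z))) * exp (\<i> * of_real (s * Arg z))"
        by (simp add: exp_add[symmetric] algebra_simps)
      also have "\<dots> = rcis (norm z powr s) (s * Arg z)"
        using z0 by (simp add: rcis_def cis_conv_exp powr_def exp_of_real del: of_real_mult of_real_exp)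
      finally show ?thesis .
    qed
    then have "c * z powr of_real s = rcis ((norm w * norm z) powr s) (\<sigma> * (s * b + \<gamma>))"
      using Az by (simp add: c_def rcis_mult powr_mult algebra_simps)
    then have "Re (c * z powr of_real s) = (norm w * norm z) powr s * cos (s * b + \<gamma>)"
      by (simp add: c\<sigma>)
    ultimately show "Re (c * z powr of_real s) \<le> homog s \<phi> (w * z)"
      using mult_left_mono[OF le[OF b], of "(norm w * norm z) powr s"] by simp
  qed
qed

lemma ball_subset_unit_ball: "ball a (1 - norm a) \<subseteq> ball 0 1"
proof
  fix y assume "y \<in> ball a (1 - norm a)"
  then show "y \<in> ball 0 1"
    using norm_triangle_ineq2[of y a] by (auto simp: dist_norm norm_minus_commute)
qed

text \<open>Division by \<open>F a\<close> moves the values close to \<open>1\<close>, away from the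
  branch cut of powers and logarithms.\<close>

lemma quotient_near_one:
  assumes F: "F holomorphic_on ball 0 1" and a: "norm a < 1" "F a \<noteq> 0" and \<delta>: "0 < \<delta>"
  obtains \<eta> where "0 < \<eta>" "ball a \<eta> \<subseteq> ball 0 1" "\<And>z. z \<in> ball a \<eta> \<Longrightarrow> F z / F a \<in> ball 1 \<delta>"
proof -
  have "continuous_on (ball 0 1) (\<lambda>z. F z / F a)"
    using F a by (intro continuous_intros holomorphic_on_imp_continuous_on) auto
  then have "isCont (\<lambda>z. F z / F a) a"
    using a by (simp add: continuous_on_eq_continuous_at)
  then obtain d where d: "0 < d" "\<And>z. dist z a < d \<Longrightarrow> dist (F z / F a) (F a / F a) < \<delta>"
    using \<delta> unfolding continuous_at_eps_delta by metis
  show thesis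
  proof (rule that[of "min d (1 - norm a)"])
    show "0 < min d (1 - norm a)" using a d by simp
    show "ball a (min d (1 - norm a)) \<subseteq> ball 0 1"
      using ball_subset_unit_ball[of a] by (auto simp: subset_iff)
    show "F z / F a \<in> ball 1 \<delta>" if "z \<in> ball a (min d (1 - norm a))" for z
      using that d(2)[of z] a(2) by (auto simp: dist_commute)
  qed
qed

lemma near_one_not_nonpos: "(z::complex) \<in> ball 1 \<delta> \<Longrightarrow> \<delta> \<le> 1 \<Longrightarrow> z \<notin> \<real>\<^sub>\<le>\<^sub>0"
  using complex_Re_le_cmod[of "1 - z"] by (auto simp: complex_nonpos_Reals_iff dist_norm)

lemma homog_comp_touches:
  assumes s: "0 < s" and \<phi>: "trig_convex s \<phi>" and F: "F holomorphic_on ball 0 1"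
    and a: "norm a < 1" "F a \<noteq> 0"
  shows "touches_from_below (\<lambda>z. homog s \<phi> (F z)) a"
proof -
  obtain c \<delta> where \<delta>: "0 < \<delta>" "\<delta> \<le> 1" and c: "Re c = homog s \<phi> (F a)"
    "\<And>z. z \<in> ball 1 \<delta> \<Longrightarrow> Re (c * z powr of_real s) \<le> homog s \<phi> (F a * z)"
    using homog_touch[OF s \<phi> a(2)] by blast
  obtain \<eta> where \<eta>: "0 < \<eta>" and sub: "ball a \<eta> \<subseteq> ball 0 1"
    and near: "\<And>z. z \<in> ball a \<eta> \<Longrightarrow> F z / F a \<in> ball 1 \<delta>"
    using quotient_near_one[OF F a \<delta>(1)] by blast
  show ?thesis
    unfolding touches_from_below_def
  proof (intro exI[of _ \<eta>] exI[of _ "\<lambda>z. c * (F z / F a) powr of_real s"] conjI ballI)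
    show "(\<lambda>z. c * (F z / F a) powr of_real s) holomorphic_on ball a \<eta>"
      by (intro holomorphic_intros holomorphic_on_subset[OF F sub])
        (use a near_one_not_nonpos[OF near \<delta>(2)] in auto)
    show "Re (c * (F a / F a) powr of_real s) = homog s \<phi> (F a)" using a c by simp
    fix z assume "z \<in> ball a \<eta>"
    then show "Re (c * (F z / F a) powr of_real s) \<le> homog s \<phi> (F z)"
      using c(2)[OF near] a(2) by simp
  qed (rule \<eta>)
qed

text \<open>For a polynomial \<open>P\<close> the mean of \<open>Re (poly P (c * z ^ n))\<close> is
  \<open>Re (poly P 0)\<close>, whatever \<open>c\<close> and \<open>n > 0\<close> are. Uniform
  approximation on the circle extends this invariance to \<open>v\<close>.\<close>

lemma circle_mean_cover:
  fixes v :: "complex \<Rightarrow> real" and c :: complex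
  assumes v: "continuous_on UNIV v" and c: "norm c = 1" and n: "0 < n"
  shows "(\<integral>z. v (c * z ^ n) \<partial>circle) = (\<integral>z. v z \<partial>circle)"
proof -
  interpret prob_space circle by (rule prob_space_circle)
  have cv: "continuous_on UNIV (\<lambda>z::complex. v (c * z ^ n))"
    by (intro continuous_on_compose2[OF v] continuous_intros) auto
  have "\<bar>(\<integral>z. v (c * z ^ n) \<partial>circle) - (\<integral>z. v z \<partial>circle)\<bar> \<le> 0 + e" if e: "e > 0" for e
  proof -
    obtain P where P: "\<And>z. norm z = 1 \<Longrightarrow> \<bar>v z - Re (poly P z)\<bar> < e / 2"
      using Re_poly_approx_circle[of v "e / 2"] continuous_on_subset[OF v] e by auto
    have close: "\<bar>(\<integral>z. v (c * z ^ n) \<partial>circle) - Re (poly P 0)\<bar> \<le> e / 2"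
      if c: "norm c = 1" and n: "0 < n" for c :: complex and n
    proof -
      have cv: "continuous_on UNIV (\<lambda>z::complex. v (c * z ^ n))"
        by (intro continuous_on_compose2[OF v] continuous_intros) auto
      have mean: "(\<integral>z. Re (poly P (c * z ^ n)) + d \<partial>circle) = Re (poly P 0) + d" for d
      proof -
        have "poly P (c * z ^ n) = poly (pcompose P (monom c n)) z" for z
          by (simp add: poly_pcompose poly_monom)
        then show ?thesis
          using circle_mean_Re_poly[of "pcompose P (monom c n)" 0 1] n prob_space
          by (subst Bochner_Integration.integral_add)
             (auto intro!: integrable_circle continuous_intros simp: poly_pcompose poly_monom zero_power)
      qed
      have nn: "norm (c * z ^ n) = 1" if "norm z = 1" for z
        using that c by (simp add: norm_mult norm_power)
      have "(\<integral>z. v (c * z ^ n) \<partial>circle) \<le> (\<integral>z. Re (poly P (c * z ^ n)) + e / 2 \<partial>circle)"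
      proof (intro circle_mean_mono cv)
        fix z :: complex assume "norm z = 1"
        from P[OF nn[OF this]] show "v (c * z ^ n) \<le> Re (poly P (c * z ^ n)) + e / 2" by linarith
      qed (auto intro!: continuous_intros)
      moreover have "(\<integral>z. Re (poly P (c * z ^ n)) + - (e / 2) \<partial>circle) \<le> (\<integral>z. v (c * z ^ n) \<partial>circle)"
      proof (intro circle_mean_mono cv)
        fix z :: complex assume "norm z = 1"
        from P[OF nn[OF this]] show "Re (poly P (c * z ^ n)) + - (e / 2) \<le> v (c * z ^ n)" by linarith
      qed (auto intro!: continuous_intros)
      ultimately show ?thesis unfolding mean by linarith
    qed
    have "\<bar>(\<integral>z. v z \<partial>circle) - Re (poly P 0)\<bar> \<le> e / 2" using close[of 1 1] by simp
    with close[OF c n] show ?thesis unfolding abs_le_iff by linarith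
  qed
  then have "\<bar>(\<integral>z. v (c * z ^ n) \<partial>circle) - (\<integral>z. v z \<partial>circle)\<bar> \<le> 0"
    by (rule field_le_epsilon)
  then show ?thesis by simp
qed

text \<open>Near a zero of order \<open>k\<close> the function \<open>F\<close> is \<open>c (z - a)\<^sup>k\<close> up to smaller terms, so by homogeneity the
  mean over a small circle is a positive multiple of the mean of \<open>homog s \<phi>\<close>, up to a smaller error.\<close>

lemma homog_comp_mean_near_zero:
  assumes s: "0 < s" and \<phi>: "continuous_on {0..pi} \<phi>"
    and mean: "0 < (\<integral>z. homog s \<phi> z \<partial>circle)"
    and F: "F holomorphic_on ball 0 1" "continuous_on UNIV F"
    and nc: "\<not> F constant_on ball 0 1" and a: "norm a < 1" "F a = 0"
  shows "\<exists>r>0. r < 1 - norm a \<and> 0 < (\<integral>\<zeta>. homog s \<phi> (F (a + r * \<zeta>)) \<partial>circle)"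
proof -
  interpret prob_space circle by (rule prob_space_circle)
  have ch: "continuous_on UNIV (homog s \<phi>)" by (rule continuous_on_homog[OF s \<phi>])
  obtain g \<rho> n where n: "0 < n" and \<rho>: "0 < \<rho>" "ball a \<rho> \<subseteq> ball 0 1" and g: "g holomorphic_on ball a \<rho>"
    and Fg: "\<And>w. w \<in> ball a \<rho> \<Longrightarrow> F w = (w - a) ^ n * g w" and g0: "\<And>w. w \<in> ball a \<rho> \<Longrightarrow> g w \<noteq> 0"
    using holomorphic_factor_zero_nonconstant[OF F(1) _ _ _ a(2) nc] a(1) by auto metis
  define R where "R = min (\<rho> / 2) ((1 - norm a) / 2)"
  have R: "0 < R" "R < \<rho>" "R < 1 - norm a" using \<rho>(1) a(1) by (auto simp: R_def min_def)
  define r where "r k = R / (real k + 1)" for k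
  have r: "0 < r k" "r k \<le> R" for k using R by (auto simp: r_def divide_le_eq)
  have rlim: "r \<longlonglongrightarrow> 0" unfolding r_def by real_asymp
  \<comment> \<open>A zero of order \<open>n\<close> together with homogeneity of degree
    \<open>s\<close> makes \<open>r powr (n * s)\<close> the exact size of the values on the circle
    of radius \<open>r\<close>; after division the means have a positive limit.\<close>
  define w where "w k \<zeta> = homog s \<phi> (F (a + r k * \<zeta>)) / r k powr (n * s)" for k and \<zeta> :: complex
  have inb: "a + r k * \<zeta> \<in> ball a \<rho>" "a + r k * \<zeta> \<in> cball a R" if "norm \<zeta> = 1" for k and \<zeta> :: complex
    using that r[of k] R by (auto simp: dist_norm norm_mult)
  have weq: "w k \<zeta> = homog s \<phi> (\<zeta> ^ n * g (a + r k * \<zeta>))" if "norm \<zeta> = 1" for k and \<zeta> :: complex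
  proof -
    have "F (a + r k * \<zeta>) = of_real (r k ^ n) * (\<zeta> ^ n * g (a + r k * \<zeta>))"
      using Fg[OF inb(1)[OF that]] by (simp add: power_mult_distrib mult_ac)
    moreover have "(r k ^ n) powr s = r k powr (n * s)"
      using r[of k] by (simp add: powr_powr flip: powr_realpow)
    ultimately have eq: "homog s \<phi> (F (a + r k * \<zeta>)) = r k powr (n * s) * homog s \<phi> (\<zeta> ^ n * g (a + r k * \<zeta>))"
      using homog_scale[of "r k ^ n" s \<phi>] zero_le_power[OF less_imp_le[OF r(1)], of k n] by metis
    have "r k \<noteq> 0" by (metis r(1) less_irrefl)
    then have "r k powr (n * s) \<noteq> 0" by simp
    then show ?thesis unfolding w_def eq by (rule nonzero_mult_div_cancel_left)
  qed
  have "(\<lambda>k. \<integral>\<zeta>. w k \<zeta> \<partial>circle) \<longlonglongrightarrow> (\<integral>\<zeta>. homog s \<phi> (\<zeta> ^ n * g a) \<partial>circle)"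
  proof -
    have "compact (g ` cball a R)"
      using R by (intro compact_continuous_image holomorphic_on_imp_continuous_on holomorphic_on_subset[OF g]) auto
    then obtain B where B: "\<And>z. z \<in> cball a R \<Longrightarrow> norm (g z) \<le> B"
      by (force dest!: compact_imp_bounded simp: bounded_iff)
    have "compact (homog s \<phi> ` cball 0 B)"
      by (intro compact_continuous_image continuous_on_subset[OF ch]) auto
    then obtain C where C: "\<And>z. norm z \<le> B \<Longrightarrow> \<bar>homog s \<phi> z\<bar> \<le> C"
      by (force dest!: compact_imp_bounded simp: bounded_iff)
    have meas: "continuous_on UNIV (\<lambda>\<zeta>. homog s \<phi> (\<zeta> ^ n * g a))" "continuous_on UNIV (w k)" for k
      using less_imp_neq[OF r(1)[of k]] unfolding w_def
      by (auto intro!: continuous_intros continuous_on_compose2[OF ch] continuous_on_compose2[OF F(2)])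
    show ?thesis
    proof (rule integral_dominated_convergence[where w = "\<lambda>_. C"])
      show "AE \<zeta> in circle. (\<lambda>k. w k \<zeta>) \<longlonglongrightarrow> homog s \<phi> (\<zeta> ^ n * g a)"
        using AE_circle
      proof eventually_elim
        fix \<zeta> :: complex assume \<zeta>: "norm \<zeta> = 1"
        have "isCont g a"
          using holomorphic_on_imp_continuous_on[OF g] \<rho>(1) by (simp add: continuous_on_eq_continuous_at)
        moreover have "(\<lambda>k. a + r k * \<zeta>) \<longlonglongrightarrow> a + of_real 0 * \<zeta>"
          by (intro tendsto_intros rlim)
        ultimately have "(\<lambda>k. \<zeta> ^ n * g (a + r k * \<zeta>)) \<longlonglongrightarrow> \<zeta> ^ n * g a"
          by (intro tendsto_intros isCont_tendsto_compose[of a g]) auto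
        then have "(\<lambda>k. homog s \<phi> (\<zeta> ^ n * g (a + r k * \<zeta>))) \<longlonglongrightarrow> homog s \<phi> (\<zeta> ^ n * g a)"
          using ch by (intro isCont_tendsto_compose[of "\<zeta> ^ n * g a" "homog s \<phi>"])
            (auto simp: continuous_on_eq_continuous_at)
        then show "(\<lambda>k. w k \<zeta>) \<longlonglongrightarrow> homog s \<phi> (\<zeta> ^ n * g a)" by (simp add: weq[OF \<zeta>])
      qed
      show "(\<lambda>\<zeta>. homog s \<phi> (\<zeta> ^ n * g a)) \<in> borel_measurable circle" "w k \<in> borel_measurable circle" for k
        using meas[THEN borel_measurable_continuous_onI] by (simp_all cong: measurable_cong_sets)
      show "AE \<zeta> in circle. norm (w k \<zeta>) \<le> C" for k
        using AE_circle
      proof eventually_elim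
        fix \<zeta> :: complex assume \<zeta>: "norm \<zeta> = 1"
        show "norm (w k \<zeta>) \<le> C"
          unfolding weq[OF \<zeta>] using B[OF inb(2)[OF \<zeta>]] \<zeta> by (intro order_trans[OF _ C]) (auto simp: norm_mult norm_power)
      qed
    qed simp
  qed
  moreover have "(\<integral>\<zeta>. homog s \<phi> (\<zeta> ^ n * g a) \<partial>circle) > 0"
  proof -
    have ga: "g a \<noteq> 0" using g0 \<rho> by auto
    have "homog s \<phi> (\<zeta> ^ n * g a) = norm (g a) powr s * homog s \<phi> (sgn (g a) * \<zeta> ^ n)" for \<zeta>
    proof -
      have "\<zeta> ^ n * g a = of_real (norm (g a)) * (sgn (g a) * \<zeta> ^ n)"
        using ga by (simp add: sgn_eq)
      then show ?thesis by (simp only: homog_scale norm_ge_zero)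
    qed
    then show ?thesis
      using circle_mean_cover[OF ch _ n, of "sgn (g a)"] ga mean by (simp add: norm_sgn)
  qed
  ultimately have "eventually (\<lambda>k. 0 < (\<integral>\<zeta>. w k \<zeta> \<partial>circle)) sequentially"
    by (simp add: order_tendstoD)
  then obtain k where "0 < (\<integral>\<zeta>. w k \<zeta> \<partial>circle)"
    by (auto simp: eventually_sequentially)
  then have "0 < (\<integral>\<zeta>. homog s \<phi> (F (a + r k * \<zeta>)) \<partial>circle)"
    using r[of k] by (simp add: w_def zero_less_divide_iff)
  then show ?thesis using r[of k] R by (intro exI[of _ "r k"]) auto
qed

text \<open>Where \<open>F\<close> is not zero there is a holomorphic touching function. At a zero
  of a nonconstant \<open>F\<close> the extension may be negative nearby, and the positive mean
  supplies the strict alternative instead. If \<open>F\<close> is constantly zero on the disc, the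
  function \<open>0\<close> touches.\<close>

lemma homog_comp_submean_of_mean_pos:
  assumes s: "0 < s" and \<phi>: "continuous_on {0..pi} \<phi>" "trig_convex s \<phi>"
    and mean: "0 < (\<integral>z. homog s \<phi> z \<partial>circle)"
    and F: "F holomorphic_on ball 0 1" "continuous_on UNIV F"
  shows "homog s \<phi> (F 0) \<le> (\<integral>z. homog s \<phi> (F z) \<partial>circle)"
proof (rule submean_circle)
  show "continuous_on UNIV (\<lambda>z. homog s \<phi> (F z))"
    using continuous_on_compose2[OF continuous_on_homog[OF s \<phi>(1)] F(2)] by simp
  fix a :: complex assume a: "norm a < 1"
  show "touches_from_below (\<lambda>z. homog s \<phi> (F z)) a \<or>
     (\<exists>r>0. r < 1 - norm a \<and> homog s \<phi> (F a) < (\<integral>\<zeta>. homog s \<phi> (F (a + r * \<zeta>)) \<partial>circle))"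
  proof (cases "F a = 0")
    case False
    then show ?thesis using homog_comp_touches[OF s \<phi>(2) F(1) a] by simp
  next
    case True
    show ?thesis
    proof (cases "F constant_on ball 0 1")
      case const: True
      have "F z = 0" if "z \<in> ball 0 1" for z
        using const True a that unfolding constant_on_def by (metis mem_ball_0)
      then have "touches_from_below (\<lambda>z. homog s \<phi> (F z)) a"
        unfolding touches_from_below_def using a ball_subset_unit_ball[of a]
        by (intro exI[of _ "1 - norm a"] conjI exI[of _ "\<lambda>_. 0"]) auto
      then show ?thesis ..
    next
      case False
      then show ?thesis using homog_comp_mean_near_zero[OF s \<phi>(1) mean F False a True] True by simp
    qed
  qed
qed

lemma circle_mean_eq_integral:
  fixes v :: "complex \<Rightarrow> real"
  assumes v: "continuous_on UNIV v"
  shows "(\<integral>z. v z \<partial>circle) = integral {0..2*pi} (\<lambda>x. v (cis x)) / (2 * pi)"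
proof -
  have [measurable]: "v \<in> borel_measurable borel" using v by (rule borel_measurable_continuous_onI)
  have "(\<integral>z. v z \<partial>circle) = (\<integral>x. v (cis x) \<partial>uniform_measure lborel {0..2 * pi})"
    unfolding circle_def by (rule integral_distr) auto
  also have "\<dots> = (LBINT x:{0..2*pi}. v (cis x)) / (2 * pi)"
    unfolding uniform_measure_eq_density set_lebesgue_integral_def
    by (subst integral_density) auto
  also have "(LBINT x:{0..2*pi}. v (cis x)) = integral {0..2*pi} (\<lambda>x. v (cis x))"
    by (intro set_borel_integral_eq_integral(2) borel_integrable_atLeastAtMost')
       (auto intro!: continuous_on_compose2[OF v] continuous_intros)
  finally show ?thesis .
qed

text \<open>The reflection \<open>x \<mapsto> 2 * pi - x\<close> maps the lower half circle to the
  upper one without changing the unsigned angle.\<close>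

lemma circle_mean_homog:
  assumes s: "0 < s" and \<phi>: "continuous_on {0..pi} \<phi>"
  shows "(\<integral>z. homog s \<phi> z \<partial>circle) = integral {0..pi} \<phi> / pi"
proof -
  have i\<phi>: "(\<phi> has_integral integral {0..pi} \<phi>) {0..pi}"
    using \<phi> by (intro integrable_integral integrable_continuous_real)
  have v: "homog s \<phi> (cis x) = \<phi> (arccos (cos x))" for x
    by (simp add: homog_def angle_def)
  have 1: "((\<lambda>x. homog s \<phi> (cis x)) has_integral integral {0..pi} \<phi>) {0..pi}"
    using i\<phi> by (rule has_integral_eq[rotated]) (simp add: v arccos_cos)
  have im: "(\<lambda>x. - x + 2 * pi) ` {0..pi} = {pi..2 * pi}"
  proof (intro equalityI subsetI)
    fix y assume "y \<in> {pi..2 * pi}"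
    then show "y \<in> (\<lambda>x. - x + 2 * pi) ` {0..pi}" by (intro image_eqI[of _ _ "2 * pi - y"]) auto
  qed auto
  have "((\<lambda>x. \<phi> (- x + 2 * pi)) has_integral integral {0..pi} \<phi>) {pi..2 * pi}"
    using has_integral_affinity[of \<phi> "integral {0..pi} \<phi>" 0 pi "- 1" "2 * pi"] i\<phi> by (simp add: im)
  moreover have "homog s \<phi> (cis x) = \<phi> (- x + 2 * pi)" if "x \<in> {pi..2 * pi}" for x
  proof -
    have "cos x = cos (- x + 2 * pi)" by (simp add: cos_diff)
    moreover have "arccos (cos (- x + 2 * pi)) = - x + 2 * pi" using that by (intro arccos_cos) auto
    ultimately show ?thesis by (simp only: v)
  qed
  ultimately have 2: "((\<lambda>x. homog s \<phi> (cis x)) has_integral integral {0..pi} \<phi>) {pi..2*pi}"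
    by (subst has_integral_cong) auto
  have "((\<lambda>x. homog s \<phi> (cis x)) has_integral (integral {0..pi} \<phi> + integral {0..pi} \<phi>)) {0..2*pi}"
    by (rule has_integral_combine[OF _ _ 1 2]) auto
  then show ?thesis
    by (simp add: circle_mean_eq_integral[OF continuous_on_homog[OF s \<phi>]] integral_unique field_simps)
qed


text \<open>The integral of the profile is \<open>sin (s * pi) / s\<close>, which vanishes at
  \<open>s = 1\<close>. That case is treated apart in \<open>submean_phi_lo\<close>, where the
  extension is linear.\<close>

lemma circle_mean_phi_lo_pos:
  assumes s: "0 < s" "s < 1"
  shows "0 < (\<integral>z. homog s (phi_lo s) z \<partial>circle)"
proof -
  have "((\<lambda>t. cos (s * t)) has_integral (sin (s * pi) / s - sin (s * 0) / s)) {0..pi}"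
    using s by (intro fundamental_theorem_of_calculus)
      (auto intro!: derivative_eq_intros simp: has_real_derivative_iff_has_vector_derivative[symmetric])
  then have "integral {0..pi} (phi_lo s) = sin (s * pi) / s"
    by (simp add: phi_lo_def[abs_def] integral_unique)
  moreover have "0 < sin (s * pi)" using s by (intro sin_gt_zero) auto
  ultimately show ?thesis
    using s by (subst circle_mean_homog) (auto simp: phi_lo_def[abs_def] intro!: continuous_intros)
qed

lemma continuous_on_phi_lo: "continuous_on A (phi_lo s)"
  unfolding phi_lo_def[abs_def] by (intro continuous_intros)

lemma continuous_on_phi_hi: "continuous_on A (phi_hi s)"
  unfolding phi_hi_def[abs_def] by (intro continuous_intros)

text \<open>The cosine part over \<open>[0, pi / s]\<close> integrates to \<open>0\<close>; the
  surplus \<open>pi - pi / s\<close> comes from the cap alone.\<close>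

lemma circle_mean_phi_hi_pos:
  assumes s: "1 < s"
  shows "0 < (\<integral>z. homog s (phi_hi s) z \<partial>circle)"
proof -
  have "((\<lambda>t. - cos (s * t)) has_integral (- sin (s * (pi / s)) / s - - sin (s * 0) / s)) {0..pi / s}"
    using s by (intro fundamental_theorem_of_calculus)
      (auto intro!: derivative_eq_intros simp: has_real_derivative_iff_has_vector_derivative[symmetric])
  then have "((\<lambda>t. - cos (s * t)) has_integral 0) {0..pi / s}" using s by simp
  then have 1: "(phi_hi s has_integral 0) {0..pi / s}"
    by (rule has_integral_eq[rotated]) (use s in \<open>auto simp: phi_hi_def field_simps min_def\<close>)
  have "((\<lambda>_. 1 :: real) has_integral (pi - pi / s)) {pi / s..pi}"
    using has_integral_const_real[of "1::real" "pi / s" pi] s by (simp add: divide_le_eq)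
  then have 2: "(phi_hi s has_integral (pi - pi / s)) {pi / s..pi}"
    by (rule has_integral_eq[rotated]) (use s in \<open>auto simp: phi_hi_eq_one field_simps\<close>)
  have "(phi_hi s has_integral (0 + (pi - pi / s))) {0..pi}"
    by (rule has_integral_combine[OF _ _ 1 2]) (use s in \<open>auto simp: divide_le_eq\<close>)
  then have "integral {0..pi} (phi_hi s) = pi - pi / s" by (simp add: integral_unique)
  moreover have "pi / s < pi" using s by (simp add: divide_less_eq)
  ultimately show ?thesis
    using s by (subst circle_mean_homog) (auto intro!: continuous_on_phi_hi)
qed

text \<open>Continuity is asked for on the whole plane so that compositions are Borel and continuous
  at once; the integrals only involve values on the closed disc.\<close>

definition disc_algebra :: "(complex \<Rightarrow> complex) \<Rightarrow> bool" where
  "disc_algebra F \<longleftrightarrow> F holomorphic_on ball 0 1 \<and> continuous_on UNIV F"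

lemma homog_one_submean:
  assumes F: "disc_algebra F" and eq: "\<And>w. homog s \<phi> w = Re (c * w)"
  shows "homog s \<phi> (F 0) \<le> (\<integral>z. homog s \<phi> (F z) \<partial>circle)"
proof (rule submean_circle)
  show "continuous_on UNIV (\<lambda>z. homog s \<phi> (F z))"
    unfolding eq using F by (auto intro!: continuous_intros simp: disc_algebra_def)
  fix a :: complex assume a: "norm a < 1"
  have "(\<lambda>z. c * F z) holomorphic_on ball 0 1"
    using F unfolding disc_algebra_def by (intro holomorphic_intros) simp
  then have "(\<lambda>z. c * F z) holomorphic_on ball a (1 - norm a)"
    by (rule holomorphic_on_subset) (rule ball_subset_unit_ball)
  then have "touches_from_below (\<lambda>z. homog s \<phi> (F z)) a"
    unfolding touches_from_below_def eq using a
    by (intro exI[of _ "1 - norm a"] conjI exI[of _ "\<lambda>z. c * F z"]) auto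
  then show "touches_from_below (\<lambda>z. homog s \<phi> (F z)) a \<or>
     (\<exists>r>0. r < 1 - norm a \<and> homog s \<phi> (F a) < (\<integral>\<zeta>. homog s \<phi> (F (a + r * \<zeta>)) \<partial>circle))" ..
qed

lemma submean_phi_hi:
  assumes s: "1 \<le> s" and F: "disc_algebra F"
  shows "homog s (phi_hi s) (F 0) \<le> (\<integral>z. homog s (phi_hi s) (F z) \<partial>circle)"
proof (cases "s = 1")
  case True
  have "homog 1 (phi_hi 1) w = Re (- 1 * w)" for w
  proof -
    have "min (1 * angle w) pi = angle w" using angle_bounds[of w] by simp
    then have "homog 1 (phi_hi 1) w = - (norm w * cos (angle w))"
      by (simp only: homog_def phi_hi_def powr_one norm_ge_zero mult_minus_right)
    then show ?thesis by (simp only: norm_mult_cos_angle) simp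
  qed
  then show ?thesis using homog_one_submean[OF F, of 1 "phi_hi 1" "- 1"] True by simp
next
  case False
  then show ?thesis
    using s F homog_comp_submean_of_mean_pos[OF _ continuous_on_phi_hi trig_convex_phi_hi circle_mean_phi_hi_pos]
    by (auto simp: disc_algebra_def)
qed

lemma submean_phi_lo:
  assumes s: "0 < s" "s \<le> 1" and F: "disc_algebra F"
  shows "homog s (phi_lo s) (F 0) \<le> (\<integral>z. homog s (phi_lo s) (F z) \<partial>circle)"
proof (cases "s = 1")
  case True
  have "homog 1 (phi_lo 1) w = Re (1 * w)" for w
    using norm_mult_cos_angle[of w] by (simp add: homog_def phi_lo_def)
  then show ?thesis using homog_one_submean[OF F, of 1 "phi_lo 1" 1] True by simp
next
  case False
  then show ?thesis
    using s F homog_comp_submean_of_mean_pos[OF _ continuous_on_phi_lo trig_convex_phi_lo circle_mean_phi_lo_pos]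
    by (auto simp: disc_algebra_def)
qed

section \<open>Carleman's inequality in weighted form\<close>

lemma lborel_complex:
  "(lborel :: complex measure) = distr (lborel \<Otimes>\<^sub>M lborel) borel (\<lambda>(x, y). Complex x y)"
proof (rule lborel_eqI)
  fix l u :: complex assume le: "\<And>b. b \<in> Basis \<Longrightarrow> l \<bullet> b \<le> u \<bullet> b"
  have m: "(\<lambda>(x, y). Complex x y) \<in> borel_measurable (lborel \<Otimes>\<^sub>M lborel)"
    unfolding borel_measurable_complex_iff by (simp add: split_beta)
  have "(\<lambda>(x, y). Complex x y) -` box l u = {Re l<..<Re u} \<times> {Im l<..<Im u}"
    by (auto simp: box_def Basis_complex_def inner_complex_def)
  then have "emeasure (distr (lborel \<Otimes>\<^sub>M lborel) borel (\<lambda>(x, y). Complex x y)) (box l u)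
      = emeasure (lborel \<Otimes>\<^sub>M lborel) ({Re l<..<Re u} \<times> {Im l<..<Im u})"
    using m by (subst emeasure_distr) (auto simp: space_pair_measure)
  also have "\<dots> = ennreal (Re u - Re l) * ennreal (Im u - Im l)"
    using le[of 1] le[of \<i>] by (subst lborel.emeasure_pair_measure_Times) (auto simp: Basis_complex_def)
  also have "\<dots> = (\<Prod>b\<in>Basis. (u - l) \<bullet> b)"
    using le[of 1] le[of \<i>] by (simp add: Basis_complex_def ennreal_mult'' complex_eq_iff)
  finally show "emeasure (distr (lborel \<Otimes>\<^sub>M lborel) borel (\<lambda>(x, y). Complex x y)) (box l u)
      = (\<Prod>b\<in>Basis. (u - l) \<bullet> b)" .
qed simp

lemma borel_measurable_Complex [measurable]:
  "f \<in> borel_measurable M \<Longrightarrow> g \<in> borel_measurable M \<Longrightarrow> (\<lambda>x. Complex (f x) (g x)) \<in> borel_measurable M"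
  by (simp add: borel_measurable_complex_iff)

lemma nn_integral_lborel_complex:
  assumes [measurable]: "f \<in> borel_measurable borel"
  shows "(\<integral>\<^sup>+z. f z \<partial>lborel) = (\<integral>\<^sup>+x. \<integral>\<^sup>+y. f (Complex x y) \<partial>lborel \<partial>lborel)"
    and "(\<integral>\<^sup>+z. f z \<partial>lborel) = (\<integral>\<^sup>+y. \<integral>\<^sup>+x. f (Complex x y) \<partial>lborel \<partial>lborel)"
proof -
  have "(\<integral>\<^sup>+z. f z \<partial>lborel) = (\<integral>\<^sup>+w. f (Complex (fst w) (snd w)) \<partial>(lborel \<Otimes>\<^sub>M lborel))"
    by (subst lborel_complex, subst nn_integral_distr) (auto simp: split_beta)
  then show 1: "(\<integral>\<^sup>+z. f z \<partial>lborel) = (\<integral>\<^sup>+x. \<integral>\<^sup>+y. f (Complex x y) \<partial>lborel \<partial>lborel)"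
    by (subst (asm) lborel.nn_integral_fst[symmetric]) auto
  show "(\<integral>\<^sup>+z. f z \<partial>lborel) = (\<integral>\<^sup>+y. \<integral>\<^sup>+x. f (Complex x y) \<partial>lborel \<partial>lborel)"
    unfolding 1 by (rule lborel_pair.Fubini'[symmetric]) measurable
qed

text \<open>Rotations are products of shears, and shears preserve the measure by Fubini.\<close>

lemma nn_integral_lborel_shear:
  fixes f :: "complex \<Rightarrow> ennreal"
  assumes [measurable]: "f \<in> borel_measurable borel"
  shows "(\<integral>\<^sup>+z. f (Complex (Re z + a * Im z) (Im z)) \<partial>lborel) = (\<integral>\<^sup>+z. f z \<partial>lborel)"
    and "(\<integral>\<^sup>+z. f (Complex (Re z) (Im z + a * Re z)) \<partial>lborel) = (\<integral>\<^sup>+z. f z \<partial>lborel)"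
proof -
  have shift: "(\<integral>\<^sup>+x. g (x + c) \<partial>lborel) = (\<integral>\<^sup>+x. g x \<partial>lborel)"
    if [measurable]: "g \<in> borel_measurable borel" for g :: "real \<Rightarrow> ennreal" and c
    using nn_integral_real_affine[of g 1 c] by (simp add: add.commute)
  have "(\<integral>\<^sup>+z. f (Complex (Re z + a * Im z) (Im z)) \<partial>lborel)
     = (\<integral>\<^sup>+y. \<integral>\<^sup>+x. f (Complex (x + a * y) y) \<partial>lborel \<partial>lborel)"
    by (subst nn_integral_lborel_complex(2)) auto
  also have "\<dots> = (\<integral>\<^sup>+y. \<integral>\<^sup>+x. f (Complex x y) \<partial>lborel \<partial>lborel)"
    by (intro nn_integral_cong shift) auto
  also have "\<dots> = (\<integral>\<^sup>+z. f z \<partial>lborel)" by (rule nn_integral_lborel_complex(2)[symmetric]) simp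
  finally show "(\<integral>\<^sup>+z. f (Complex (Re z + a * Im z) (Im z)) \<partial>lborel) = (\<integral>\<^sup>+z. f z \<partial>lborel)" .
  have "(\<integral>\<^sup>+z. f (Complex (Re z) (Im z + a * Re z)) \<partial>lborel)
     = (\<integral>\<^sup>+x. \<integral>\<^sup>+y. f (Complex x (y + a * x)) \<partial>lborel \<partial>lborel)"
    by (subst nn_integral_lborel_complex(1)) auto
  also have "\<dots> = (\<integral>\<^sup>+x. \<integral>\<^sup>+y. f (Complex x y) \<partial>lborel \<partial>lborel)"
    by (intro nn_integral_cong shift) auto
  also have "\<dots> = (\<integral>\<^sup>+z. f z \<partial>lborel)" by (rule nn_integral_lborel_complex(1)[symmetric]) simp
  finally show "(\<integral>\<^sup>+z. f (Complex (Re z) (Im z + a * Re z)) \<partial>lborel) = (\<integral>\<^sup>+z. f z \<partial>lborel)" .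
qed

lemma nn_integral_lborel_rotate:
  fixes f :: "complex \<Rightarrow> ennreal"
  assumes f [measurable]: "f \<in> borel_measurable borel" and c: "norm c = 1"
  shows "(\<integral>\<^sup>+z. f (c * z) \<partial>lborel) = (\<integral>\<^sup>+z. f z \<partial>lborel)"
proof -
  have main: "(\<integral>\<^sup>+z. f (c * z) \<partial>lborel) = (\<integral>\<^sup>+z. f z \<partial>lborel)"
    if c: "norm c = 1" "Re c \<noteq> - 1" and f [measurable]: "f \<in> borel_measurable borel"
    for c and f :: "complex \<Rightarrow> ennreal"
  proof -
    \<comment> \<open>For \<open>c = cis \<theta>\<close> this is
      \<open>- tan (\<theta> / 2)\<close>: the rotation is the product of shears with parameters
      \<open>t\<close>, \<open>Im c\<close> and \<open>t\<close>. The formula breaks down at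
      \<open>c = - 1\<close>, which is treated as two rotations by \<open>\<i>\<close>.\<close>
    define t where "t = - (Im c / (1 + Re c))"
    define S where "S z = Complex (Re z + t * Im z) (Im z)" for z
    define T where "T z = Complex (Re z) (Im z + Im c * Re z)" for z
    have sq: "(Re c)\<^sup>2 + (Im c)\<^sup>2 = 1" using c(1) by (simp flip: cmod_power2)
    have ne: "1 + Re c \<noteq> 0" using c(2) by linarith
    have t1: "t * (1 + Re c) = - Im c" using ne by (simp add: t_def)
    have "t * Im c * (1 + Re c) = (Re c - 1) * (1 + Re c)"
      using t1 sq by algebra
    then have t2: "t * Im c = Re c - 1" using ne by simp
    have [measurable]: "S \<in> borel_measurable borel" "T \<in> borel_measurable borel"
      unfolding S_def T_def by measurable
    have "c * z = S (T (S z))" for z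
    proof (rule complex_eqI)
      show "Im (c * z) = Im (S (T (S z)))"
        using t2 by (simp add: S_def T_def) algebra
      show "Re (c * z) = Re (S (T (S z)))"
        using t1 t2 by (simp add: S_def T_def) algebra
    qed
    then have "(\<integral>\<^sup>+z. f (c * z) \<partial>lborel) = (\<integral>\<^sup>+z. f (S (T (S z))) \<partial>lborel)" by simp
    also have "\<dots> = (\<integral>\<^sup>+z. f (S (T z)) \<partial>lborel)"
      using nn_integral_lborel_shear(1)[of "\<lambda>z. f (S (T z))" t] by (simp add: S_def)
    also have "\<dots> = (\<integral>\<^sup>+z. f (S z) \<partial>lborel)"
      using nn_integral_lborel_shear(2)[of "\<lambda>z. f (S z)" "Im c"] by (simp add: T_def)
    also have "\<dots> = (\<integral>\<^sup>+z. f z \<partial>lborel)"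
      using nn_integral_lborel_shear(1)[of f t] by (simp add: S_def)
    finally show ?thesis .
  qed
  show ?thesis
  proof (cases "Re c = - 1")
    case True
    then have "(Im c)\<^sup>2 = 0" using c cmod_power2[of c] by simp
    then have c1: "c = \<i> * \<i>" using True by (simp add: complex_eq_iff)
    have "(\<integral>\<^sup>+z. f (c * z) \<partial>lborel) = (\<integral>\<^sup>+z. f (\<i> * (\<i> * z)) \<partial>lborel)"
      unfolding c1 by (simp only: mult.assoc)
    also have "\<dots> = (\<integral>\<^sup>+z. f (\<i> * z) \<partial>lborel)"
      by (rule main[of \<i> "\<lambda>z. f (\<i> * z)"]) auto
    also have "\<dots> = (\<integral>\<^sup>+z. f z \<partial>lborel)" by (rule main) auto
    finally show ?thesis .
  qed (use main c f in blast)
qed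

section \<open>The weighted measure on the disc and its moments\<close>

definition disc_density :: "nat \<Rightarrow> complex \<Rightarrow> real" where
  "disc_density m z = indicator (ball 0 1) z * ((real m - 1) / pi * (1 - (norm z)\<^sup>2) ^ (m - 2))"

definition disc_measure :: "nat \<Rightarrow> complex measure" where
  "disc_measure m = density lborel (\<lambda>z. ennreal (disc_density m z))"

lemma disc_density_measurable [measurable]: "disc_density m \<in> borel_measurable borel"
  unfolding disc_density_def[abs_def]
  by (intro borel_measurable_times borel_measurable_indicator)
    (auto intro!: borel_measurable_continuous_onI continuous_intros)

lemma sets_disc_measure [measurable_cong, simp]: "sets (disc_measure m) = sets borel"
  by (simp add: disc_measure_def)

lemma nn_integral_disc_measure:
  assumes [measurable]: "f \<in> borel_measurable borel"
  shows "(\<integral>\<^sup>+z. f z \<partial>disc_measure m) = (\<integral>\<^sup>+z. ennreal (disc_density m z) * f z \<partial>lborel)"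
  unfolding disc_measure_def by (rule nn_integral_density) auto

lemma AE_disc_measure: "AE z in disc_measure m. norm z < 1"
  unfolding disc_measure_def
  by (subst AE_density) (auto simp: disc_density_def indicator_def)

lemma nn_integral_disc_rotate:
  assumes [measurable]: "f \<in> borel_measurable borel" and c: "norm c = 1"
  shows "(\<integral>\<^sup>+z. f (c * z) \<partial>disc_measure m) = (\<integral>\<^sup>+z. f z \<partial>disc_measure m)"
proof -
  have "disc_density m (c * z) = disc_density m z" for z
    using c by (simp add: disc_density_def norm_mult indicator_def)
  then show ?thesis
    using nn_integral_lborel_rotate[of "\<lambda>z. ennreal (disc_density m z) * f z" c] c
    by (simp add: nn_integral_disc_measure)
qed

text \<open>Rotation invariance allows averaging over all rotations, and Fubini exchanges the
  integrals. This takes the place of polar coordinates: afterwards only circle means have to be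
  computed.\<close>

lemma nn_integral_disc_circle:
  fixes f :: "complex \<Rightarrow> ennreal"
  assumes [measurable]: "f \<in> borel_measurable borel"
  assumes fin: "sigma_finite_measure (disc_measure m)"
  shows "(\<integral>\<^sup>+z. f z \<partial>disc_measure m) = (\<integral>\<^sup>+z. \<integral>\<^sup>+\<zeta>. f (\<zeta> * z) \<partial>circle \<partial>disc_measure m)"
proof -
  interpret C: prob_space circle by (rule prob_space_circle)
  interpret D: sigma_finite_measure "disc_measure m" by (rule fin)
  interpret pair_sigma_finite circle "disc_measure m" ..
  have "(\<integral>\<^sup>+z. f z \<partial>disc_measure m) = (\<integral>\<^sup>+\<zeta>. \<integral>\<^sup>+z. f z \<partial>disc_measure m \<partial>circle)"
    by (simp add: C.emeasure_space_1[simplified])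
  also have "\<dots> = (\<integral>\<^sup>+\<zeta>. \<integral>\<^sup>+z. f (\<zeta> * z) \<partial>disc_measure m \<partial>circle)"
  proof (rule nn_integral_cong_AE)
    show "AE \<zeta> in circle. (\<integral>\<^sup>+z. f z \<partial>disc_measure m) = (\<integral>\<^sup>+z. f (\<zeta> * z) \<partial>disc_measure m)"
      using AE_circle by eventually_elim (simp add: nn_integral_disc_rotate)
  qed
  also have "\<dots> = (\<integral>\<^sup>+z. \<integral>\<^sup>+\<zeta>. f (\<zeta> * z) \<partial>circle \<partial>disc_measure m)"
    by (rule Fubini'[symmetric]) measurable
  finally show ?thesis .
qed

text \<open>Under normalised area on the disc, \<open>(norm z)\<^sup>2\<close> is uniformly
  distributed on \<open>[0, 1]\<close>, because the disc of radius \<open>sqrt x\<close> has area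
  \<open>pi * x\<close>. Equality of the distribution functions gives equality of the
  measures.\<close>

lemma nn_integral_unit_disc_radial:
  fixes h :: "real \<Rightarrow> ennreal"
  assumes [measurable]: "h \<in> borel_measurable borel"
  shows "(\<integral>\<^sup>+z. ennreal (indicator (ball (0::complex) 1) z) * h ((norm z)\<^sup>2) \<partial>lborel)
     = ennreal pi * (\<integral>\<^sup>+t. indicator {0..1} t * h t \<partial>lborel)"
proof -
  define U where "U = uniform_measure lborel (ball (0::complex) 1)"
  define V where "V = uniform_measure lborel {0..1::real}"
  define q where "q = (\<lambda>z::complex. (norm z)\<^sup>2)"
  have [measurable]: "q \<in> borel_measurable borel" unfolding q_def by measurable
  have vol: "emeasure lborel (ball (0::complex) r) = ennreal (pi * r\<^sup>2)" if "0 \<le> r" for r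
    using emeasure_ball[OF that, of "0::complex"] by (simp add: unit_ball_vol_numeral power2_eq_square unit_ball_vol_2)
  have volc: "emeasure lborel (cball (0::complex) r) = ennreal (pi * r\<^sup>2)" if "0 \<le> r" for r
    using emeasure_cball[OF that, of "0::complex"] by (simp add: power2_eq_square unit_ball_vol_2)
  have v1: "emeasure lborel (ball (0::complex) 1) = ennreal pi" using vol[of 1] by simp
  interpret U: prob_space U unfolding U_def by (rule prob_space_uniform_measure) (auto simp: v1)
  interpret V: prob_space V unfolding V_def by (rule prob_space_uniform_measure) auto
  interpret D: prob_space "distr U borel q"
    by (rule U.prob_space_distr) (simp add: U_def)
  have rD: "real_distribution (distr U borel q)" "real_distribution V"
    by unfold_locales (auto simp: V_def)
  have "distr U borel q = V"
  proof (rule cdf_unique[OF rD], rule ext)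
    fix x :: real
    show "cdf (distr U borel q) x = cdf V x"
    proof (cases "x < 0")
      case True
      have "emeasure (distr U borel q) {..x} = 0"
      proof -
        have "q -` {..x} = {}" using True by (auto simp: q_def) (smt (verit) zero_le_power2)
        then show ?thesis by (subst emeasure_distr) (auto simp: U_def)
      qed
      moreover have "emeasure V {..x} = 0"
      proof -
        have "{0..1} \<inter> {..x} = {}" using True by auto
        then show ?thesis unfolding V_def by (subst emeasure_uniform_measure) auto
      qed
      ultimately show ?thesis by (simp add: cdf_def measure_def)
    next
      case x0: False
      define y where "y = min x 1"
      have "ball 0 1 \<inter> q -` {..x} = (if x < 1 then cball 0 (sqrt x) else ball 0 1)"
      proof (cases "x < 1")
        case True
        have iff: "q z \<le> x \<longleftrightarrow> norm z \<le> sqrt x" for z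
          using x0 real_sqrt_le_iff[of "(norm z)\<^sup>2" x] by (simp add: q_def)
        have "sqrt x < 1" using True by simp
        then have "ball 0 1 \<inter> q -` {..x} = cball 0 (sqrt x)"
          using le_less_trans[OF _ \<open>sqrt x < 1\<close>] by (auto simp: iff)
        then show ?thesis using True by simp
      next
        case False
        have "q z \<le> x" if "norm z < 1" for z
          using False that power_le_one[of "norm z" 2] by (simp add: q_def)
        then show ?thesis using False by auto
      qed
      then have "emeasure lborel (ball 0 1 \<inter> q -` {..x}) = ennreal (pi * y)"
        using x0 volc[of "sqrt x"] v1 by (auto simp: y_def min_def)
      then have "emeasure (distr U borel q) {..x} = ennreal (pi * y) / ennreal pi"
        unfolding U_def by (subst emeasure_distr, simp, simp, subst emeasure_uniform_measure)
          (auto simp: v1 measurable_sets_borel[of q borel])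
      also have "\<dots> = ennreal y" using x0 by (subst divide_ennreal) (auto simp: y_def)
      finally have 1: "emeasure (distr U borel q) {..x} = ennreal y" .
      have "{0..1} \<inter> {..x} = {0..y}" by (auto simp: y_def)
      then have "emeasure V {..x} = ennreal y"
        unfolding V_def using x0 by (subst emeasure_uniform_measure) (auto simp: y_def divide_ennreal_def)
      with 1 show ?thesis by (simp add: cdf_def measure_def)
    qed
  qed
  moreover have "(\<integral>\<^sup>+t. h t \<partial>distr U borel q) = (\<integral>\<^sup>+z. h (q z) \<partial>U)"
    by (rule nn_integral_distr) (auto simp: U_def)
  ultimately have "(\<integral>\<^sup>+z. h (q z) \<partial>U) = (\<integral>\<^sup>+t. h t \<partial>V)" by simp
  moreover have "(\<integral>\<^sup>+z. h (q z) \<partial>U) = (\<integral>\<^sup>+z. h (q z) * indicator (ball 0 1) z \<partial>lborel) / ennreal pi"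
    unfolding U_def by (subst nn_integral_uniform_measure) (auto simp: v1)
  moreover have "(\<integral>\<^sup>+t. h t \<partial>V) = (\<integral>\<^sup>+t. h t * indicator {0..1} t \<partial>lborel)"
    unfolding V_def by (subst nn_integral_uniform_measure) (auto simp: divide_ennreal_def)
  ultimately have "(\<integral>\<^sup>+z. h (q z) * indicator (ball 0 1) z \<partial>lborel) / ennreal pi = (\<integral>\<^sup>+t. h t * indicator {0..1} t \<partial>lborel)"
    by simp
  then have "ennreal pi * (\<integral>\<^sup>+t. h t * indicator {0..1} t \<partial>lborel) = (\<integral>\<^sup>+z. h (q z) * indicator (ball 0 1) z \<partial>lborel)"
    by (metis ennreal_times_divide ennreal_mult_divide_eq ennreal_neq_top ennreal_eq_0_iff mult.commute not_le pi_gt_zero)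
  then show ?thesis by (simp add: q_def mult.commute ennreal_indicator)
qed

text \<open>A Beta integral. The induction step integrates the derivative of
  \<open>t ^ Suc k * (1 - t) ^ Suc j\<close>, which vanishes at both ends.\<close>

lemma integral_power_mult_power:
  "((\<lambda>t::real. t ^ k * (1 - t) ^ j) has_integral fact k * fact j / fact (k + j + 1)) {0..1}"
proof (induction j arbitrary: k)
  case 0
  have "((\<lambda>t. t ^ Suc k / real (Suc k)) has_real_derivative t ^ k) (at t within A)" for t :: real and A
    using DERIV_cdivide[OF DERIV_pow[of "Suc k" t A], of "real (Suc k)"] by (simp del: of_nat_Suc)
  then have "((\<lambda>t::real. t ^ k) has_integral (1 ^ Suc k / real (Suc k) - 0 ^ Suc k / real (Suc k))) {0..1}"
    by (intro fundamental_theorem_of_calculus; simp add: has_real_derivative_iff_has_vector_derivative[symmetric])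
  moreover have "(1::real) ^ Suc k / real (Suc k) - 0 ^ Suc k / real (Suc k) = fact k * fact 0 / fact (k + 0 + 1)"
    by (simp del: of_nat_Suc)
  ultimately show ?case by (simp only: power_0 mult_1_right)
next
  case (Suc j)
  have d: "((\<lambda>t::real. t ^ Suc k * (1 - t) ^ Suc j) has_real_derivative
      real (Suc k) * (t ^ k * (1 - t) ^ Suc j) - real (Suc j) * (t ^ Suc k * (1 - t) ^ j)) (at t within A)" for t A
    by (auto intro!: derivative_eq_intros simp del: of_nat_Suc power_Suc)
  have "((\<lambda>t::real. real (Suc k) * (t ^ k * (1 - t) ^ Suc j) - real (Suc j) * (t ^ Suc k * (1 - t) ^ j))
     has_integral (1 ^ Suc k * (1 - 1) ^ Suc j - 0 ^ Suc k * (1 - 0) ^ Suc j)) {0..1}"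
    by (intro fundamental_theorem_of_calculus)
       (auto simp: has_real_derivative_iff_has_vector_derivative[symmetric] intro!: d simp del: of_nat_Suc power_Suc)
  then have "((\<lambda>t::real. real (Suc k) * (t ^ k * (1 - t) ^ Suc j) - real (Suc j) * (t ^ Suc k * (1 - t) ^ j))
     has_integral 0) {0..1}" by simp
  from has_integral_add[OF this has_integral_mult_right[OF Suc.IH[of "Suc k"], of "real (Suc j)"]]
  have "((\<lambda>t::real. real (Suc k) * (t ^ k * (1 - t) ^ Suc j)) has_integral
      real (Suc j) * (fact (Suc k) * fact j / fact (Suc k + j + 1))) {0..1}" by simp
  from has_integral_mult_right[OF this, of "1 / real (Suc k)"]
  have "((\<lambda>t::real. t ^ k * (1 - t) ^ Suc j) has_integral
      1 / real (Suc k) * (real (Suc j) * (fact (Suc k) * fact j / fact (Suc k + j + 1)))) {0..1}"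
    by (simp del: of_nat_Suc power_Suc fact_Suc)
  also have "1 / real (Suc k) * (real (Suc j) * (fact (Suc k) * fact j / fact (Suc k + j + 1)))
     = fact k * fact (Suc j) / (fact (k + Suc j + 1) :: real)"
    by (simp add: fact_Suc[of k] fact_Suc[of j] field_simps del: of_nat_Suc fact_Suc)
  finally show ?case .
qed

text \<open>The reciprocals of the moments are the coefficients of
  \<open>(1 - x)\<^sup>-\<^sup>m\<close>; this match is what makes the constant in Carleman's
  inequality equal to \<open>1\<close>. The case \<open>k = 0\<close> is the normalisation.\<close>

lemma nn_integral_disc_moment:
  assumes m: "2 \<le> m"
  shows "(\<integral>\<^sup>+z. ennreal ((norm z) ^ (2 * k)) \<partial>disc_measure m) = ennreal (1 / real ((k + m - 1) choose k))"
proof -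
  obtain j where j: "m = j + 2" using m by (metis add.commute le_Suc_ex)
  define h where "h t = ennreal (indicator {0..1} t * ((real m - 1) / pi * (1 - t) ^ j * t ^ k))" for t :: real
  have [measurable]: "h \<in> borel_measurable borel" unfolding h_def by measurable
  have "(\<integral>\<^sup>+z. ennreal ((norm z) ^ (2 * k)) \<partial>disc_measure m)
      = (\<integral>\<^sup>+z. ennreal (disc_density m z) * ennreal ((norm z) ^ (2 * k)) \<partial>lborel)"
    by (rule nn_integral_disc_measure) measurable
  also have "\<dots> = (\<integral>\<^sup>+z. ennreal (indicator (ball (0::complex) 1) z) * h ((norm z)\<^sup>2) \<partial>lborel)"
  proof (rule nn_integral_cong)
    fix z :: complex
    show "ennreal (disc_density m z) * ennreal ((norm z) ^ (2 * k)) = ennreal (indicator (ball 0 1) z) * h ((norm z)\<^sup>2)"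
      using m power_le_one[of "norm z" 2]
      by (auto simp: disc_density_def h_def indicator_def j power_mult simp flip: ennreal_mult')
  qed
  also have "\<dots> = ennreal pi * (\<integral>\<^sup>+t. indicator {0..1} t * h t \<partial>lborel)"
    by (rule nn_integral_unit_disc_radial) measurable
  also have "(\<integral>\<^sup>+t. indicator {0..1} t * h t \<partial>lborel) = (\<integral>\<^sup>+t. h t \<partial>lborel)"
    by (intro nn_integral_cong) (auto simp: h_def indicator_def)
  also have "(\<integral>\<^sup>+t. h t \<partial>lborel) = ennreal ((real m - 1) / pi * (fact k * fact j / fact (k + j + 1)))"
    unfolding h_def
  proof (rule nn_integral_has_integral_lborel)
    show "((\<lambda>t. indicator {0..1} t * ((real m - 1) / pi * (1 - t) ^ j * t ^ k)) has_integral
       (real m - 1) / pi * (fact k * fact j / fact (k + j + 1))) UNIV"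
    proof -
      have "((\<lambda>t. (real m - 1) / pi * (t ^ k * (1 - t) ^ j)) has_integral
         (real m - 1) / pi * (fact k * fact j / fact (k + j + 1))) {0..1}"
        by (intro has_integral_mult_right integral_power_mult_power)
      then have "((\<lambda>t. if t \<in> {0..1} then (real m - 1) / pi * (t ^ k * (1 - t) ^ j) else 0) has_integral
         (real m - 1) / pi * (fact k * fact j / fact (k + j + 1))) UNIV"
        by (simp only: has_integral_restrict_UNIV)
      then show ?thesis by (rule has_integral_eq[rotated]) (auto simp: indicator_def)
    qed
  qed (use m in \<open>auto simp: indicator_def\<close>)
  also have "ennreal pi * \<dots> = ennreal (pi * ((real m - 1) / pi * (fact k * fact j / fact (k + j + 1))))"
    using m by (simp flip: ennreal_mult')
  also have "pi * ((real m - 1) / pi * (fact k * fact j / fact (k + j + 1))) = 1 / real ((k + m - 1) choose k)"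
  proof -
    have "real ((k + m - 1) choose k) = fact (k + j + 1) / (fact k * fact (j + 1))"
      using binomial_fact[of k "k + m - 1", where ?'a = real] by (simp add: j)
    moreover have "(real m - 1) * fact j = fact (j + 1)" by (simp add: j)
    moreover have "pi * ((real m - 1) / pi * (fact k * fact j / fact (k + j + 1)))
       = fact k * ((real m - 1) * fact j) / fact (k + j + 1)" by simp
    ultimately show ?thesis by (simp only:) simp
  qed
  finally show ?thesis .
qed

lemma prob_space_disc_measure:
  assumes "2 \<le> m" shows "prob_space (disc_measure m)"
  by (rule prob_spaceI) (use nn_integral_disc_moment[OF assms, of 0] in simp)

lemma circle_parseval:
  "(\<integral>\<zeta>. (norm (poly q (\<zeta> * z)))\<^sup>2 \<partial>circle) = (\<Sum>k\<le>degree q. (norm (coeff q k))\<^sup>2 * norm z ^ (2 * k))"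
proof -
  let ?d = "degree q"
  define b where "b k = coeff q k * z ^ k" for k
  have mean: "(\<integral>\<zeta>. \<zeta> ^ i * cnj \<zeta> ^ j \<partial>circle) = (if i = j then 1 else 0)" for i j
  proof -
    have pw: "\<zeta> ^ i * cnj \<zeta> ^ j = \<zeta> ^ (i - j)" if "norm \<zeta> = 1" "j \<le> i" for \<zeta> i j
    proof -
      have "\<zeta> * cnj \<zeta> = 1" using that by (simp add: complex_norm_square[symmetric])
      then have "\<zeta> ^ j * cnj \<zeta> ^ j = 1" by (simp flip: power_mult_distrib)
      moreover have "\<zeta> ^ i = \<zeta> ^ (i - j) * \<zeta> ^ j" using \<open>j \<le> i\<close> by (simp flip: power_add)
      ultimately show ?thesis by (simp add: mult.assoc)
    qed
    have le: "(\<integral>\<zeta>. \<zeta> ^ i * cnj \<zeta> ^ j \<partial>circle) = (if i = j then 1 else 0)" if "j \<le> i" for i j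
    proof -
      have "(\<integral>\<zeta>. \<zeta> ^ i * cnj \<zeta> ^ j \<partial>circle) = (\<integral>\<zeta>. \<zeta> ^ (i - j) \<partial>circle)"
      proof (rule integral_cong_AE)
        show "AE \<zeta> in circle. \<zeta> ^ i * cnj \<zeta> ^ j = \<zeta> ^ (i - j)"
          using AE_circle by eventually_elim (rule pw[OF _ that])
      qed (auto intro!: borel_measurable_integrable integrable_circle continuous_intros)
      then show ?thesis using that by (simp add: circle_mean_power)
    qed
    show ?thesis
    proof (cases "j \<le> i")
      case False
      have "(\<integral>\<zeta>. \<zeta> ^ i * cnj \<zeta> ^ j \<partial>circle) = (\<integral>\<zeta>. cnj (\<zeta> ^ j * cnj \<zeta> ^ i) \<partial>circle)"
        by (simp add: mult.commute)
      also have "\<dots> = cnj (\<integral>\<zeta>. \<zeta> ^ j * cnj \<zeta> ^ i \<partial>circle)" by (rule Bochner_Integration.integral_cnj)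
      finally show ?thesis using le[of i j] False by simp
    qed (rule le)
  qed
  have "complex_of_real (\<integral>\<zeta>. (norm (poly q (\<zeta> * z)))\<^sup>2 \<partial>circle) = (\<integral>\<zeta>. complex_of_real ((norm (poly q (\<zeta> * z)))\<^sup>2) \<partial>circle)"
    by (rule integral_complex_of_real[symmetric])
  also have "\<dots> = (\<integral>\<zeta>. (\<Sum>i\<le>?d. \<Sum>j\<le>?d. b i * cnj (b j) * (\<zeta> ^ i * cnj \<zeta> ^ j)) \<partial>circle)"
    by (intro Bochner_Integration.integral_cong refl)
      (simp add: complex_norm_square poly_altdef sum_product b_def power_mult_distrib mult_ac flip: of_real_power)
  also have "\<dots> = (\<Sum>i\<le>?d. \<Sum>j\<le>?d. b i * cnj (b j) * (\<integral>\<zeta>. \<zeta> ^ i * cnj \<zeta> ^ j \<partial>circle))"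
    by (subst Bochner_Integration.integral_sum, intro integrable_circle continuous_intros)+
      (simp add: integrable_circle continuous_intros)
  also have "\<dots> = (\<Sum>i\<le>?d. b i * cnj (b i))"
    by (simp add: mean if_distrib[of "times _"] cong: if_cong)
  also have "\<dots> = of_real (\<Sum>k\<le>?d. (norm (coeff q k))\<^sup>2 * norm z ^ (2 * k))"
  proof -
    have "(norm (b k))\<^sup>2 = (norm (coeff q k))\<^sup>2 * norm z ^ (2 * k)" for k
      by (simp add: b_def norm_mult norm_power power_mult_distrib power_mult[symmetric] mult.commute)
    then show ?thesis by (simp only: complex_norm_square[symmetric] of_real_sum)
  qed
  finally show ?thesis by (simp only: of_real_eq_iff)
qed

lemma nn_integral_circle_eq_integral:
  fixes v :: "complex \<Rightarrow> real"
  assumes "continuous_on UNIV v" "\<And>z. norm z = 1 \<Longrightarrow> 0 \<le> v z"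
  shows "(\<integral>\<^sup>+z. ennreal (v z) \<partial>circle) = ennreal (\<integral>z. v z \<partial>circle)"
proof (rule nn_integral_eq_integral)
  show "AE z in circle. 0 \<le> v z" using AE_circle by eventually_elim (rule assms(2))
qed (rule integrable_circle[OF assms(1)])

lemma nn_integral_disc_norm_poly_sq:
  assumes m: "2 \<le> m"
  shows "(\<integral>\<^sup>+z. ennreal ((norm (poly q z))\<^sup>2) \<partial>disc_measure m)
    = ennreal (\<Sum>k\<le>degree q. (norm (coeff q k))\<^sup>2 / real ((k + m - 1) choose k))"
proof -
  have [measurable]: "poly q \<in> borel_measurable borel"
    by (intro borel_measurable_continuous_onI continuous_intros)
  interpret prob_space "disc_measure m" by (rule prob_space_disc_measure[OF m])
  have "(\<integral>\<^sup>+z. ennreal ((norm (poly q z))\<^sup>2) \<partial>disc_measure m)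
     = (\<integral>\<^sup>+z. \<integral>\<^sup>+\<zeta>. ennreal ((norm (poly q (\<zeta> * z)))\<^sup>2) \<partial>circle \<partial>disc_measure m)"
    by (rule nn_integral_disc_circle) (measurable, unfold_locales)
  also have "\<dots> = (\<integral>\<^sup>+z. ennreal (\<Sum>k\<le>degree q. (norm (coeff q k))\<^sup>2 * norm z ^ (2 * k)) \<partial>disc_measure m)"
    by (intro nn_integral_cong, subst nn_integral_circle_eq_integral)
      (auto intro!: continuous_intros simp: circle_parseval)
  also have "\<dots> = (\<Sum>k\<le>degree q. \<integral>\<^sup>+z. ennreal ((norm (coeff q k))\<^sup>2) * ennreal (norm z ^ (2 * k)) \<partial>disc_measure m)"
    by (subst nn_integral_sum[symmetric]) (auto simp: sum_nonneg ennreal_mult' simp flip: sum_ennreal)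
  also have "\<dots> = (\<Sum>k\<le>degree q. ennreal ((norm (coeff q k))\<^sup>2 / real ((k + m - 1) choose k)))"
    by (intro sum.cong refl, subst nn_integral_cmult)
      (auto simp: nn_integral_disc_moment[OF m] simp flip: ennreal_mult')
  also have "\<dots> = ennreal (\<Sum>k\<le>degree q. (norm (coeff q k))\<^sup>2 / real ((k + m - 1) choose k))"
    by (rule sum_ennreal) auto
  finally show ?thesis .
qed

section \<open>Carleman's inequality for polynomials and for exponentials of polynomials\<close>

lemma weighted_cauchy_schwarz:
  fixes a w :: "'i \<Rightarrow> real"
  assumes "\<And>i. i \<in> A \<Longrightarrow> 0 < w i"
  shows "(\<Sum>i\<in>A. a i)\<^sup>2 \<le> (\<Sum>i\<in>A. w i) * (\<Sum>i\<in>A. (a i)\<^sup>2 / w i)"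
proof -
  have "(\<Sum>i\<in>A. a i)\<^sup>2 = (\<Sum>i\<in>A. sqrt (w i) * (a i / sqrt (w i)))\<^sup>2"
    using assms by (intro arg_cong[where f = "\<lambda>x. x\<^sup>2"] sum.cong) (auto simp: less_le)
  also have "\<dots> \<le> (\<Sum>i\<in>A. (sqrt (w i))\<^sup>2) * (\<Sum>i\<in>A. (a i / sqrt (w i))\<^sup>2)"
    by (rule Cauchy_Schwarz_ineq_sum)
  also have "\<dots> = (\<Sum>i\<in>A. w i) * (\<Sum>i\<in>A. (a i)\<^sup>2 / w i)"
    using assms by (intro arg_cong2[where f = "times"] sum.cong) (auto simp: power_divide less_imp_le)
  finally show ?thesis .
qed

text \<open>By Parseval its value at \<open>1\<close> is the circle mean of
  \<open>(norm (poly q z))\<^sup>2\<close>; evaluating its \<open>m\<close>-th power at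
  \<open>1\<close> gives the right side of \<open>carleman_poly\<close>.\<close>

definition sq_coeffs :: "complex poly \<Rightarrow> real poly" where
  "sq_coeffs q = (\<Sum>k\<le>degree q. monom ((norm (coeff q k))\<^sup>2) k)"

lemma coeff_sq_coeffs: "coeff (sq_coeffs q) k = (norm (coeff q k))\<^sup>2"
  by (auto simp: sq_coeffs_def coeff_sum if_distrib coeff_eq_0 cong: if_cong)

text \<open>The weights are the coefficients of \<open>(1 - x)\<^sup>-\<^sup>m\<close>; they add up along the induction by the hockey-stick
  identity.\<close>

lemma coeff_power_norm_sq_le:
  "(norm (coeff (q ^ Suc m) k))\<^sup>2 \<le> real ((k + m) choose k) * coeff (sq_coeffs q ^ Suc m) k"
proof (induction m arbitrary: k)
  case 0
  then show ?case by (simp add: coeff_sq_coeffs)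
next
  case (Suc m)
  have "norm (coeff (q ^ Suc (Suc m)) k) \<le> (\<Sum>i\<le>k. norm (coeff q (k - i)) * norm (coeff (q ^ Suc m) i))"
  proof -
    have "coeff (q ^ Suc (Suc m)) k = (\<Sum>i\<le>k. coeff (q ^ Suc m) i * coeff q (k - i))"
      by (subst power_Suc2) (rule coeff_mult)
    then show ?thesis by (simp add: norm_mult mult.commute sum_norm_le)
  qed
  then have "(norm (coeff (q ^ Suc (Suc m)) k))\<^sup>2 \<le> (\<Sum>i\<le>k. norm (coeff q (k - i)) * norm (coeff (q ^ Suc m) i))\<^sup>2"
    by (intro power_mono) auto
  also have "\<dots> \<le> (\<Sum>i\<le>k. real ((i + m) choose i)) *
      (\<Sum>i\<le>k. (norm (coeff q (k - i)) * norm (coeff (q ^ Suc m) i))\<^sup>2 / real ((i + m) choose i))"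
    by (rule weighted_cauchy_schwarz) simp
  also have "(\<Sum>i\<le>k. real ((i + m) choose i)) = real ((k + Suc m) choose k)"
    using sum_choose_lower[of m k] by (simp add: add.commute flip: of_nat_sum)
  also have "(\<Sum>i\<le>k. (norm (coeff q (k - i)) * norm (coeff (q ^ Suc m) i))\<^sup>2 / real ((i + m) choose i))
     \<le> (\<Sum>i\<le>k. coeff (sq_coeffs q ^ Suc m) i * coeff (sq_coeffs q) (k - i))"
  proof (rule sum_mono)
    fix i assume "i \<in> {..k}"
    have "(norm (coeff (q ^ Suc m) i))\<^sup>2 / real ((i + m) choose i) \<le> coeff (sq_coeffs q ^ Suc m) i"
      using Suc.IH[of i] by (subst pos_divide_le_eq) (auto simp: mult.commute)
    from mult_right_mono[OF this, of "(norm (coeff q (k - i)))\<^sup>2"]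
    show "(norm (coeff q (k - i)) * norm (coeff (q ^ Suc m) i))\<^sup>2 / real ((i + m) choose i)
       \<le> coeff (sq_coeffs q ^ Suc m) i * coeff (sq_coeffs q) (k - i)"
      by (simp add: coeff_sq_coeffs power_mult_distrib mult.commute del: power_Suc)
  qed
  also have "\<dots> = coeff (sq_coeffs q ^ Suc (Suc m)) k"
    by (subst power_Suc2[of _ "Suc m"]) (rule coeff_mult[symmetric])
  finally show ?case by (simp add: mult_left_mono del: power_Suc)
qed

text \<open>The disc integral of \<open>(norm (q ^ m))\<^sup>2\<close> is a sum of squared
  coefficients divided by binomials, and these binomials cancel against those of
  \<open>coeff_power_norm_sq_le\<close>. What remains is at most the coefficient sum of
  \<open>sq_coeffs q ^ m\<close>, its value at \<open>1\<close>.\<close>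

lemma carleman_poly:
  assumes m: "2 \<le> m"
  shows "(\<integral>\<^sup>+z. ennreal (norm (poly q z) ^ (2 * m)) \<partial>disc_measure m)
    \<le> ennreal ((\<integral>z. (norm (poly q z))\<^sup>2 \<partial>circle) ^ m)"
proof -
  obtain j where j: "m = Suc j" using m by (cases m) auto
  have "(\<integral>\<^sup>+z. ennreal (norm (poly q z) ^ (2 * m)) \<partial>disc_measure m)
     = (\<integral>\<^sup>+z. ennreal ((norm (poly (q ^ m) z))\<^sup>2) \<partial>disc_measure m)"
    by (simp add: norm_power power_mult[symmetric] mult.commute)
  also have "\<dots> = ennreal (\<Sum>k\<le>degree (q ^ m). (norm (coeff (q ^ m) k))\<^sup>2 / real ((k + m - 1) choose k))"
    by (rule nn_integral_disc_norm_poly_sq[OF m])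
  also have "\<dots> \<le> ennreal ((\<integral>z. (norm (poly q z))\<^sup>2 \<partial>circle) ^ m)"
  proof (rule ennreal_leI)
    have "(\<Sum>k\<le>degree (q ^ m). (norm (coeff (q ^ m) k))\<^sup>2 / real ((k + m - 1) choose k))
       \<le> (\<Sum>k\<le>degree (q ^ m). coeff (sq_coeffs q ^ m) k)"
      using coeff_power_norm_sq_le[of q j] unfolding j
      by (intro sum_mono) (subst pos_divide_le_eq, auto simp: mult.commute simp del: power_Suc)
    also have "\<dots> \<le> poly (sq_coeffs q ^ m) 1"
    proof -
      have nn: "0 \<le> coeff (sq_coeffs q ^ m) k" for k
      proof (induction m arbitrary: k)
        case (Suc m)
        then show ?case by (auto simp: coeff_mult coeff_sq_coeffs intro!: sum_nonneg)
      qed simp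
      \<comment> \<open>The degrees of the two powers are not compared: nonnegative coefficients
        allow summation up to the larger one.\<close>
      have "(\<Sum>k\<le>degree (q ^ m). coeff (sq_coeffs q ^ m) k)
          \<le> (\<Sum>k\<le>max (degree (q ^ m)) (degree (sq_coeffs q ^ m)). coeff (sq_coeffs q ^ m) k)"
        by (intro sum_mono2) (auto simp: nn)
      also have "\<dots> = (\<Sum>k\<le>degree (sq_coeffs q ^ m). coeff (sq_coeffs q ^ m) k)"
        by (intro sum.mono_neutral_right) (auto simp: coeff_eq_0)
      finally show ?thesis by (simp add: poly_altdef)
    qed
    also have "\<dots> = (\<Sum>k\<le>degree q. (norm (coeff q k))\<^sup>2) ^ m"
      by (simp add: sq_coeffs_def poly_sum poly_monom)
    also have "(\<Sum>k\<le>degree q. (norm (coeff q k))\<^sup>2) = (\<integral>z. (norm (poly q z))\<^sup>2 \<partial>circle)"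
      using circle_parseval[of q 1] by simp
    finally show "(\<Sum>k\<le>degree (q ^ m). (norm (coeff (q ^ m) k))\<^sup>2 / real ((k + m - 1) choose k))
       \<le> (\<integral>z. (norm (poly q z))\<^sup>2 \<partial>circle) ^ m" .
  qed
  finally show ?thesis .
qed

lemma integrable_disc:
  fixes v :: "complex \<Rightarrow> 'b::euclidean_space"
  assumes m: "2 \<le> m" and v: "continuous_on UNIV v"
  shows "integrable (disc_measure m) v"
proof -
  interpret prob_space "disc_measure m" by (rule prob_space_disc_measure[OF m])
  have [measurable]: "v \<in> borel_measurable borel"
    using v by (rule borel_measurable_continuous_onI)
  have "compact (v ` cball 0 1)"
    by (intro compact_continuous_image continuous_on_subset[OF v]) auto
  then obtain B where B: "\<And>z. norm z \<le> 1 \<Longrightarrow> norm (v z) \<le> B"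
    by (force dest!: compact_imp_bounded simp: bounded_iff)
  have "AE z in disc_measure m. norm (v z) \<le> B"
    using AE_disc_measure by eventually_elim (auto intro: B)
  then show ?thesis by (rule integrable_const_bound) simp
qed

lemma disc_mean_mono:
  fixes v w :: "complex \<Rightarrow> real"
  assumes m: "2 \<le> m" and "continuous_on UNIV v" "continuous_on UNIV w"
    and "\<And>z. norm z < 1 \<Longrightarrow> v z \<le> w z"
  shows "(\<integral>z. v z \<partial>disc_measure m) \<le> (\<integral>z. w z \<partial>disc_measure m)"
proof (intro integral_mono_AE integrable_disc[OF m] assms(2,3))
  show "AE z in disc_measure m. v z \<le> w z"
    using AE_disc_measure by eventually_elim (rule assms(4))
qed

text \<open>The partial sums of the exponential series are polynomials in \<open>z\<close>, bounded
  by \<open>exp B\<close> on the closed disc, so dominated convergence passes to the limit on both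
  sides.\<close>

lemma carleman_exp_poly:
  assumes m: "2 \<le> m"
  shows "(\<integral>z. norm (exp (poly P z)) ^ (2 * m) \<partial>disc_measure m)
    \<le> (\<integral>z. (norm (exp (poly P z)))\<^sup>2 \<partial>circle) ^ m"
proof -
  interpret C: prob_space circle by (rule prob_space_circle)
  interpret D: prob_space "disc_measure m" by (rule prob_space_disc_measure[OF m])
  define q where "q k = (\<Sum>i<k. smult (1 / of_nat (fact i)) (P ^ i))" for k
  have qs: "poly (q k) z = (\<Sum>i<k. poly P z ^ i /\<^sub>R fact i)" for k z
    by (simp add: q_def poly_sum scaleR_conv_of_real divide_inverse)
  have lim: "(\<lambda>k. poly (q k) z) \<longlonglongrightarrow> exp (poly P z)" for z
    unfolding qs using exp_converges[of "poly P z"] by (simp add: sums_def)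
  have "compact (poly P ` cball 0 1)"
    by (intro compact_continuous_image continuous_intros) auto
  then obtain B where B: "\<And>z. norm z \<le> 1 \<Longrightarrow> norm (poly P z) \<le> B"
    by (force dest!: compact_imp_bounded simp: bounded_iff)
  have bound: "norm (poly (q k) z) \<le> exp B" if "norm z \<le> 1" for k z
  proof -
    have "norm (poly (q k) z) \<le> (\<Sum>i<k. norm (poly P z) ^ i /\<^sub>R fact i)"
      unfolding qs by (rule order_trans[OF norm_sum]) (simp add: norm_power norm_divide)
    also have "\<dots> \<le> exp (norm (poly P z))"
      using exp_converges[of "norm (poly P z)"]
        sum_le_suminf[of "\<lambda>n. norm (poly P z) ^ n /\<^sub>R fact n" "{..<k}"] by (simp add: sums_iff)
    also have "\<dots> \<le> exp B" using B[OF that] by simp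
    finally show ?thesis .
  qed
  have dc: "(\<lambda>k. \<integral>z. norm (poly (q k) z) ^ n \<partial>M) \<longlonglongrightarrow> (\<integral>z. norm (exp (poly P z)) ^ n \<partial>M)"
    if M: "finite_measure M" "sets M = sets borel" "AE z in M. norm z \<le> 1" for M n
  proof (rule integral_dominated_convergence[where w = "\<lambda>_. exp B ^ n"])
    interpret finite_measure M by (rule M)
    show "integrable M (\<lambda>_. exp B ^ n)" by simp
    show "AE z in M. (\<lambda>k. norm (poly (q k) z) ^ n) \<longlonglongrightarrow> norm (exp (poly P z)) ^ n"
      by (intro always_eventually allI tendsto_intros lim)
    show "AE z in M. norm (norm (poly (q k) z) ^ n) \<le> exp B ^ n" for k
      using M(3) by eventually_elim (auto intro!: power_mono bound)
  qed (auto simp: measurable_cong_sets[OF M(2) refl] intro!: borel_measurable_continuous_onI continuous_intros)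
  have "(\<lambda>k. \<integral>z. norm (poly (q k) z) ^ (2 * m) \<partial>disc_measure m) \<longlonglongrightarrow>
      (\<integral>z. norm (exp (poly P z)) ^ (2 * m) \<partial>disc_measure m)"
    using AE_disc_measure[of m] by (intro dc) (auto intro: D.finite_measure_axioms elim: eventually_mono)
  moreover have "(\<lambda>k. (\<integral>z. (norm (poly (q k) z))\<^sup>2 \<partial>circle) ^ m) \<longlonglongrightarrow>
      (\<integral>z. (norm (exp (poly P z)))\<^sup>2 \<partial>circle) ^ m"
    using AE_circle by (intro tendsto_intros dc) (auto intro: C.finite_measure_axioms elim: eventually_mono)
  ultimately show ?thesis
  proof (rule LIMSEQ_le, intro exI allI impI)
    fix k
    have "ennreal (\<integral>z. norm (poly (q k) z) ^ (2 * m) \<partial>disc_measure m)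
        \<le> ennreal ((\<integral>z. (norm (poly (q k) z))\<^sup>2 \<partial>circle) ^ m)"
      using carleman_poly[OF m, of "q k"]
      by (subst nn_integral_eq_integral[symmetric]) (auto intro!: integrable_disc[OF m] continuous_intros)
    then show "(\<integral>z. norm (poly (q k) z) ^ (2 * m) \<partial>disc_measure m) \<le> (\<integral>z. (norm (poly (q k) z))\<^sup>2 \<partial>circle) ^ m"
      by (subst (asm) ennreal_le_iff) (auto intro!: zero_le_power integral_nonneg_AE)
  qed
qed

section \<open>Inequalities of Riesz type on the disc\<close>

text \<open>The sub-mean inequality is integrated over all concentric circles. Adding the bound
  \<open>B\<close> makes the integrand nonnegative on the closed disc, so that extended nonnegative
  integrals can be used.\<close>

lemma submean_disc:
  fixes v :: "complex \<Rightarrow> real"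
  assumes m: "2 \<le> m" and v: "continuous_on UNIV v"
    and sub: "\<And>z. norm z < 1 \<Longrightarrow> v 0 \<le> (\<integral>\<zeta>. v (\<zeta> * z) \<partial>circle)"
  shows "v 0 \<le> (\<integral>z. v z \<partial>disc_measure m)"
proof -
  interpret C: prob_space circle by (rule prob_space_circle)
  interpret D: prob_space "disc_measure m" by (rule prob_space_disc_measure[OF m])
  have [measurable]: "v \<in> borel_measurable borel" using v by (rule borel_measurable_continuous_onI)
  have "compact (v ` cball 0 1)"
    by (intro compact_continuous_image continuous_on_subset[OF v]) auto
  then obtain B where "\<And>z. norm z \<le> 1 \<Longrightarrow> \<bar>v z\<bar> \<le> B"
    by (force dest!: compact_imp_bounded simp: bounded_iff)
  then have B: "0 \<le> v z + B" if "norm z \<le> 1" for z using that[THEN \<open>\<And>z. norm z \<le> 1 \<Longrightarrow> \<bar>v z\<bar> \<le> B\<close>] by linarith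
  have "ennreal (v 0 + B) = (\<integral>\<^sup>+z. ennreal (v 0 + B) \<partial>disc_measure m)"
    using D.emeasure_space_1 by simp
  also have "\<dots> \<le> (\<integral>\<^sup>+z. \<integral>\<^sup>+\<zeta>. ennreal (v (\<zeta> * z) + B) \<partial>circle \<partial>disc_measure m)"
  proof (rule nn_integral_mono_AE)
    show "AE z in disc_measure m. ennreal (v 0 + B) \<le> (\<integral>\<^sup>+\<zeta>. ennreal (v (\<zeta> * z) + B) \<partial>circle)"
      using AE_disc_measure
    proof eventually_elim
      fix z :: complex assume z: "norm z < 1"
      have c: "continuous_on UNIV (\<lambda>\<zeta>. v (\<zeta> * z))"
        by (intro continuous_on_compose2[OF v] continuous_intros) auto
      have "(\<integral>\<^sup>+\<zeta>. ennreal (v (\<zeta> * z) + B) \<partial>circle) = ennreal (\<integral>\<zeta>. v (\<zeta> * z) + B \<partial>circle)"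
        using z by (intro nn_integral_circle_eq_integral continuous_intros c B) (auto simp: norm_mult)
      also have "(\<integral>\<zeta>. v (\<zeta> * z) + B \<partial>circle) = (\<integral>\<zeta>. v (\<zeta> * z) \<partial>circle) + B"
        using C.prob_space by (subst Bochner_Integration.integral_add) (auto intro!: integrable_circle c)
      finally show "ennreal (v 0 + B) \<le> (\<integral>\<^sup>+\<zeta>. ennreal (v (\<zeta> * z) + B) \<partial>circle)"
        using sub[OF z] by (simp add: ennreal_leI)
    qed
  qed
  also have "\<dots> = (\<integral>\<^sup>+z. ennreal (v z + B) \<partial>disc_measure m)"
    by (rule nn_integral_disc_circle[symmetric]) (measurable, unfold_locales)
  also have "\<dots> = ennreal (\<integral>z. v z + B \<partial>disc_measure m)"
  proof (rule nn_integral_eq_integral)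
    show "AE z in disc_measure m. 0 \<le> v z + B"
      using AE_disc_measure by eventually_elim (auto intro: B)
  qed (intro integrable_disc[OF m] continuous_intros v)
  finally have le: "ennreal (v 0 + B) \<le> ennreal (\<integral>z. v z + B \<partial>disc_measure m)" .
  have "0 \<le> (\<integral>z. v z + B \<partial>disc_measure m)"
  proof (rule integral_nonneg_AE)
    show "AE z in disc_measure m. 0 \<le> v z + B"
      using AE_disc_measure by eventually_elim (auto intro: B)
  qed
  with le have "v 0 + B \<le> (\<integral>z. v z + B \<partial>disc_measure m)" by simp
  also have "(\<integral>z. v z + B \<partial>disc_measure m) = (\<integral>z. v z \<partial>disc_measure m) + B"
    using D.prob_space by (subst Bochner_Integration.integral_add) (auto intro!: integrable_disc[OF m] v)
  finally show ?thesis by simp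
qed

lemma disc_algebra_scale:
  assumes F: "disc_algebra F" and z: "norm z \<le> 1"
  shows "disc_algebra (\<lambda>\<zeta>. F (\<zeta> * z))"
proof -
  have hF: "F holomorphic_on ball 0 1" and cF: "continuous_on UNIV F"
    using F by (auto simp: disc_algebra_def)
  have "norm (\<zeta> * z) < 1" if "norm \<zeta> < 1" for \<zeta>
    using that z mult_left_mono[of "norm z" 1 "norm \<zeta>"] by (simp add: norm_mult)
  then have "(\<lambda>\<zeta>. \<zeta> * z) ` ball 0 1 \<subseteq> ball 0 1" by auto
  moreover have "(\<lambda>\<zeta>. \<zeta> * z) holomorphic_on ball 0 1" by (intro holomorphic_intros)
  ultimately have "(\<lambda>\<zeta>. F (\<zeta> * z)) holomorphic_on ball 0 1"
    using holomorphic_on_compose_gen[OF _ hF, of "\<lambda>\<zeta>. \<zeta> * z"] by (simp add: o_def)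
  moreover have "continuous_on UNIV (\<lambda>\<zeta>. F (\<zeta> * z))"
    by (intro continuous_on_compose2[OF cF] continuous_intros) auto
  ultimately show ?thesis by (simp add: disc_algebra_def)
qed

lemma disc_algebra_mult: "disc_algebra g \<Longrightarrow> disc_algebra h \<Longrightarrow> disc_algebra (\<lambda>z. g z * h z)"
  by (auto simp: disc_algebra_def intro!: holomorphic_intros continuous_intros)

lemma disc_algebra_uminus: "disc_algebra g \<Longrightarrow> disc_algebra (\<lambda>z. - g z)"
  by (auto simp: disc_algebra_def intro!: holomorphic_intros continuous_intros)

lemma disc_algebra_poly: "disc_algebra (poly P)"
  by (auto simp: disc_algebra_def intro!: holomorphic_intros continuous_intros)

lemma submean_phi_hi_disc:
  assumes m: "2 \<le> m" and s: "1 \<le> s" and F: "disc_algebra F"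
  shows "homog s (phi_hi s) (F 0) \<le> (\<integral>z. homog s (phi_hi s) (F z) \<partial>disc_measure m)"
proof (rule submean_disc[OF m])
  have "continuous_on UNIV (homog s (phi_hi s))"
    using s by (intro continuous_on_homog continuous_on_phi_hi) auto
  then show "continuous_on UNIV (\<lambda>z. homog s (phi_hi s) (F z))"
    using F continuous_on_compose2[of UNIV _ UNIV F] by (auto simp: disc_algebra_def)
  show "homog s (phi_hi s) (F 0) \<le> (\<integral>\<zeta>. homog s (phi_hi s) (F (\<zeta> * z)) \<partial>circle)" if "norm z < 1" for z
    using submean_phi_hi[OF s disc_algebra_scale[OF F, of z]] that by simp
qed

lemma le_of_le_limit_at_right_0:
  fixes A :: real and f :: "real \<Rightarrow> real"
  assumes "\<And>e. 0 < e \<Longrightarrow> A \<le> f e" "(f \<longlongrightarrow> L) (at_right 0)"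
  shows "A \<le> L"
  using assms(2) by (rule tendsto_lowerbound)
    (auto intro!: eventually_mono[OF eventually_at_right_less] assms(1))

lemma carleman_log_subharmonic:
  fixes v :: "complex \<Rightarrow> real"
  assumes m: "2 \<le> m" and v: "continuous_on UNIV v"
    and touch: "\<And>a. norm a < 1 \<Longrightarrow> touches_from_below v a"
  shows "(\<integral>z. exp (real m * v z) \<partial>disc_measure m) \<le> (\<integral>z. exp (v z) \<partial>circle) ^ m"
proof (rule le_of_le_limit_at_right_0)
  show "((\<lambda>e. exp (real m * e) * (\<integral>z. exp (v z) \<partial>circle) ^ m) \<longlongrightarrow> (\<integral>z. exp (v z) \<partial>circle) ^ m) (at_right 0)"
    by (rule tendsto_eq_intros refl | simp)+
  fix e :: real assume e: "0 < e"
  obtain P0 where P0: "\<And>z. norm z = 1 \<Longrightarrow> \<bar>v z - Re (poly P0 z)\<bar> < e / 2"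
    using Re_poly_approx_circle[of v "e / 2"] continuous_on_subset[OF v] e by auto
  define P where "P = P0 + [:of_real (e / 2):]"
  have P: "v z \<le> Re (poly P z)" "Re (poly P z) \<le> v z + e" if "norm z = 1" for z
  proof -
    have "v z - Re (poly P0 z) \<le> e / 2" "Re (poly P0 z) - v z \<le> e / 2" using P0[OF that] by linarith+
    then show "v z \<le> Re (poly P z)" "Re (poly P z) \<le> v z + e" by (simp_all add: P_def)
  qed
  \<comment> \<open>Halving gives
    \<open>(norm (exp (poly Q z)))\<^sup>2 = exp (Re (poly P z))\<close>, the form to which
    \<open>carleman_exp_poly\<close> applies.\<close>
  define Q where "Q = smult (1 / 2) P"
  have nQ: "norm (exp (poly Q z)) ^ (2 * n) = exp (real n * Re (poly P z))" for z n
    by (simp add: Q_def norm_exp_eq_Re exp_of_nat_mult[symmetric])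
  have "(\<integral>z. exp (real m * v z) \<partial>disc_measure m) \<le> (\<integral>z. norm (exp (poly Q z)) ^ (2 * m) \<partial>disc_measure m)"
  proof (intro disc_mean_mono[OF m] continuous_intros v)
    fix z :: complex assume "norm z < 1"
    then have "v z \<le> Re (poly P z)"
      using max_principle_Re_poly[OF v _ P(1), of z] touch by auto
    then show "exp (real m * v z) \<le> norm (exp (poly Q z)) ^ (2 * m)"
      unfolding nQ by (simp add: mult_left_mono)
  qed
  also have "\<dots> \<le> (\<integral>z. (norm (exp (poly Q z)))\<^sup>2 \<partial>circle) ^ m"
    by (rule carleman_exp_poly[OF m])
  also have "\<dots> \<le> (\<integral>z. exp e * exp (v z) \<partial>circle) ^ m"
  proof (intro power_mono circle_mean_mono continuous_intros v)
    fix z :: complex assume "norm z = 1"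
    then show "(norm (exp (poly Q z)))\<^sup>2 \<le> exp e * exp (v z)"
      using P(2)[of z] unfolding nQ[of z 1, unfolded mult_1_right of_nat_1 mult_1]
      by (simp add: exp_add[symmetric] add.commute)
  qed (simp add: integral_nonneg_AE)
  also have "\<dots> = exp (real m * e) * (\<integral>z. exp (v z) \<partial>circle) ^ m"
    by (simp add: power_mult_distrib exp_of_nat_mult)
  finally show "(\<integral>z. exp (real m * v z) \<partial>disc_measure m) \<le> exp (real m * e) * (\<integral>z. exp (v z) \<partial>circle) ^ m" .
qed

text \<open>By Cauchy--Schwarz \<open>|g|\<^sup>2 + |h|\<^sup>2 + \<delta>\<close> is bounded below by a squared modulus of a holomorphic
  function that agrees with it at a given point.\<close>

lemma log_sum_squares_touches:
  assumes g: "disc_algebra g" and h: "disc_algebra h" and \<delta>: "0 < \<delta>" and s: "0 < s" and a: "norm a < 1"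
  shows "touches_from_below (\<lambda>z. s * ln ((norm (g z))\<^sup>2 + (norm (h z))\<^sup>2 + \<delta>)) a"
proof -
  define N where "N z = (norm (g z))\<^sup>2 + (norm (h z))\<^sup>2 + \<delta>" for z
  \<comment> \<open>The inner product of the vectors \<open>(g, h, sqrt \<delta>)\<close> at
    \<open>z\<close> and at \<open>a\<close>; it is holomorphic in \<open>z\<close>.\<close>
  define L where "L z = cnj (g a) * g z + cnj (h a) * h z + of_real \<delta>" for z
  have N0: "N z > 0" for z using \<delta> by (simp add: N_def add_nonneg_pos)
  have La: "L a = of_real (N a)"
    by (simp add: L_def N_def complex_norm_square mult.commute del: of_real_power)
  have CS: "(norm (L z))\<^sup>2 \<le> N a * N z" for z
  proof -
    have "norm (L z) \<le> norm (g a) * norm (g z) + norm (h a) * norm (h z) + \<delta>"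
      unfolding L_def using \<delta> norm_triangle_ineq
      by (intro order_trans[OF norm_triangle_ineq] add_mono) (auto simp: norm_mult intro: order_trans[OF norm_triangle_ineq])
    then have "(norm (L z))\<^sup>2 \<le> (norm (g a) * norm (g z) + norm (h a) * norm (h z) + \<delta>)\<^sup>2"
      by (intro power_mono) auto
    also have "\<dots> \<le> N a * N z"
    proof -
      \<comment> \<open>Lagrange's identity for \<open>(x, y, d)\<close> and
        \<open>(u, w, d)\<close>, used with \<open>d = sqrt \<delta>\<close>.\<close>
      have id: "(x\<^sup>2 + y\<^sup>2 + d * d) * (u\<^sup>2 + w\<^sup>2 + d * d) - (x * u + y * w + d * d)\<^sup>2
          = (x * w - y * u)\<^sup>2 + (d * (x - u))\<^sup>2 + (d * (y - w))\<^sup>2" for x y u w d :: real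
        by (simp add: power2_eq_square algebra_simps)
      have sq: "sqrt \<delta> * sqrt \<delta> = \<delta>" using \<delta> by simp
      show ?thesis
        using id[of "norm (g a)" "norm (h a)" "sqrt \<delta>" "norm (g z)" "norm (h z)", unfolded sq]
          zero_le_power2[of "norm (g a) * norm (h z) - norm (h a) * norm (g z)"]
          zero_le_power2[of "sqrt \<delta> * (norm (g a) - norm (g z))"]
          zero_le_power2[of "sqrt \<delta> * (norm (h a) - norm (h z))"]
        unfolding N_def by linarith
    qed
    finally show ?thesis .
  qed
  have hol: "L holomorphic_on ball 0 1"
    unfolding L_def using g h by (intro holomorphic_intros) (auto simp: disc_algebra_def)
  have "L a \<noteq> 0" using La N0[of a] by simp
  then obtain \<eta> where \<eta>: "0 < \<eta>" and sub: "ball a \<eta> \<subseteq> ball 0 1"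
    and near: "\<And>z. z \<in> ball a \<eta> \<Longrightarrow> L z / L a \<in> ball 1 1"
    using quotient_near_one[OF hol a, of 1] by auto
  show ?thesis
    unfolding touches_from_below_def N_def[symmetric]
  proof (intro exI[of _ \<eta>] exI[of _ "\<lambda>z. of_real (2 * s) * Ln (L z / L a) + of_real (s * ln (N a))"] conjI ballI)
    show "(\<lambda>z. of_real (2 * s) * Ln (L z / L a) + of_real (s * ln (N a))) holomorphic_on ball a \<eta>"
      by (intro holomorphic_intros holomorphic_on_subset[OF hol sub])
        (use \<open>L a \<noteq> 0\<close> near_one_not_nonpos[OF near] in auto)
    show "Re (of_real (2 * s) * Ln (L a / L a) + of_real (s * ln (N a))) = s * ln (N a)"
      using \<open>L a \<noteq> 0\<close> by simp
    fix z assume z: "z \<in> ball a \<eta>"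
    have Lz: "L z \<noteq> 0" using near[OF z] by auto
    have "Re (Ln (L z / L a)) = ln (norm (L z)) - ln (N a)"
      using Lz \<open>L a \<noteq> 0\<close> N0[of a] by (simp add: Re_Ln norm_divide La ln_div)
    moreover have "2 * ln (norm (L z)) \<le> ln (N a) + ln (N z)"
    proof -
      have "2 * ln (norm (L z)) = ln ((norm (L z))\<^sup>2)" using Lz by (simp add: ln_realpow)
      also have "\<dots> \<le> ln (N a * N z)" using CS[of z] Lz N0 by (intro ln_mono) auto
      also have "\<dots> = ln (N a) + ln (N z)" using N0[of a] N0[of z] by (simp add: ln_mult)
      finally show ?thesis .
    qed
    ultimately have "2 * Re (Ln (L z / L a)) + ln (N a) \<le> ln (N z)" by linarith
    then have "s * (2 * Re (Ln (L z / L a)) + ln (N a)) \<le> s * ln (N z)"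
      using s by (intro mult_left_mono) auto
    then show "Re (of_real (2 * s) * Ln (L z / L a) + of_real (s * ln (N a))) \<le> s * ln (N z)"
      by (simp add: algebra_simps)
  qed (rule \<eta>)
qed

lemma disc_algebra_continuous [continuous_intros]:
  "disc_algebra g \<Longrightarrow> continuous_on A g"
  by (auto simp: disc_algebra_def intro: continuous_on_subset)

lemma continuous_on_nonneg_powr:
  fixes f :: "'a::topological_space \<Rightarrow> real"
  assumes "continuous_on A f" "\<And>x. x \<in> A \<Longrightarrow> 0 \<le> f x" "0 < s"
  shows "continuous_on A (\<lambda>x. f x powr s)"
  using assms by (intro continuous_on_powr') (auto intro!: continuous_intros)

text \<open>The summand \<open>\<delta>\<close> keeps the logarithm finite at common zeros of
  \<open>g\<close> and \<open>h\<close>. On the disc it is discarded by monotonicity, on the circle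
  by dominated convergence.\<close>

lemma carleman_pair:
  assumes m: "2 \<le> m" and s: "0 < s" and g: "disc_algebra g" and h: "disc_algebra h"
  shows "(\<integral>z. ((norm (g z))\<^sup>2 + (norm (h z))\<^sup>2) powr (s * real m) \<partial>disc_measure m)
    \<le> (\<integral>z. ((norm (g z))\<^sup>2 + (norm (h z))\<^sup>2) powr s \<partial>circle) ^ m"
proof -
  interpret C: prob_space circle by (rule prob_space_circle)
  define w where "w z = (norm (g z))\<^sup>2 + (norm (h z))\<^sup>2" for z
  have w0: "0 \<le> w z" for z by (simp add: w_def)
  have cw: "continuous_on UNIV w" unfolding w_def by (intro continuous_intros g h)
  have step: "(\<integral>z. w z powr (s * real m) \<partial>disc_measure m) \<le> (\<integral>z. (w z + \<delta>) powr s \<partial>circle) ^ m"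
    if \<delta>: "0 < \<delta>" for \<delta>
  proof -
    have pos: "w z + \<delta> > 0" for z using w0[of z] \<delta> by linarith
    have e: "exp (r * (s * ln (w z + \<delta>))) = (w z + \<delta>) powr (r * s)" for z r
      using pos[of z] by (simp add: powr_def mult_ac)
    have "(\<integral>z. w z powr (s * real m) \<partial>disc_measure m) \<le> (\<integral>z. exp (real m * (s * ln (w z + \<delta>))) \<partial>disc_measure m)"
    proof (intro disc_mean_mono[OF m])
      show "continuous_on UNIV (\<lambda>z. w z powr (s * real m))"
        using s m by (intro continuous_on_nonneg_powr cw w0) auto
      show "continuous_on UNIV (\<lambda>z. exp (real m * (s * ln (w z + \<delta>))))"
        using pos by (intro continuous_intros cw) (simp add: less_imp_neq[THEN not_sym])
      show "w z powr (s * real m) \<le> exp (real m * (s * ln (w z + \<delta>)))" for z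
        unfolding e using w0[of z] \<delta> s by (simp add: mult.commute powr_mono2)
    qed
    also have "\<dots> \<le> (\<integral>z. exp (s * ln (w z + \<delta>)) \<partial>circle) ^ m"
    proof (rule carleman_log_subharmonic[OF m])
      show "continuous_on UNIV (\<lambda>z. s * ln (w z + \<delta>))"
        using pos by (intro continuous_intros cw) (simp add: less_imp_neq[THEN not_sym])
      show "touches_from_below (\<lambda>z. s * ln (w z + \<delta>)) a" if "norm a < 1" for a
        unfolding w_def by (rule log_sum_squares_touches[OF g h \<delta> s that])
    qed
    also have "\<dots> = (\<integral>z. (w z + \<delta>) powr s \<partial>circle) ^ m"
      using e[of 1] by simp
    finally show ?thesis .
  qed
  have cpow: "continuous_on UNIV (\<lambda>z. (w z + d) powr s)" if "0 \<le> d" for d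
    using s that w0 by (intro continuous_on_nonneg_powr continuous_intros cw) auto
  have "(\<lambda>k. \<integral>z. (w z + 1 / (real k + 1)) powr s \<partial>circle) \<longlonglongrightarrow> (\<integral>z. (w z + 0) powr s \<partial>circle)"
  proof (rule integral_dominated_convergence[where w = "\<lambda>z. (w z + 1) powr s"])
    show "integrable circle (\<lambda>z. (w z + 1) powr s)" by (intro integrable_circle cpow) simp
    show "AE z in circle. (\<lambda>k. (w z + 1 / (real k + 1)) powr s) \<longlonglongrightarrow> (w z + 0) powr s"
    proof (intro always_eventually allI)
      fix z
      have "(\<lambda>k. 1 / (real k + 1)) \<longlonglongrightarrow> 0" by real_asymp
      then show "(\<lambda>k. (w z + 1 / (real k + 1)) powr s) \<longlonglongrightarrow> (w z + 0) powr s"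
        using s w0[of z] by (intro tendsto_powr' tendsto_intros) (auto intro!: always_eventually add_nonneg_nonneg)
    qed
    show "AE z in circle. norm ((w z + 1 / (real k + 1)) powr s) \<le> (w z + 1) powr s" for k
      using s w0 by (intro always_eventually allI) (auto intro!: powr_mono2 add_nonneg_nonneg simp: divide_le_eq)
    show "(\<lambda>z. (w z + 0) powr s) \<in> borel_measurable circle"
      "(\<lambda>z. (w z + 1 / (real k + 1)) powr s) \<in> borel_measurable circle" for k
      by (intro borel_measurable_integrable integrable_circle cpow; simp)+
  qed
  then have "(\<lambda>k. (\<integral>z. (w z + 1 / (real k + 1)) powr s \<partial>circle) ^ m) \<longlonglongrightarrow> (\<integral>z. w z powr s \<partial>circle) ^ m"
    by (simp only: add_0_right) (rule tendsto_power)
  then show ?thesis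
    unfolding w_def[symmetric]
    by (rule LIMSEQ_le_const) (auto intro!: step)
qed

text \<open>With \<open>s = p * m / 2\<close> the half-angle formula turns the constant of
  \<open>norm_add_cnj_powr_upper\<close> into the numerator of \<open>const_R\<close> to the power
  \<open>p * m\<close>.\<close>

lemma one_plus_cos_powr_half:
  assumes p: "1 < p" and m: "2 \<le> (m::nat)"
  shows "(1 + cos (pi / (2 * (p / 2 * real m)))) powr (p / 2 * real m) = (sqrt 2 * cos (pi / (2 * real m * p))) powr (p * real m)"
proof -
  define x where "x = pi / (2 * real m * p)"
  have "1 * 1 \<le> real m * p" using p m by (intro mult_mono) auto
  then have x: "0 \<le> x" "x \<le> pi / 2" using p by (auto simp: x_def field_simps)
  have "1 + cos (2 * x) = (sqrt 2 * cos x)\<^sup>2" by (simp add: power_mult_distrib cos_double_cos)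
  moreover have "pi / (2 * (p / 2 * real m)) = 2 * x" by (simp add: x_def field_simps)
  moreover have "0 \<le> sqrt 2 * cos x" using x by (intro mult_nonneg_nonneg cos_ge_zero) auto
  ultimately show ?thesis by (simp add: sq_powr x_def[symmetric])
qed

lemma abs_cos_less_one: "1 < p \<Longrightarrow> \<bar>cos (pi / p)\<bar> < 1"
proof -
  assume p: "1 < p"
  then have "0 < pi / p" "pi / p < pi" by (auto simp: divide_less_eq)
  then have "0 < sin (pi / p)" by (intro sin_gt_zero)
  then have "(cos (pi / p))\<^sup>2 < 1" using sin_cos_squared_add[of "pi / p"] zero_less_power[of "sin (pi / p)" 2] by linarith
  then show ?thesis by (simp add: abs_square_less_1)
qed

lemma const_R_pos:
  assumes p: "1 < p" and m: "2 \<le> m"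
  shows "0 < const_R p m"
proof -
  have "1 * 1 < real m * p" using p m by (intro mult_le_less_imp_less) auto
  then have "pi / (2 * real m * p) < pi / 2" using p m by (simp add: field_simps)
  moreover have "0 < pi / (2 * real m * p)" using p m by simp
  ultimately have "0 < cos (pi / (2 * real m * p))" by (intro cos_gt_zero_pi) auto
  then show ?thesis using abs_cos_less_one[OF p] by (simp add: const_R_def)
qed

text \<open>The measures stay abstract so that one argument serves both the disc with its circle and
  the polydisc with its torus. The upper pointwise bound is integrated over \<open>M\<close> with
  exponent \<open>p * m\<close>, the lower one over \<open>N\<close> with exponent \<open>p\<close>,
  and \<open>carl\<close> joins them; the corrections have nonnegative integrals and are
  dropped.\<close>

lemma riesz_type_abstract:
  fixes g h :: "'a \<Rightarrow> complex"
  assumes p: "1 < p" and m: "2 \<le> (m::nat)"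
    and M: "\<And>Q :: complex \<times> complex \<Rightarrow> real. continuous_on UNIV Q \<Longrightarrow> integrable M (\<lambda>z. Q (g z, h z))"
    and N: "\<And>Q :: complex \<times> complex \<Rightarrow> real. continuous_on UNIV Q \<Longrightarrow> integrable N (\<lambda>z. Q (g z, h z))"
    and subM: "\<And>s. 1 \<le> s \<Longrightarrow> 0 \<le> (\<integral>z. homog s (phi_hi s) (g z * h z) \<partial>M)"
    and subN_hi: "\<And>s. 1 \<le> s \<Longrightarrow> 0 \<le> (\<integral>z. homog s (phi_hi s) (- (g z * h z)) \<partial>N)"
    and subN_lo: "\<And>s. 0 < s \<Longrightarrow> s \<le> 1 \<Longrightarrow> 0 \<le> (\<integral>z. homog s (phi_lo s) (g z * h z) \<partial>N)"
    and carl: "(\<integral>z. ((norm (g z))\<^sup>2 + (norm (h z))\<^sup>2) powr (p / 2 * real m) \<partial>M)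
       \<le> (\<integral>z. ((norm (g z))\<^sup>2 + (norm (h z))\<^sup>2) powr (p / 2) \<partial>N) ^ m"
  shows "(\<integral>z. norm (g z + cnj (h z)) powr (p * real m) \<partial>M)
    \<le> (const_R p m powr p * (\<integral>z. norm (g z + cnj (h z)) powr p \<partial>N)) ^ m"
proof -
  define X where "X z = (norm (g z))\<^sup>2 + (norm (h z))\<^sup>2" for z
  define s where "s = p / 2 * real m"
  have "1 * 2 \<le> p * real m" using p m by (intro mult_mono) auto
  then have s: "1 \<le> s" by (simp add: s_def)
  have cX: "continuous_on UNIV (\<lambda>w::complex \<times> complex. ((norm (fst w))\<^sup>2 + (norm (snd w))\<^sup>2) powr r)" if "0 < r" for r
    using that by (intro continuous_on_nonneg_powr continuous_intros) auto
  have cf: "continuous_on UNIV (\<lambda>w::complex \<times> complex. norm (fst w + cnj (snd w)) powr r)" if "0 < r" for r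
    using that by (intro continuous_on_nonneg_powr continuous_intros) auto
  have chi: "continuous_on UNIV (\<lambda>w::complex \<times> complex. homog r (phi_hi r) (c * (fst w * snd w)))" if "1 \<le> r" for r c
    using that by (intro continuous_on_compose2[OF continuous_on_homog[OF _ continuous_on_phi_hi]] continuous_intros) auto
  have clo: "continuous_on UNIV (\<lambda>w::complex \<times> complex. homog r (phi_lo r) (fst w * snd w))" if "0 < r" for r
    using that by (intro continuous_on_compose2[OF continuous_on_homog[OF _ continuous_on_phi_lo]] continuous_intros) auto
  have sp: "0 < s" "0 < p" "0 < p / 2" using s p by auto
  note iM = M[OF cX[OF sp(1)]] M[OF cf[of "p * real m"]] M[OF chi[OF s, of 1]]
  obtain c where c: "0 \<le> c" "\<And>a b. norm (a + cnj b) powr (2 * s) + c * homog s (phi_hi s) (a * b)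
     \<le> (1 + cos (pi / (2 * s))) powr s * ((norm a)\<^sup>2 + (norm b)\<^sup>2) powr s"
    using norm_add_cnj_powr_upper[OF s] by blast
  define K1 where "K1 = (sqrt 2 * cos (pi / (2 * real m * p))) powr (p * real m)"
  have K1: "(1 + cos (pi / (2 * s))) powr s = K1" unfolding K1_def s_def by (rule one_plus_cos_powr_half[OF p m])
  have K1': "K1 \<ge> 0" by (simp add: K1_def)
  have s2: "2 * s = p * real m" by (simp add: s_def)
  have pm: "0 < p * real m" using p m by simp
  have "(\<integral>z. norm (g z + cnj (h z)) powr (p * real m) \<partial>M)
     \<le> (\<integral>z. norm (g z + cnj (h z)) powr (p * real m) \<partial>M) + c * (\<integral>z. homog s (phi_hi s) (g z * h z) \<partial>M)"
    using c(1) subM[OF s] by simp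
  also have "\<dots> = (\<integral>z. norm (g z + cnj (h z)) powr (p * real m) + c * homog s (phi_hi s) (g z * h z) \<partial>M)"
    using iM pm by simp
  also have "\<dots> \<le> (\<integral>z. K1 * X z powr s \<partial>M)"
    using iM pm c(2)[unfolded K1, unfolded s2] unfolding X_def by (intro integral_mono) auto
  also have "\<dots> = K1 * (\<integral>z. X z powr s \<partial>M)" by simp
  also have "\<dots> \<le> K1 * (\<integral>z. X z powr (p / 2) \<partial>N) ^ m"
    using carl K1' unfolding X_def s_def by (intro mult_left_mono)
  finally have 1: "(\<integral>z. norm (g z + cnj (h z)) powr (p * real m) \<partial>M) \<le> K1 * (\<integral>z. X z powr (p / 2) \<partial>N) ^ m" .
  \<comment> \<open>The lower bounds have base \<open>1 - cos (pi / p)\<close> for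
    \<open>p \<ge> 2\<close> and \<open>1 + cos (pi / p)\<close> for \<open>p < 2\<close>; the sign
    of the cosine makes both equal to \<open>k\<close>.\<close>
  define k where "k = 1 - \<bar>cos (pi / p)\<bar>"
  have k: "k > 0" using abs_cos_less_one[OF p] by (simp add: k_def)
  note iN = N[OF cX[OF sp(3)]] N[OF cf[OF sp(2)]]
  have 2: "k powr (p / 2) * (\<integral>z. X z powr (p / 2) \<partial>N) \<le> (\<integral>z. norm (g z + cnj (h z)) powr p \<partial>N)"
  proof (cases "2 \<le> p")
    case True
    then have p2: "1 \<le> p / 2" by simp
    obtain c where c: "0 \<le> c" "\<And>a b. (1 - cos (pi / (2 * (p / 2)))) powr (p / 2) * ((norm a)\<^sup>2 + (norm b)\<^sup>2) powr (p / 2)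
     + c * homog (p / 2) (phi_hi (p / 2)) (- (a * b)) \<le> norm (a + cnj b) powr (2 * (p / 2))"
      using norm_add_cnj_powr_lower_hi[OF p2] by blast
    have "0 \<le> pi / p" "pi / p \<le> pi / 2" using True divide_left_mono[of 2 p pi] by auto
    then have "0 \<le> cos (pi / p)" by (intro cos_ge_zero) linarith+
    then have kk: "1 - cos (pi / (2 * (p / 2))) = k" by (simp add: k_def)
    note i = iN N[OF chi[OF p2, of "- 1"]]
    have "k powr (p / 2) * (\<integral>z. X z powr (p / 2) \<partial>N)
      \<le> k powr (p / 2) * (\<integral>z. X z powr (p / 2) \<partial>N) + c * (\<integral>z. homog (p / 2) (phi_hi (p / 2)) (- (g z * h z)) \<partial>N)"
      using c(1) subN_hi[OF p2] by simp
    also have "\<dots> = (\<integral>z. k powr (p / 2) * X z powr (p / 2) + c * homog (p / 2) (phi_hi (p / 2)) (- (g z * h z)) \<partial>N)"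
      using i by (simp add: X_def)
    also have "\<dots> \<le> (\<integral>z. norm (g z + cnj (h z)) powr p \<partial>N)"
      using i c(2) unfolding kk X_def by (intro integral_mono) auto
    finally show ?thesis .
  next
    case False
    then have p2: "1 / 2 < p / 2" "p / 2 \<le> 1" using p by auto
    obtain c where c: "0 \<le> c" "\<And>a b. (1 + cos (pi / (2 * (p / 2)))) powr (p / 2) * ((norm a)\<^sup>2 + (norm b)\<^sup>2) powr (p / 2)
     + c * homog (p / 2) (phi_lo (p / 2)) (a * b) \<le> norm (a + cnj b) powr (2 * (p / 2))"
      using norm_add_cnj_powr_lower_lo[OF p2] by blast
    have "0 \<le> cos (pi - pi / p)" using False p by (intro cos_ge_zero) (auto simp: field_simps)
    then have kk: "1 + cos (pi / (2 * (p / 2))) = k" by (simp add: k_def)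
    note i = iN N[OF clo[OF sp(3)]]
    have "k powr (p / 2) * (\<integral>z. X z powr (p / 2) \<partial>N)
      \<le> k powr (p / 2) * (\<integral>z. X z powr (p / 2) \<partial>N) + c * (\<integral>z. homog (p / 2) (phi_lo (p / 2)) (g z * h z) \<partial>N)"
      using c(1) subN_lo[OF sp(3) p2(2)] by simp
    also have "\<dots> = (\<integral>z. k powr (p / 2) * X z powr (p / 2) + c * homog (p / 2) (phi_lo (p / 2)) (g z * h z) \<partial>N)"
      using i by (simp add: X_def)
    also have "\<dots> \<le> (\<integral>z. norm (g z + cnj (h z)) powr p \<partial>N)"
      using i c(2) unfolding kk X_def by (intro integral_mono) auto
    finally show ?thesis .
  qed
  then have 3: "(\<integral>z. X z powr (p / 2) \<partial>N) \<le> k powr (- (p / 2)) * (\<integral>z. norm (g z + cnj (h z)) powr p \<partial>N)"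
    using k by (simp add: powr_minus field_simps)
  have "K1 * (\<integral>z. X z powr (p / 2) \<partial>N) ^ m \<le> K1 * (k powr (- (p / 2)) * (\<integral>z. norm (g z + cnj (h z)) powr p \<partial>N)) ^ m"
    using K1' 3 by (intro mult_left_mono power_mono) (auto intro!: integral_nonneg_AE)
  also have "\<dots> = (const_R p m powr p * (\<integral>z. norm (g z + cnj (h z)) powr p \<partial>N)) ^ m"
  proof -
    have x0: "0 < sqrt 2 * cos (pi / (2 * real m * p))"
      using const_R_pos[OF p m] k by (simp add: const_R_def k_def[symmetric] zero_less_divide_iff)
    have "sqrt k powr p = k powr (p / 2)"
      using k by (simp add: powr_half_sqrt[symmetric] powr_powr)
    moreover have "const_R p m powr p = (sqrt 2 * cos (pi / (2 * real m * p))) powr p / sqrt k powr p"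
      unfolding const_R_def k_def[symmetric] by (rule powr_divide)
    ultimately have "const_R p m powr p = (sqrt 2 * cos (pi / (2 * real m * p))) powr p * k powr (- (p / 2))"
      by (simp only: powr_minus divide_inverse)
    moreover have "K1 = ((sqrt 2 * cos (pi / (2 * real m * p))) powr p) ^ m"
    proof -
      have "K1 = ((sqrt 2 * cos (pi / (2 * real m * p))) powr p) powr real m"
        unfolding K1_def powr_powr ..
      also have "\<dots> = ((sqrt 2 * cos (pi / (2 * real m * p))) powr p) ^ m"
        by (intro powr_realpow) (metis powr_gt_zero less_irrefl x0)
      finally show ?thesis .
    qed
    ultimately show ?thesis by (simp add: power_mult_distrib mult.assoc)
  qed
  finally show ?thesis using 1 by linarith
qed

lemma riesz_type_disc:
  assumes p: "1 < p" and m: "2 \<le> m" and g: "disc_algebra g" and h: "disc_algebra h" and gh: "g 0 * h 0 = 0"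
  shows "(\<integral>z. norm (g z + cnj (h z)) powr (p * real m) \<partial>disc_measure m)
    \<le> (const_R p m powr p * (\<integral>z. norm (g z + cnj (h z)) powr p \<partial>circle)) ^ m"
proof (rule riesz_type_abstract[OF p m])
  have c: "continuous_on UNIV (\<lambda>z. Q (g z, h z))" if "continuous_on UNIV Q" for Q :: "complex \<times> complex \<Rightarrow> real"
    by (rule continuous_on_compose2[OF that]) (auto intro!: continuous_intros g h)
  show "integrable (disc_measure m) (\<lambda>z. Q (g z, h z))" "integrable circle (\<lambda>z. Q (g z, h z))"
    if "continuous_on UNIV Q" for Q :: "complex \<times> complex \<Rightarrow> real"
    by (intro integrable_disc[OF m] integrable_circle c that)+
  show "0 \<le> (\<integral>z. homog s (phi_hi s) (g z * h z) \<partial>disc_measure m)" if "1 \<le> s" for s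
    using submean_phi_hi_disc[OF m that disc_algebra_mult[OF g h]] gh by simp
  show "0 \<le> (\<integral>z. homog s (phi_hi s) (- (g z * h z)) \<partial>circle)" if "1 \<le> s" for s
    using submean_phi_hi[OF that disc_algebra_uminus[OF disc_algebra_mult[OF g h]]] gh by simp
  show "0 \<le> (\<integral>z. homog s (phi_lo s) (g z * h z) \<partial>circle)" if "0 < s" "s \<le> 1" for s
    using submean_phi_lo[OF that disc_algebra_mult[OF g h]] gh by simp
  show "(\<integral>z. ((norm (g z))\<^sup>2 + (norm (h z))\<^sup>2) powr (p / 2 * real m) \<partial>disc_measure m)
     \<le> (\<integral>z. ((norm (g z))\<^sup>2 + (norm (h z))\<^sup>2) powr (p / 2) \<partial>circle) ^ m"
    using p by (intro carleman_pair[OF m _ g h]) simp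
qed

section \<open>The one-variable inequality with the constant \<open>D\<close>\<close>

lemma Bernoulli_powr:
  fixes x t :: real
  assumes "0 \<le> x" "1 \<le> t"
  shows "1 + t * (x - 1) \<le> x powr t"
proof -
  define h where "h u = u powr t - t * u" for u :: real
  have "h 1 \<le> h x"
  proof (rule minimum_of_monotone_factor[where h = h and v = 1 and u = x and p = "\<lambda>_. t" and M = "\<lambda>u. u powr (t - 1)" and b = "x + 2"])
    show "continuous_on {0..x + 2} h"
      unfolding h_def using assms by (intro continuous_intros continuous_on_nonneg_powr) auto
    fix u :: real assume "0 < u"
    then show "(h has_real_derivative t * (u powr (t - 1) - 1 powr (t - 1))) (at u)"
      unfolding h_def by (auto intro!: derivative_eq_intros simp: algebra_simps)
  qed (use assms in \<open>auto intro: powr_mono2\<close>)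
  then show ?thesis by (simp add: h_def algebra_simps)
qed

lemma powr_above_tangent:
  fixes x a t :: real
  assumes "0 \<le> x" "0 < a" "1 \<le> t"
  shows "a powr t + t * a powr (t - 1) * (x - a) \<le> x powr t"
proof -
  have "a powr t * (1 + t * (x / a - 1)) \<le> a powr t * (x / a) powr t"
    using assms by (intro mult_left_mono Bernoulli_powr) auto
  also have "a powr t * (x / a) powr t = x powr t"
    using assms by (simp add: powr_divide)
  also have "a powr t * (1 + t * (x / a - 1)) = a powr t + t * (a powr t / a) * (x - a)"
    using assms by (simp add: field_simps)
  also have "a powr t / a = a powr (t - 1)"
    using assms by (simp add: powr_diff)
  finally show ?thesis .
qed

text \<open>Tangent line of \<open>x\<^sup>t\<close> at \<open>|f a|\<close>, applied to \<open>Re (cnj \<omega> f) \<le> |f|\<close> with \<open>\<omega>\<close> the direction of \<open>f a\<close>.\<close>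

lemma norm_harmonic_powr_touches:
  assumes t: "1 \<le> t" and g: "disc_algebra g" and h: "disc_algebra h" and a: "norm a < 1"
  shows "touches_from_below (\<lambda>z. norm (g z + cnj (h z)) powr t) a"
proof (cases "g a + cnj (h a) = 0")
  case True
  then show ?thesis
    unfolding touches_from_below_def by (intro exI[of _ 1] conjI exI[of _ "\<lambda>_. 0"]) auto
next
  case False
  define f where "f z = g z + cnj (h z)" for z
  define r where "r = norm (f a)"
  have r: "0 < r" using False by (simp add: r_def f_def)
  define \<omega> where "\<omega> = sgn (f a)"
  have n\<omega>: "norm \<omega> = 1" using False by (simp add: \<omega>_def f_def norm_sgn)
  define E where "E z = of_real (r powr t) + of_real (t * r powr (t - 1)) * (cnj \<omega> * g z + \<omega> * h z - of_real r)" for z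
  have ReE: "Re (E z) = r powr t + t * r powr (t - 1) * (Re (cnj \<omega> * f z) - r)" for z
    by (simp add: E_def f_def algebra_simps)
  have "cnj \<omega> * f a = of_real r"
    using r by (simp add: \<omega>_def r_def sgn_eq complex_norm_square[symmetric] mult.commute power2_eq_square)
  then have Ea: "Re (E a) = r powr t" by (simp only: ReE) simp
  show ?thesis
    unfolding touches_from_below_def
  proof (intro exI[of _ "1 - norm a"] exI[of _ E] conjI ballI)
    show "0 < 1 - norm a" using a by simp
    have "g holomorphic_on ball a (1 - norm a)" "h holomorphic_on ball a (1 - norm a)"
      using g h ball_subset_unit_ball[of a] by (auto simp: disc_algebra_def intro: holomorphic_on_subset)
    then show "E holomorphic_on ball a (1 - norm a)"
      unfolding E_def by (intro holomorphic_intros)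
    show "Re (E a) = norm (g a + cnj (h a)) powr t" using Ea by (simp add: r_def f_def)
    fix z
    have "Re (cnj \<omega> * f z) \<le> norm (f z)"
      using complex_Re_le_cmod[of "cnj \<omega> * f z"] n\<omega> by (simp add: norm_mult)
    then have "Re (E z) \<le> r powr t + t * r powr (t - 1) * (norm (f z) - r)"
      unfolding ReE using t by (intro add_left_mono mult_left_mono) auto
    also have "\<dots> \<le> norm (f z) powr t" by (rule powr_above_tangent[OF _ r t]) simp
    finally show "Re (E z) \<le> norm (g z + cnj (h z)) powr t" by (simp add: f_def)
  qed
qed

text \<open>At \<open>p = 2\<close> the denominator of \<open>R\<close> is \<open>1\<close>, since
  \<open>cos (pi / 2) = 0\<close>; this is where \<open>D\<close> comes from.\<close>

lemma const_R_two: "const_R 2 m = const_D m"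
  by (simp add: const_R_def const_D_def mult.commute)

text \<open>\<open>Re P\<close> is written as \<open>g + cnj h\<close> with the whole constant term
  in \<open>g\<close>, so that \<open>h 0 = 0\<close> and \<open>riesz_type_disc\<close> applies
  with \<open>p = 2\<close>.\<close>

lemma carleman_Re_poly:
  assumes m: "2 \<le> m"
  shows "(\<integral>z. \<bar>Re (poly P z)\<bar> ^ (2 * m) \<partial>disc_measure m)
     \<le> ((const_D m)\<^sup>2 * (\<integral>z. (Re (poly P z))\<^sup>2 \<partial>circle)) ^ m"
proof -
  define g where "g = poly (smult (1 / 2) (P + [:cnj (poly P 0):]))"
  define h where "h = poly (smult (1 / 2) (P - [:poly P 0:]))"
  have eq: "g z + cnj (h z) = of_real (Re (poly P z))" for z
    by (simp add: g_def h_def complex_eq_iff field_simps)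
  have dg: "disc_algebra g" "disc_algebra h"
    unfolding g_def h_def by (rule disc_algebra_poly)+
  have n: "norm (g z + cnj (h z)) = \<bar>Re (poly P z)\<bar>" for z by (simp add: eq)
  have D: "0 < const_D m" using const_R_pos[of 2 m] m by (simp add: const_R_two)
  have p1: "x powr (2 * real m) = x ^ (2 * m)" if "0 \<le> x" for x :: real
    using that m by (cases "x = 0") (auto simp: power_0_left simp flip: powr_realpow)
  have p2: "x powr 2 = x\<^sup>2" if "0 \<le> x" for x :: real
    using that by (cases "x = 0") (auto simp: powr_numeral)
  have "(\<integral>z. norm (g z + cnj (h z)) powr (2 * real m) \<partial>disc_measure m)
    \<le> (const_R 2 m powr 2 * (\<integral>z. norm (g z + cnj (h z)) powr 2 \<partial>circle)) ^ m"
    by (rule riesz_type_disc[OF _ m dg]) (auto simp: h_def)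
  then show ?thesis
    unfolding n const_R_two using D by (simp add: p1 p2)
qed

text \<open>For \<open>v = norm f powr (p / 2)\<close> the claim becomes the exponent
  \<open>2\<close> inequality, known for real parts of polynomials. A majorant within
  \<open>e\<close> of \<open>v\<close> on the circle transfers it; \<open>p \<ge> 2\<close> makes
  the exponent \<open>p / 2\<close> at least \<open>1\<close>, for which \<open>v\<close> has
  touching minorants.\<close>

lemma carleman_harmonic:
  assumes m: "2 \<le> m" and p: "2 \<le> p" and g: "disc_algebra g" and h: "disc_algebra h"
  shows "(\<integral>z. norm (g z + cnj (h z)) powr (p * real m) \<partial>disc_measure m)
     \<le> ((const_D m)\<^sup>2 * (\<integral>z. norm (g z + cnj (h z)) powr p \<partial>circle)) ^ m"
proof -
  interpret C: prob_space circle by (rule prob_space_circle)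
  define v where "v z = norm (g z + cnj (h z)) powr (p / 2)" for z
  have v0: "0 \<le> v z" for z by (simp add: v_def)
  have cv: "continuous_on UNIV v"
    unfolding v_def using p by (intro continuous_on_nonneg_powr continuous_intros g h) auto
  have sq: "norm (g z + cnj (h z)) powr p = (v z)\<^sup>2" for z
    by (cases "g z + cnj (h z) = 0") (auto simp: v_def powr_powr simp flip: powr_numeral)
  have pw: "norm (g z + cnj (h z)) powr (p * real m) = v z ^ (2 * m)" for z
    by (cases "g z + cnj (h z) = 0") (use m p in \<open>auto simp: v_def powr_powr power_0_left simp flip: powr_realpow\<close>)
  define I1 I2 where "I1 = (\<integral>z. v z \<partial>circle)" and "I2 = (\<integral>z. (v z)\<^sup>2 \<partial>circle)"
  have "(\<integral>z. v z ^ (2 * m) \<partial>disc_measure m) \<le> ((const_D m)\<^sup>2 * (I2 + 2 * e * I1 + e\<^sup>2)) ^ m" if e: "0 < e" for e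
  proof -
    obtain P0 where P0: "\<And>z. norm z = 1 \<Longrightarrow> \<bar>v z - Re (poly P0 z)\<bar> < e / 2"
      using Re_poly_approx_circle[of v "e / 2"] continuous_on_subset[OF cv] e by auto
    define P where "P = P0 + [:of_real (e / 2):]"
    have P: "v z \<le> Re (poly P z)" "Re (poly P z) \<le> v z + e" if "norm z = 1" for z
    proof -
      have "v z - Re (poly P0 z) \<le> e / 2" "Re (poly P0 z) - v z \<le> e / 2" using P0[OF that] by linarith+
      then show "v z \<le> Re (poly P z)" "Re (poly P z) \<le> v z + e" by (simp_all add: P_def)
    qed
    have "(\<integral>z. v z ^ (2 * m) \<partial>disc_measure m) \<le> (\<integral>z. \<bar>Re (poly P z)\<bar> ^ (2 * m) \<partial>disc_measure m)"
    proof (intro disc_mean_mono[OF m] continuous_intros cv)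
      fix z :: complex assume "norm z < 1"
      moreover have "touches_from_below v a" if "norm a < 1" for a
        unfolding v_def using norm_harmonic_powr_touches[OF _ g h that] p by simp
      ultimately have "v z \<le> Re (poly P z)"
        using max_principle_Re_poly[OF cv _ P(1), of z] by auto
      then show "v z ^ (2 * m) \<le> \<bar>Re (poly P z)\<bar> ^ (2 * m)"
        using v0 by (intro power_mono) (auto intro: order_trans)
    qed
    also have "\<dots> \<le> ((const_D m)\<^sup>2 * (\<integral>z. (Re (poly P z))\<^sup>2 \<partial>circle)) ^ m"
      by (rule carleman_Re_poly[OF m])
    also have "\<dots> \<le> ((const_D m)\<^sup>2 * (\<integral>z. (v z + e)\<^sup>2 \<partial>circle)) ^ m"
    proof (rule power_mono[OF mult_left_mono[OF circle_mean_mono]])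
      fix z :: complex assume z: "norm z = 1"
      show "(Re (poly P z))\<^sup>2 \<le> (v z + e)\<^sup>2"
        using P[OF z] v0[of z] by (intro power_mono) linarith+
    qed (auto intro!: mult_nonneg_nonneg integral_nonneg_AE continuous_intros cv disc_algebra_poly)
    also have "(\<integral>z. (v z + e)\<^sup>2 \<partial>circle) = I2 + 2 * e * I1 + e\<^sup>2"
    proof -
      have i: "integrable circle v" "integrable circle (\<lambda>z. (v z)\<^sup>2)"
        by (intro integrable_circle continuous_intros cv)+
      have "(\<integral>z. (v z + e)\<^sup>2 \<partial>circle) = (\<integral>z. (v z)\<^sup>2 + 2 * e * v z + e\<^sup>2 \<partial>circle)"
        by (simp add: power2_eq_square algebra_simps)
      then show ?thesis using i C.prob_space by (simp add: I1_def I2_def)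
    qed
    finally show ?thesis .
  qed
  moreover have "((\<lambda>e. ((const_D m)\<^sup>2 * (I2 + 2 * e * I1 + e\<^sup>2)) ^ m) \<longlongrightarrow> ((const_D m)\<^sup>2 * (I2 + 2 * 0 * I1 + 0\<^sup>2)) ^ m) (at_right 0)"
    by (intro tendsto_intros)
  ultimately have "(\<integral>z. v z ^ (2 * m) \<partial>disc_measure m) \<le> ((const_D m)\<^sup>2 * (I2 + 2 * 0 * I1 + 0\<^sup>2)) ^ m"
    by (rule le_of_le_limit_at_right_0)
  then show ?thesis by (simp add: pw sq I2_def)
qed

section \<open>Tensorization\<close>

lemma power_above_tangent:
  fixes x a :: real
  assumes "0 \<le> x" "0 \<le> a" "0 < m"
  shows "a ^ m + real m * a ^ (m - 1) * (x - a) \<le> x ^ m"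
proof (cases "a = 0")
  case True
  then show ?thesis using assms by (cases "m = 1") (auto simp: power_0_left)
next
  case False
  then have a: "0 < a" using assms by simp
  have "1 + real m * (x / a - 1) \<le> (1 + (x / a - 1)) ^ m"
    using assms a by (intro Bernoulli_inequality) auto
  then have "a ^ m * (1 + real m * (x / a - 1)) \<le> a ^ m * (x / a) ^ m"
    using a by (intro mult_left_mono) auto
  also have "a ^ m * (x / a) ^ m = x ^ m" using a by (simp add: power_divide)
  also have "a ^ m * (1 + real m * (x / a - 1)) = a ^ m + real m * a ^ (m - 1) * (x - a)"
  proof -
    have "a ^ m = a ^ (m - 1) * a" using assms by (metis power_minus_mult)
    then show ?thesis using a by (simp add: field_simps)
  qed
  finally show ?thesis .
qed

text \<open>Jensen's inequality for the probability measure proportional to \<open>B dN\<close>, via the tangent line at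
  the mean.\<close>

lemma weighted_jensen_power:
  fixes w B :: "'a \<Rightarrow> real"
  assumes N: "prob_space N" and m: "0 < m"
    and wB: "\<And>y. 0 \<le> w y" "\<And>y. 0 < B y"
    and int: "integrable N w" "integrable N B" "integrable N (\<lambda>y. w y ^ m / B y ^ (m - 1))"
  shows "(\<integral>y. w y \<partial>N) ^ m \<le> (\<integral>y. B y \<partial>N) ^ (m - 1) * (\<integral>y. w y ^ m / B y ^ (m - 1) \<partial>N)"
proof -
  interpret prob_space N by (rule N)
  define S where "S = (\<integral>y. B y \<partial>N)"
  have S: "0 < S"
  proof -
    have "0 \<le> S" unfolding S_def using wB by (intro integral_nonneg_AE) (auto intro: less_imp_le)
    moreover have "S \<noteq> 0"
    proof
      assume "S = 0"
      then have "AE y in N. B y = 0"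
        unfolding S_def using int(2) wB by (subst (asm) integral_nonneg_eq_0_iff_AE) (auto intro: less_imp_le)
      then have "AE y in N. False" by eventually_elim (use wB in \<open>metis less_irrefl\<close>)
      then show False by simp
    qed
    ultimately show ?thesis by simp
  qed
  \<comment> \<open>The mean of \<open>w / B\<close> under the probability measure with density
    \<open>B / S\<close>. The tangent of \<open>x ^ m\<close> at \<open>A\<close> is integrated, and
    its linear term contributes \<open>0\<close>.\<close>
  define A where "A = (\<integral>y. w y \<partial>N) / S"
  have A0: "0 \<le> A" unfolding A_def using S wB by (intro divide_nonneg_nonneg integral_nonneg_AE) auto
  have "A ^ m * S = (\<integral>y. A ^ m * B y + real m * A ^ (m - 1) * (w y - A * B y) \<partial>N)"
    using int S by (simp add: S_def[symmetric] A_def)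
  also have "\<dots> \<le> (\<integral>y. w y ^ m / B y ^ (m - 1) \<partial>N)"
  proof (rule integral_mono)
    fix y
    have "B y * (A ^ m + real m * A ^ (m - 1) * (w y / B y - A)) \<le> B y * (w y / B y) ^ m"
      using wB[of y] A0 m by (intro mult_left_mono power_above_tangent) (auto intro: less_imp_le)
    also have "B y * (w y / B y) ^ m = w y ^ m / B y ^ (m - 1)"
    proof -
      have "B y ^ m = B y ^ (m - 1) * B y" using m by (metis power_minus_mult)
      then show ?thesis using wB(2)[of y] by (simp add: power_divide field_simps)
    qed
    also have "B y * (A ^ m + real m * A ^ (m - 1) * (w y / B y - A)) = A ^ m * B y + real m * A ^ (m - 1) * (w y - A * B y)"
      using wB(2)[of y] by (simp add: field_simps)
    finally show "A ^ m * B y + real m * A ^ (m - 1) * (w y - A * B y) \<le> w y ^ m / B y ^ (m - 1)" .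
  qed (use int in auto)
  finally have "A ^ m * S \<le> (\<integral>y. w y ^ m / B y ^ (m - 1) \<partial>N)" .
  then have "S ^ (m - 1) * (A ^ m * S) \<le> S ^ (m - 1) * (\<integral>y. w y ^ m / B y ^ (m - 1) \<partial>N)"
    using S by (intro mult_left_mono) auto
  moreover have "S ^ (m - 1) * (A ^ m * S) = (\<integral>y. w y \<partial>N) ^ m"
  proof -
    have "S ^ m = S ^ (m - 1) * S" using m by (metis power_minus_mult)
    then have "S ^ (m - 1) * (A ^ m * S) = (A * S) ^ m" by (simp add: power_mult_distrib)
    then show ?thesis using S by (simp add: A_def)
  qed
  ultimately show ?thesis by (simp add: S_def)
qed

lemma (in prob_space) integrable_bounded:
  fixes f :: "'a \<Rightarrow> real"
  assumes "f \<in> borel_measurable M" "\<And>x. \<bar>f x\<bar> \<le> K"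
  shows "integrable M f"
  by (rule integrable_const_bound[where B = K]) (use assms in auto)

lemma (in prob_space) abs_integral_le:
  fixes f :: "'a \<Rightarrow> real"
  assumes f: "\<And>x. \<bar>f x\<bar> \<le> K"
  shows "\<bar>\<integral>x. f x \<partial>M\<bar> \<le> K"
proof (cases "integrable M f")
  case True
  have b: "f x \<le> K" "- K \<le> f x" for x using f[of x] by linarith+
  have "(\<integral>x. f x \<partial>M) \<le> (\<integral>x. K \<partial>M)" "(\<integral>x. - K \<partial>M) \<le> (\<integral>x. f x \<partial>M)"
    by (intro integral_mono True b; simp)+
  then show ?thesis using prob_space by (simp add: abs_le_iff)
next
  case False
  then show ?thesis using f[of undefined] by (simp add: not_integrable_integral_eq)
qed

text \<open>Minkowski's integral inequality for the \<open>m\<close>-norm over \<open>M\<close>.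
  Jensen with weight \<open>B = b + e\<close>, then Fubini: the inner integral of
  \<open>w ^ m / B ^ (m - 1)\<close> is at most \<open>C * B\<close>. The summand \<open>e\<close>
  avoids division by zero and tends to \<open>0\<close> at the end.\<close>

lemma minkowski_power:
  fixes w :: "'a \<Rightarrow> 'b \<Rightarrow> real" and b :: "'a \<Rightarrow> real"
  assumes N: "prob_space N" and M: "prob_space M" and m: "0 < m" and C: "0 \<le> C"
    and w [measurable]: "(\<lambda>(y, x). w y x) \<in> borel_measurable (N \<Otimes>\<^sub>M M)"
    and w0: "\<And>y x. 0 \<le> w y x" and wK: "\<And>y x. w y x \<le> K"
    and b [measurable]: "b \<in> borel_measurable N" and b0: "\<And>y. 0 \<le> b y" and bK: "\<And>y. b y \<le> K"
    and le: "\<And>y. y \<in> space N \<Longrightarrow> (\<integral>x. w y x ^ m \<partial>M) \<le> C * b y ^ m"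
  shows "(\<integral>x. (\<integral>y. w y x \<partial>N) ^ m \<partial>M) \<le> C * (\<integral>y. b y \<partial>N) ^ m"
proof (rule le_of_le_limit_at_right_0)
  interpret N: prob_space N by (rule N)
  interpret M: prob_space M by (rule M)
  interpret P: pair_prob_space N M ..
  have ws [measurable]: "(\<lambda>(x, y). w y x) \<in> borel_measurable (M \<Otimes>\<^sub>M N)"
    using measurable_pair_swap[OF w] by simp
  have K: "0 \<le> K" using b0[of undefined] bK[of undefined] by linarith
  have wabs: "\<bar>w y x\<bar> \<le> K" "\<bar>w y x ^ m\<bar> \<le> K ^ m" for y x
    using w0[of y x] wK[of y x] by (auto simp: power_mono abs_le_iff)
  have bi: "integrable N b" by (rule N.integrable_bounded[where K = K]) (use b0 bK b in \<open>auto simp: abs_le_iff intro: order_trans[of _ 0]\<close>)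
  show "((\<lambda>e. C * ((\<integral>y. b y \<partial>N) + e) ^ m) \<longlongrightarrow> C * (\<integral>y. b y \<partial>N) ^ m) (at_right 0)"
    by (rule tendsto_eq_intros refl | simp)+
  fix e :: real assume e: "0 < e"
  define B where "B y = b y + e" for y
  have B: "0 < B y" "e \<le> B y" for y using b0[of y] e by (auto simp: B_def)
  have [measurable]: "B \<in> borel_measurable N" unfolding B_def by measurable
  define S where "S = (\<integral>y. B y \<partial>N)"
  have Sb: "S = (\<integral>y. b y \<partial>N) + e" using bi N.prob_space by (simp add: S_def B_def)
  have S0: "0 \<le> S" unfolding S_def using B by (intro integral_nonneg_AE) (auto intro: less_imp_le)
  define Q where "Q = K ^ m / e ^ (m - 1)"
  have qb: "\<bar>w y x ^ m / B y ^ (m - 1)\<bar> \<le> Q" for y x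
  proof -
    have "w y x ^ m / B y ^ (m - 1) \<le> K ^ m / e ^ (m - 1)"
      using w0 wK K B e by (intro frac_le power_mono) auto
    moreover have "0 \<le> w y x ^ m / B y ^ (m - 1)" using w0[of y x] B(1)[of y] by simp
    ultimately show ?thesis by (simp add: Q_def)
  qed
  have qm: "(\<lambda>(y, x). w y x ^ m / B y ^ (m - 1)) \<in> borel_measurable (N \<Otimes>\<^sub>M M)"
    by measurable
  have "(\<integral>x. (\<integral>y. w y x \<partial>N) ^ m \<partial>M) \<le> (\<integral>x. S ^ (m - 1) * (\<integral>y. w y x ^ m / B y ^ (m - 1) \<partial>N) \<partial>M)"
  proof (rule integral_mono)
    fix x assume x [measurable]: "x \<in> space M"
    show "(\<integral>y. w y x \<partial>N) ^ m \<le> S ^ (m - 1) * (\<integral>y. w y x ^ m / B y ^ (m - 1) \<partial>N)"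
      unfolding S_def
    proof (rule weighted_jensen_power[OF N m])
      show "integrable N B" using bi unfolding B_def by simp
      show "integrable N (\<lambda>y. w y x)"
        by (rule N.integrable_bounded[OF _ wabs(1)]) measurable
      show "integrable N (\<lambda>y. w y x ^ m / B y ^ (m - 1))"
        by (rule N.integrable_bounded[OF _ qb]) measurable
    qed (use w0 B in auto)
  next
    show "integrable M (\<lambda>x. (\<integral>y. w y x \<partial>N) ^ m)"
    proof (rule M.integrable_bounded[where K = "K ^ m"])
      show "\<bar>(\<integral>y. w y x \<partial>N) ^ m\<bar> \<le> K ^ m" for x
        unfolding power_abs by (intro power_mono N.abs_integral_le wabs(1)) auto
    qed measurable
    show "integrable M (\<lambda>x. S ^ (m - 1) * (\<integral>y. w y x ^ m / B y ^ (m - 1) \<partial>N))"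
      by (intro integrable_mult_right M.integrable_bounded[OF _ N.abs_integral_le[OF qb]]) measurable
  qed
  also have "\<dots> = S ^ (m - 1) * (\<integral>x. (\<integral>y. w y x ^ m / B y ^ (m - 1) \<partial>N) \<partial>M)"
    by simp
  also have "(\<integral>x. (\<integral>y. w y x ^ m / B y ^ (m - 1) \<partial>N) \<partial>M) = (\<integral>y. (\<integral>x. w y x ^ m / B y ^ (m - 1) \<partial>M) \<partial>N)"
    by (rule P.Fubini_integral, rule P.integrable_bounded[where K = Q, OF qm]) (use qb in auto)
  also have "S ^ (m - 1) * (\<integral>y. (\<integral>x. w y x ^ m / B y ^ (m - 1) \<partial>M) \<partial>N) \<le> S ^ (m - 1) * (\<integral>y. C * B y \<partial>N)"
  proof (intro mult_left_mono integral_mono)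
    show "integrable N (\<lambda>y. \<integral>x. w y x ^ m / B y ^ (m - 1) \<partial>M)"
      by (intro N.integrable_bounded[OF _ M.abs_integral_le[OF qb]]) measurable
    show "integrable N (\<lambda>y. C * B y)" using bi unfolding B_def by simp
    fix y assume y: "y \<in> space N"
    have Bm: "B y ^ m = B y ^ (m - 1) * B y" using m by (metis power_minus_mult)
    have "(\<integral>x. w y x ^ m \<partial>M) \<le> C * b y ^ m" by (rule le[OF y])
    also have "\<dots> \<le> C * B y ^ m" using C b0[of y] e by (intro mult_left_mono power_mono) (auto simp: B_def)
    finally have "(\<integral>x. w y x ^ m \<partial>M) / B y ^ (m - 1) \<le> C * B y"
      using B(1)[of y] by (simp add: Bm divide_le_eq mult_ac)
    then show "(\<integral>x. w y x ^ m / B y ^ (m - 1) \<partial>M) \<le> C * B y" by simp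
  qed (use S0 in simp)
  also have "\<dots> = C * S ^ m"
    using m by (simp add: S_def[symmetric] power_minus_mult[of m S, symmetric])
  finally show "(\<integral>x. (\<integral>y. w y x \<partial>N) ^ m \<partial>M) \<le> C * ((\<integral>y. b y \<partial>N) + e) ^ m" by (simp add: Sb)
qed

section \<open>Integration coordinate by coordinate against product measures\<close>

definition upd :: "'a ^ 'n \<Rightarrow> 'n \<Rightarrow> 'a \<Rightarrow> 'a ^ 'n" where
  "upd z k x = (\<chi> j. if j = k then x else z $ j)"

definition vmerge :: "'n set \<Rightarrow> ('n \<Rightarrow> 'a) \<Rightarrow> 'a ^ 'n \<Rightarrow> 'a ^ 'n" where
  "vmerge J x z = (\<chi> j. if j \<in> J then x j else z $ j)"

lemma vmerge_insert:
  "k \<notin> J \<Longrightarrow> vmerge (insert k J) (x(k := t)) z = vmerge J x (upd z k t)"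
  by (auto simp: vmerge_def upd_def vec_eq_iff)

lemma vmerge_upd:
  "k \<notin> J \<Longrightarrow> vmerge J x (upd z k t) = upd (vmerge J x z) k t"
  by (auto simp: vmerge_def upd_def vec_eq_iff)

lemma borel_measurable_vec_lambda:
  fixes f :: "'b \<Rightarrow> 'n::finite \<Rightarrow> 'a::euclidean_space"
  assumes "\<And>k. (\<lambda>x. f x k) \<in> borel_measurable M"
  shows "(\<lambda>x. \<chi> k. f x k) \<in> borel_measurable M"
proof (subst borel_measurable_euclidean_space, intro ballI)
  fix b :: "'a ^ 'n" assume "b \<in> Basis"
  then obtain u k where "b = axis k u" by (auto simp: Basis_vec_def)
  then have "(\<lambda>x. (\<chi> k. f x k) \<bullet> b) = (\<lambda>x. f x k \<bullet> u)"
    by (simp add: inner_axis)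
  then show "(\<lambda>x. (\<chi> k. f x k) \<bullet> b) \<in> borel_measurable M"
    using assms[of k] by simp
qed

lemma borel_measurable_vec_nth [measurable]:
  "(\<lambda>z :: 'a::euclidean_space ^ 'n::finite. z $ k) \<in> borel_measurable borel"
  by (intro borel_measurable_continuous_onI continuous_intros)

locale coordinate_measures =
  fixes M :: "'a::euclidean_space measure"
  assumes prob: "prob_space M" and sets_M [measurable_cong, simp]: "sets M = sets borel"
begin

sublocale prob_space M by (rule prob)

sublocale product: product_prob_space "\<lambda>_ :: 'n::finite. M" UNIV
  by unfold_locales

lemma vmerge_measurable [measurable]:
  "(\<lambda>x. vmerge J x z) \<in> borel_measurable (\<Pi>\<^sub>M j\<in>J. M)" for J :: "'n::finite set"
proof -
  have "(\<lambda>x. if j \<in> J then x j else z $ j) \<in> borel_measurable (\<Pi>\<^sub>M j\<in>J. M)" for j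
  proof (cases "j \<in> J")
    case True
    then have "(\<lambda>x. x j) \<in> measurable (\<Pi>\<^sub>M j\<in>J. M) M" by (rule measurable_component_singleton)
    then show ?thesis using True by (simp cong: measurable_cong_sets)
  qed simp
  then show ?thesis unfolding vmerge_def by (rule borel_measurable_vec_lambda)
qed

lemma vmerge_upd_measurable:
  "(\<lambda>(x, t). vmerge J x (upd z k t)) \<in> borel_measurable ((\<Pi>\<^sub>M j\<in>J. M) \<Otimes>\<^sub>M M)" for J :: "'n::finite set"
proof -
  have "(\<lambda>w. if j \<in> J then fst w j else upd z k (snd w) $ j) \<in> borel_measurable ((\<Pi>\<^sub>M j\<in>J. M) \<Otimes>\<^sub>M M)" for j
  proof (cases "j \<in> J")
    case True
    then have "(\<lambda>x. x j) \<in> measurable (\<Pi>\<^sub>M j\<in>J. M) M" by (rule measurable_component_singleton)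
    then have "(\<lambda>x. x j) \<in> borel_measurable (\<Pi>\<^sub>M j\<in>J. M)" by (simp cong: measurable_cong_sets)
    then show ?thesis using True by simp
  next
    case False
    have "snd \<in> borel_measurable ((\<Pi>\<^sub>M j\<in>J. M) \<Otimes>\<^sub>M M)"
      using measurable_snd[of "\<Pi>\<^sub>M j\<in>J. M" M] by (simp cong: measurable_cong_sets)
    then show ?thesis using False by (cases "j = k") (simp_all add: upd_def)
  qed
  then show ?thesis unfolding vmerge_def split_beta by (rule borel_measurable_vec_lambda)
qed

lemma prob_space_PiM_coordinates: "prob_space (\<Pi>\<^sub>M j\<in>J. M)" for J :: "'n::finite set"
  by (rule prob_space_PiM) (rule prob)

text \<open>Both orders are recorded because \<open>tensor_power_inequality\<close> needs both: it
  splits off the new coordinate as outer variable for \<open>M\<close> and reassembles it as inner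
  variable for \<open>N\<close>.\<close>

lemma integral_vmerge_insert:
  fixes f :: "'a ^ 'n::finite \<Rightarrow> real"
  assumes f [measurable]: "f \<in> borel_measurable borel" and bound: "\<And>z. \<bar>f z\<bar> \<le> K" and k: "k \<notin> J"
  shows "(\<integral>x. f (vmerge (insert k J) x z) \<partial>(\<Pi>\<^sub>M j\<in>insert k J. M))
     = (\<integral>t. (\<integral>x. f (vmerge J x (upd z k t)) \<partial>(\<Pi>\<^sub>M j\<in>J. M)) \<partial>M)"
    and "(\<integral>x. f (vmerge (insert k J) x z) \<partial>(\<Pi>\<^sub>M j\<in>insert k J. M))
     = (\<integral>x. (\<integral>t. f (vmerge J x (upd z k t)) \<partial>M) \<partial>(\<Pi>\<^sub>M j\<in>J. M))"
proof -
  interpret PJ: prob_space "\<Pi>\<^sub>M j\<in>J. M" by (rule prob_space_PiM_coordinates)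
  interpret PK: prob_space "\<Pi>\<^sub>M j\<in>insert k J. M" by (rule prob_space_PiM_coordinates)
  interpret PP: pair_prob_space "\<Pi>\<^sub>M j\<in>J. M" M ..
  note [measurable] = vmerge_upd_measurable[of J z k]
  have "(\<integral>x. f (vmerge (insert k J) x z) \<partial>(\<Pi>\<^sub>M j\<in>insert k J. M))
     = (\<integral>x. (\<integral>t. f (vmerge (insert k J) (x(k := t)) z) \<partial>M) \<partial>(\<Pi>\<^sub>M j\<in>J. M))"
  proof (rule product.product_integral_insert[OF _ k])
    show "integrable (\<Pi>\<^sub>M j\<in>insert k J. M) (\<lambda>x. f (vmerge (insert k J) x z))"
      by (rule PK.integrable_bounded[OF _ bound]) measurable
  qed simp
  then show 2: "(\<integral>x. f (vmerge (insert k J) x z) \<partial>(\<Pi>\<^sub>M j\<in>insert k J. M))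
     = (\<integral>x. (\<integral>t. f (vmerge J x (upd z k t)) \<partial>M) \<partial>(\<Pi>\<^sub>M j\<in>J. M))"
    by (simp add: vmerge_insert[OF k])
  have meas: "(\<lambda>w. f (vmerge J (fst w) (upd z k (snd w)))) \<in> borel_measurable ((\<Pi>\<^sub>M j\<in>J. M) \<Otimes>\<^sub>M M)"
    using measurable_compose[OF vmerge_upd_measurable[of J z k] f] by (simp add: split_beta)
  have "integrable ((\<Pi>\<^sub>M j\<in>J. M) \<Otimes>\<^sub>M M) (\<lambda>(x, t). f (vmerge J x (upd z k t)))"
    unfolding split_beta by (rule PP.integrable_bounded[OF meas bound])
  from PP.Fubini_integral[OF this] 2
  show "(\<integral>x. f (vmerge (insert k J) x z) \<partial>(\<Pi>\<^sub>M j\<in>insert k J. M))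
     = (\<integral>t. (\<integral>x. f (vmerge J x (upd z k t)) \<partial>(\<Pi>\<^sub>M j\<in>J. M)) \<partial>M)" by simp
qed

end

lemma integral_vmerge_empty:
  fixes f :: "'a ^ 'n \<Rightarrow> real" and M :: "'a measure"
  shows "(\<integral>x. f (vmerge {} x z) \<partial>(\<Pi>\<^sub>M j\<in>({} :: 'n set). M)) = f z"
proof -
  have "vmerge {} x z = z" for x by (simp add: vmerge_def vec_eq_iff)
  moreover have "prob_space (\<Pi>\<^sub>M j\<in>({} :: 'n set). M)" by (rule prob_space_PiM) simp
  ultimately show ?thesis by (simp add: prob_space.prob_space)
qed

text \<open>The induction hypothesis is applied for each value of the new coordinate. Minkowski then
  moves the \<open>M\<close>-integral over that coordinate inside the \<open>N\<close>-integrals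
  over \<open>J\<close>, where \<open>slice\<close> bounds it.\<close>

lemma tensor_power_inequality:
  fixes f :: "'a::euclidean_space ^ 'n::finite \<Rightarrow> real" and M N :: "'a measure"
  assumes M: "coordinate_measures M" and N: "coordinate_measures N"
    and f [measurable]: "f \<in> borel_measurable borel" and f0: "\<And>z. 0 \<le> f z" and fK: "\<And>z. f z \<le> K"
    and m: "0 < m" and C: "0 \<le> C"
    and slice: "\<And>z k. (\<integral>t. f (upd z k t) ^ m \<partial>M) \<le> C * (\<integral>t. f (upd z k t) \<partial>N) ^ m"
  shows "(\<integral>x. f (vmerge J x z) ^ m \<partial>(\<Pi>\<^sub>M j\<in>J. M)) \<le> C ^ card J * (\<integral>x. f (vmerge J x z) \<partial>(\<Pi>\<^sub>M j\<in>J. N)) ^ m"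
proof -
  interpret M: coordinate_measures M by (rule M)
  interpret N: coordinate_measures N by (rule N)
  have K: "0 \<le> K" using f0[of undefined] fK[of undefined] by linarith
  have fb: "\<bar>f z\<bar> \<le> K" "\<bar>f z ^ m\<bar> \<le> K ^ m" for z
    using f0[of z] fK[of z] by (auto simp: power_mono)
  have fm: "(\<lambda>z. f z ^ m) \<in> borel_measurable borel" by measurable
  have "finite J" by simp
  then show ?thesis
  proof (induction J arbitrary: z)
    case empty
    show ?case using integral_vmerge_empty[where f = "\<lambda>z. f z ^ m" and M = M] integral_vmerge_empty[where f = f and M = N] by simp
  next
    case (insert k J)
    interpret NJ: prob_space "\<Pi>\<^sub>M j\<in>J. N" by (rule N.prob_space_PiM_coordinates)
    interpret MJ: prob_space "\<Pi>\<^sub>M j\<in>J. M" by (rule M.prob_space_PiM_coordinates)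
    have ms: "(\<lambda>(x, t). f (vmerge J x (upd z k t))) \<in> borel_measurable ((\<Pi>\<^sub>M j\<in>J. N) \<Otimes>\<^sub>M M)"
    proof -
      have "sets ((\<Pi>\<^sub>M j\<in>J. N) \<Otimes>\<^sub>M M) = sets ((\<Pi>\<^sub>M j\<in>J. N) \<Otimes>\<^sub>M N)"
        by (intro sets_pair_measure_cong) auto
      then show ?thesis
        using measurable_compose[OF N.vmerge_upd_measurable[of J z k] f]
        by (simp add: split_beta cong: measurable_cong_sets)
    qed
    have msN: "(\<lambda>(x, t). f (vmerge J x (upd z k t))) \<in> borel_measurable ((\<Pi>\<^sub>M j\<in>J. N) \<Otimes>\<^sub>M N)"
      using measurable_compose[OF N.vmerge_upd_measurable[of J z k] f] by (simp add: split_beta)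
    have "(\<integral>x. f (vmerge (insert k J) x z) ^ m \<partial>(\<Pi>\<^sub>M j\<in>insert k J. M))
       = (\<integral>t. (\<integral>x. f (vmerge J x (upd z k t)) ^ m \<partial>(\<Pi>\<^sub>M j\<in>J. M)) \<partial>M)"
      by (rule M.integral_vmerge_insert(1)[OF fm fb(2) insert.hyps(2)])
    also have "\<dots> \<le> (\<integral>t. C ^ card J * (\<integral>x. f (vmerge J x (upd z k t)) \<partial>(\<Pi>\<^sub>M j\<in>J. N)) ^ m \<partial>M)"
    proof (intro integral_mono insert.IH)
      note [measurable] = ms
      have [measurable]: "(\<lambda>(t, x). f (vmerge J x (upd z k t))) \<in> borel_measurable (M \<Otimes>\<^sub>M (\<Pi>\<^sub>M j\<in>J. N))"
        using measurable_pair_swap[OF ms] by simp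
      have [measurable]: "(\<lambda>(t, x). f (vmerge J x (upd z k t)) ^ m) \<in> borel_measurable (M \<Otimes>\<^sub>M (\<Pi>\<^sub>M j\<in>J. M))"
      proof -
        have "(\<lambda>(x, t). f (vmerge J x (upd z k t)) ^ m) \<in> borel_measurable ((\<Pi>\<^sub>M j\<in>J. M) \<Otimes>\<^sub>M M)"
          using measurable_compose[OF M.vmerge_upd_measurable[of J z k] fm] by (simp add: split_beta)
        from measurable_pair_swap[OF this] show ?thesis by simp
      qed
      show "integrable M (\<lambda>t. \<integral>x. f (vmerge J x (upd z k t)) ^ m \<partial>(\<Pi>\<^sub>M j\<in>J. M))"
        by (rule M.integrable_bounded[OF _ MJ.abs_integral_le[OF fb(2)]]) measurable
      show "integrable M (\<lambda>t. C ^ card J * (\<integral>x. f (vmerge J x (upd z k t)) \<partial>(\<Pi>\<^sub>M j\<in>J. N)) ^ m)"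
      proof (intro integrable_mult_right M.integrable_bounded[where K = "K ^ m"])
        show "\<bar>(\<integral>x. f (vmerge J x (upd z k t)) \<partial>(\<Pi>\<^sub>M j\<in>J. N)) ^ m\<bar> \<le> K ^ m" for t
          unfolding power_abs by (intro power_mono NJ.abs_integral_le fb(1)) auto
      qed measurable
    qed
    also have "\<dots> = C ^ card J * (\<integral>t. (\<integral>x. f (vmerge J x (upd z k t)) \<partial>(\<Pi>\<^sub>M j\<in>J. N)) ^ m \<partial>M)"
      by simp
    also have "\<dots> \<le> C ^ card J * (C * (\<integral>x. (\<integral>t. f (vmerge J x (upd z k t)) \<partial>N) \<partial>(\<Pi>\<^sub>M j\<in>J. N)) ^ m)"
    proof (intro mult_left_mono minkowski_power[where K = K])
      show "(\<lambda>x. \<integral>t. f (vmerge J x (upd z k t)) \<partial>N) \<in> borel_measurable (\<Pi>\<^sub>M j\<in>J. N)"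
        using N.borel_measurable_lebesgue_integral[OF msN] .
      show "(\<integral>t. f (vmerge J x (upd z k t)) \<partial>N) \<le> K" for x
        using N.abs_integral_le[OF fb(1), of "\<lambda>t. vmerge J x (upd z k t)"] by linarith
      show "(\<integral>t. f (vmerge J x (upd z k t)) ^ m \<partial>M) \<le> C * (\<integral>t. f (vmerge J x (upd z k t)) \<partial>N) ^ m" for x
        unfolding vmerge_upd[OF insert.hyps(2)] by (rule slice)
    qed (use ms f0 fK m C in \<open>auto intro: M.prob_space_axioms NJ.prob_space_axioms integral_nonneg_AE\<close>)
    also have "(\<integral>x. (\<integral>t. f (vmerge J x (upd z k t)) \<partial>N) \<partial>(\<Pi>\<^sub>M j\<in>J. N))
       = (\<integral>x. f (vmerge (insert k J) x z) \<partial>(\<Pi>\<^sub>M j\<in>insert k J. N))"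
      by (rule N.integral_vmerge_insert(2)[OF f fb(1) insert.hyps(2), symmetric])
    finally show ?case using insert.hyps by (simp add: mult_ac)
  qed
qed

text \<open>The coordinates are released from the value \<open>0\<close> one after the other, each
  release costing nothing by \<open>slice\<close>.\<close>

lemma tensor_submean:
  fixes v :: "'a::euclidean_space ^ 'n::finite \<Rightarrow> real" and M :: "'a measure"
  assumes M: "coordinate_measures M"
    and v [measurable]: "v \<in> borel_measurable borel" and vK: "\<And>z. \<bar>v z\<bar> \<le> K"
    and slice: "\<And>z k. v (upd z k 0) \<le> (\<integral>t. v (upd z k t) \<partial>M)"
  shows "v (vmerge J (\<lambda>_. 0) z) \<le> (\<integral>x. v (vmerge J x z) \<partial>(\<Pi>\<^sub>M j\<in>J. M))"
proof -
  interpret M: coordinate_measures M by (rule M)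
  have "finite J" by simp
  then show ?thesis
  proof (induction J arbitrary: z)
    case empty
    have "vmerge {} (\<lambda>_. 0) z = z" by (simp add: vmerge_def vec_eq_iff)
    then show ?case by (simp only: integral_vmerge_empty order_refl)
  next
    case (insert k J)
    interpret MJ: prob_space "\<Pi>\<^sub>M j\<in>J. M" by (rule M.prob_space_PiM_coordinates)
    have ms: "(\<lambda>(t, x). v (vmerge J x (upd z k t))) \<in> borel_measurable (M \<Otimes>\<^sub>M (\<Pi>\<^sub>M j\<in>J. M))"
    proof -
      have "(\<lambda>(x, t). v (vmerge J x (upd z k t))) \<in> borel_measurable ((\<Pi>\<^sub>M j\<in>J. M) \<Otimes>\<^sub>M M)"
        using measurable_compose[OF M.vmerge_upd_measurable[of J z k] v] by (simp add: split_beta)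
      from measurable_pair_swap[OF this] show ?thesis by simp
    qed
    have "vmerge (insert k J) (\<lambda>_. 0) z = vmerge J (\<lambda>_. 0) (upd z k 0)"
      using vmerge_insert[OF insert.hyps(2), of "\<lambda>_. 0" 0 z] by (simp add: fun_upd_idem)
    then have "v (vmerge (insert k J) (\<lambda>_. 0) z) = v (upd (vmerge J (\<lambda>_. 0) z) k 0)"
      by (simp add: vmerge_upd[OF insert.hyps(2)])
    also have "\<dots> \<le> (\<integral>t. v (vmerge J (\<lambda>_. 0) (upd z k t)) \<partial>M)"
      unfolding vmerge_upd[OF insert.hyps(2)] by (rule slice)
    also have "\<dots> \<le> (\<integral>t. (\<integral>x. v (vmerge J x (upd z k t)) \<partial>(\<Pi>\<^sub>M j\<in>J. M)) \<partial>M)"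
    proof (intro integral_mono insert.IH)
      have "(\<lambda>t. upd (vmerge J (\<lambda>_. 0) z) k t) \<in> borel_measurable borel"
        unfolding upd_def by (intro borel_measurable_vec_lambda) simp
      then have "(\<lambda>t. v (vmerge J (\<lambda>_. 0) (upd z k t))) \<in> borel_measurable M"
        unfolding vmerge_upd[OF insert.hyps(2)] using measurable_compose[OF _ v] by (simp cong: measurable_cong_sets)
      then show "integrable M (\<lambda>t. v (vmerge J (\<lambda>_. 0) (upd z k t)))"
        by (rule M.integrable_bounded[OF _ vK])
      show "integrable M (\<lambda>t. \<integral>x. v (vmerge J x (upd z k t)) \<partial>(\<Pi>\<^sub>M j\<in>J. M))"
        by (rule M.integrable_bounded[OF MJ.borel_measurable_lebesgue_integral[OF ms] MJ.abs_integral_le[OF vK]])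
    qed
    also have "\<dots> = (\<integral>x. v (vmerge (insert k J) x z) \<partial>(\<Pi>\<^sub>M j\<in>insert k J. M))"
      by (rule M.integral_vmerge_insert(1)[OF v vK insert.hyps(2), symmetric])
    finally show ?case .
  qed
qed

section \<open>Pluriharmonic functions as sums of holomorphic and antiholomorphic functions\<close>

text \<open>The complex structure as a real linear map: it expresses complex linearity of a real
  derivative by commutation.\<close>

definition Jmul :: "complex ^ 'n \<Rightarrow> complex ^ 'n" where
  "Jmul z = (\<chi> k. \<i> * z $ k)"

lemma Jmul_linear: "linear Jmul"
  by (rule linearI) (simp_all add: Jmul_def vec_eq_iff algebra_simps)

lemma Jmul_Jmul: "Jmul (Jmul z) = - z"
  by (simp add: Jmul_def vec_eq_iff)

lemma Jmul_axis: "Jmul (axis k 1) = axis k \<i>" "Jmul (axis k \<i>) = - axis k 1"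
  by (simp_all add: Jmul_def axis_def vec_eq_iff)

lemma Jmul_zero [simp]: "Jmul 0 = 0"
  by (simp add: Jmul_def vec_eq_iff)

lemma open_polydisc: "open (polydisc :: (complex ^ 'n::finite) set)"
proof -
  have eq: "polydisc = (\<Inter>k\<in>UNIV. {z :: complex ^ 'n. norm (z $ k) < 1})"
    by (auto simp: polydisc_def)
  show ?thesis
    unfolding eq by (intro open_INT ballI open_Collect_less continuous_intros) simp
qed

lemma scale_in_polydisc: "z \<in> polydisc \<Longrightarrow> 0 \<le> t \<Longrightarrow> t \<le> 1 \<Longrightarrow> t *\<^sub>R z \<in> polydisc"
  by (auto simp: polydisc_def intro: le_less_trans[OF mult_right_mono[of t 1]])

lemma convex_polydisc: "convex (polydisc :: (complex ^ 'n) set)"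
proof -
  have eq: "polydisc = (\<Inter>k. (\<lambda>z :: complex ^ 'n. z $ k) -` ball 0 1)"
    by (auto simp: polydisc_def)
  have "convex ((\<lambda>z :: complex ^ 'n. z $ k) -` ball 0 1)" for k
    by (intro convex_linear_vimage linearI) auto
  then show ?thesis unfolding eq by (intro convex_INT)
qed

text \<open>The mean value theorem is applied twice: along \<open>u\<close> to the increment in
  direction \<open>v\<close>, then along \<open>v\<close> to the derivative in direction
  \<open>u\<close>.\<close>

lemma second_difference:
  fixes F :: "'a::real_normed_vector \<Rightarrow> real"
  assumes h: "0 < h"
    and F: "\<And>s t. 0 \<le> s \<Longrightarrow> s \<le> h \<Longrightarrow> 0 \<le> t \<Longrightarrow> t \<le> h \<Longrightarrow> (F has_derivative F' (z + s *\<^sub>R u + t *\<^sub>R v)) (at (z + s *\<^sub>R u + t *\<^sub>R v))"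
    and G: "\<And>s t. 0 \<le> s \<Longrightarrow> s \<le> h \<Longrightarrow> 0 \<le> t \<Longrightarrow> t \<le> h \<Longrightarrow>
       ((\<lambda>w. F' w u) has_derivative G (z + s *\<^sub>R u + t *\<^sub>R v)) (at (z + s *\<^sub>R u + t *\<^sub>R v))"
  obtains s t where "0 < s" "s < h" "0 < t" "t < h"
    "F (z + h *\<^sub>R u + h *\<^sub>R v) - F (z + h *\<^sub>R u) - F (z + h *\<^sub>R v) + F z = h * (h * G (z + s *\<^sub>R u + t *\<^sub>R v) v)"
proof -
  define \<phi> where "\<phi> s = F (z + s *\<^sub>R u + h *\<^sub>R v) - F (z + s *\<^sub>R u + 0 *\<^sub>R v)" for s
  have d1: "((\<lambda>s. F (z + s *\<^sub>R u + t *\<^sub>R v)) has_real_derivative F' (z + s *\<^sub>R u + t *\<^sub>R v) u) (at s)"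
    if "0 \<le> s" "s \<le> h" "0 \<le> t" "t \<le> h" for s t
  proof -
    have "((\<lambda>s. z + s *\<^sub>R u + t *\<^sub>R v) has_derivative (\<lambda>d. d *\<^sub>R u)) (at s)"
      by (auto intro!: derivative_eq_intros)
    from has_derivative_compose[OF this F[OF that]]
    have "((\<lambda>s. F (z + s *\<^sub>R u + t *\<^sub>R v)) has_derivative (\<lambda>d. F' (z + s *\<^sub>R u + t *\<^sub>R v) (d *\<^sub>R u))) (at s)" .
    moreover have "F' (z + s *\<^sub>R u + t *\<^sub>R v) (d *\<^sub>R u) = F' (z + s *\<^sub>R u + t *\<^sub>R v) u * d" for d
      using linear_cmul[OF has_derivative_linear[OF F[OF that]]] by (simp add: mult.commute)
    ultimately show ?thesis by (simp add: has_field_derivative_def)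
  qed
  have d2: "((\<lambda>t. F' (z + s *\<^sub>R u + t *\<^sub>R v) u) has_real_derivative G (z + s *\<^sub>R u + t *\<^sub>R v) v) (at t)"
    if "0 \<le> s" "s \<le> h" "0 \<le> t" "t \<le> h" for s t
  proof -
    have "((\<lambda>t. z + s *\<^sub>R u + t *\<^sub>R v) has_derivative (\<lambda>d. d *\<^sub>R v)) (at t)"
      by (auto intro!: derivative_eq_intros)
    from has_derivative_compose[OF this G[OF that]]
    have "((\<lambda>t. F' (z + s *\<^sub>R u + t *\<^sub>R v) u) has_derivative (\<lambda>d. G (z + s *\<^sub>R u + t *\<^sub>R v) (d *\<^sub>R v))) (at t)" .
    moreover have "G (z + s *\<^sub>R u + t *\<^sub>R v) (d *\<^sub>R v) = G (z + s *\<^sub>R u + t *\<^sub>R v) v * d" for d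
      using linear_cmul[OF has_derivative_linear[OF G[OF that]]] by (simp add: mult.commute)
    ultimately show ?thesis by (simp add: has_field_derivative_def)
  qed
  have "\<exists>s. 0 < s \<and> s < h \<and> \<phi> h - \<phi> 0 = (h - 0) * (F' (z + s *\<^sub>R u + h *\<^sub>R v) u - F' (z + s *\<^sub>R u + 0 *\<^sub>R v) u)"
  proof (rule MVT2[OF h])
    fix s assume "0 \<le> s" "s \<le> h"
    then show "(\<phi> has_real_derivative F' (z + s *\<^sub>R u + h *\<^sub>R v) u - F' (z + s *\<^sub>R u + 0 *\<^sub>R v) u) (at s)"
      unfolding \<phi>_def using h by (intro DERIV_diff d1) auto
  qed
  then obtain s where s: "0 < s" "s < h"
    "\<phi> h - \<phi> 0 = h * (F' (z + s *\<^sub>R u + h *\<^sub>R v) u - F' (z + s *\<^sub>R u + 0 *\<^sub>R v) u)" by auto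
  have "\<exists>t. 0 < t \<and> t < h \<and> F' (z + s *\<^sub>R u + h *\<^sub>R v) u - F' (z + s *\<^sub>R u + 0 *\<^sub>R v) u = (h - 0) * G (z + s *\<^sub>R u + t *\<^sub>R v) v"
    by (rule MVT2[OF h]) (use s in \<open>intro d2, auto\<close>)
  then obtain t where t: "0 < t" "t < h"
    "F' (z + s *\<^sub>R u + h *\<^sub>R v) u - F' (z + s *\<^sub>R u + 0 *\<^sub>R v) u = h * G (z + s *\<^sub>R u + t *\<^sub>R v) v" by auto
  show thesis
    by (rule that[OF s(1,2) t(1,2)]) (use s(3) t(3) in \<open>simp add: \<phi>_def\<close>)
qed

text \<open>The second difference is symmetric in \<open>u\<close> and \<open>v\<close>, so its two
  mean value forms coincide at points close to \<open>z\<close>; continuity then excludes different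
  values at \<open>z\<close>.\<close>

lemma second_derivative_symmetric_real:
  fixes F :: "'a::real_normed_vector \<Rightarrow> real"
  assumes S: "open S" "z \<in> S"
    and F: "\<And>w. w \<in> S \<Longrightarrow> (F has_derivative F' w) (at w)"
    and G: "\<And>w. w \<in> S \<Longrightarrow> ((\<lambda>w. F' w u) has_derivative Gu w) (at w)"
      "\<And>w. w \<in> S \<Longrightarrow> ((\<lambda>w. F' w v) has_derivative Gv w) (at w)"
    and c: "continuous_on S (\<lambda>w. Gu w v)" "continuous_on S (\<lambda>w. Gv w u)"
  shows "Gu z v = Gv z u"
proof (rule ccontr)
  assume ne: "Gu z v \<noteq> Gv z u"
  define e where "e = \<bar>Gu z v - Gv z u\<bar> / 2"
  have e: "e > 0" using ne by (simp add: e_def)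
  have "isCont (\<lambda>w. Gu w v) z" "isCont (\<lambda>w. Gv w u) z"
    using c S by (simp_all add: continuous_on_eq_continuous_at)
  then obtain d1 d2 where d: "d1 > 0" "\<And>w. dist w z < d1 \<Longrightarrow> dist (Gu w v) (Gu z v) < e"
      "d2 > 0" "\<And>w. dist w z < d2 \<Longrightarrow> dist (Gv w u) (Gv z u) < e"
    unfolding continuous_at_eps_delta using e by metis
  obtain d3 where d3: "d3 > 0" "ball z d3 \<subseteq> S" using S by (auto simp: open_contains_ball)
  define \<delta> where "\<delta> = min d1 (min d2 d3)"
  have \<delta>: "\<delta> > 0" using d d3 by (simp add: \<delta>_def)
  \<comment> \<open>With this size the whole parallelogram spanned by \<open>h *\<^sub>R u\<close>
    and \<open>h *\<^sub>R v\<close> stays within \<open>\<delta>\<close> of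
    \<open>z\<close>.\<close>
  define h where "h = \<delta> / (2 * (norm u + norm v + 1))"
  have nuv: "norm u + norm v + 1 > 0" by (simp add: add_nonneg_pos)
  then have h: "h > 0" using \<delta> by (simp add: h_def)
  have close: "dist (z + s *\<^sub>R u + t *\<^sub>R v) z < \<delta>" if "0 \<le> s" "s \<le> h" "0 \<le> t" "t \<le> h" for s t
  proof -
    have "norm (s *\<^sub>R u + t *\<^sub>R v) \<le> s * norm u + t * norm v"
      using that by (intro order_trans[OF norm_triangle_ineq]) simp
    also have "\<dots> \<le> h * norm u + h * norm v"
      using that by (intro add_mono mult_right_mono) auto
    also have "\<dots> < h * (2 * (norm u + norm v + 1))"
      using h by (simp add: algebra_simps add_strict_increasing2 add_nonneg_pos add_pos_nonneg)
    also have "\<dots> = \<delta>" using nuv by (simp add: h_def)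
    finally show ?thesis by (simp add: dist_norm add.assoc)
  qed
  then have inS: "z + s *\<^sub>R u + t *\<^sub>R v \<in> S" if "0 \<le> s" "s \<le> h" "0 \<le> t" "t \<le> h" for s t
    using that d3(2) by (force simp: \<delta>_def dist_commute)
  have inS': "z + s *\<^sub>R v + t *\<^sub>R u \<in> S" if "0 \<le> s" "s \<le> h" "0 \<le> t" "t \<le> h" for s t
    using inS[of t s] that by (simp add: add_ac)
  obtain s t where st: "0 < s" "s < h" "0 < t" "t < h"
    "F (z + h *\<^sub>R u + h *\<^sub>R v) - F (z + h *\<^sub>R u) - F (z + h *\<^sub>R v) + F z = h * (h * Gu (z + s *\<^sub>R u + t *\<^sub>R v) v)"
    by (rule second_difference[OF h, of F F' z u v Gu]) (auto intro: F G(1) inS)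
  obtain s' t' where st': "0 < s'" "s' < h" "0 < t'" "t' < h"
    "F (z + h *\<^sub>R v + h *\<^sub>R u) - F (z + h *\<^sub>R v) - F (z + h *\<^sub>R u) + F z = h * (h * Gv (z + s' *\<^sub>R v + t' *\<^sub>R u) u)"
    by (rule second_difference[OF h, of F F' z v u Gv]) (auto intro: F G(2) inS')
  have "h * (h * Gu (z + s *\<^sub>R u + t *\<^sub>R v) v) = h * (h * Gv (z + s' *\<^sub>R v + t' *\<^sub>R u) u)"
    using st(5) st'(5) unfolding add.assoc add.commute[of "h *\<^sub>R v" "h *\<^sub>R u"] by linarith
  then have eq: "Gu (z + s *\<^sub>R u + t *\<^sub>R v) v = Gv (z + s' *\<^sub>R v + t' *\<^sub>R u) u" using h by simp
  have "dist (z + s *\<^sub>R u + t *\<^sub>R v) z < \<delta>" "dist (z + s' *\<^sub>R v + t' *\<^sub>R u) z < \<delta>"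
    using close[of s t] close[of t' s'] st st' by (simp_all add: add_ac)
  then have "dist (Gu (z + s *\<^sub>R u + t *\<^sub>R v) v) (Gu z v) < e" "dist (Gv (z + s' *\<^sub>R v + t' *\<^sub>R u) u) (Gv z u) < e"
    using d by (auto simp: \<delta>_def)
  then show False using eq by (auto simp: e_def dist_real_def abs_if split: if_splits)
qed

locale C2_function =
  fixes f :: "complex ^ 'n::finite \<Rightarrow> complex" and S :: "(complex ^ 'n) set"
  assumes C2: "C2_on S f" and open_S: "open S"
begin

definition D1 :: "complex ^ 'n \<Rightarrow> complex ^ 'n \<Rightarrow> complex" where
  "D1 z v = frechet_derivative f (at z) v"

text \<open>\<open>v\<close> is the direction of the first derivative, \<open>u\<close> that of the
  second. The order of arguments follows \<open>C2_on\<close>, which differentiates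
  \<open>D1\<close> for a fixed direction.\<close>

definition D2 :: "complex ^ 'n \<Rightarrow> complex ^ 'n \<Rightarrow> complex ^ 'n \<Rightarrow> complex" where
  "D2 v z u = frechet_derivative (\<lambda>z. D1 z v) (at z) u"

lemma has_derivative_D1: "z \<in> S \<Longrightarrow> (f has_derivative D1 z) (at z)"
  using C2 unfolding C2_on_def C1_on_def D1_def
  by (metis (mono_tags) frechet_derivative_works eta_contract_eq)

lemma continuous_D1: "continuous_on S (\<lambda>z. D1 z v)"
  using C2 unfolding C2_on_def C1_on_def D1_def by blast

lemma has_derivative_D2: "z \<in> S \<Longrightarrow> ((\<lambda>z. D1 z v) has_derivative D2 v z) (at z)"
  using C2 unfolding C2_on_def C1_on_def D2_def D1_def
  by (metis (mono_tags) frechet_derivative_works)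

lemma continuous_D2: "continuous_on S (\<lambda>z. D2 v z u)"
  using C2 unfolding C2_on_def C1_on_def D2_def D1_def by blast

lemma linear_D1: "z \<in> S \<Longrightarrow> linear (D1 z)"
  using has_derivative_D1 by (rule has_derivative_linear)

lemma linear_D2: "z \<in> S \<Longrightarrow> linear (D2 v z)"
  using has_derivative_D2 by (rule has_derivative_linear)

lemma D2_symmetric:
  assumes z: "z \<in> S"
  shows "D2 u z v = D2 v z u"
proof (rule complex_eqI)
  show "Re (D2 u z v) = Re (D2 v z u)"
    by (rule second_derivative_symmetric_real[OF open_S z, of "\<lambda>z. Re (f z)" "\<lambda>z v. Re (D1 z v)" u "\<lambda>z v. Re (D2 u z v)" v "\<lambda>z u. Re (D2 v z u)"])
       (auto intro!: derivative_intros has_derivative_D1 has_derivative_D2 continuous_intros continuous_D2)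
  show "Im (D2 u z v) = Im (D2 v z u)"
    by (rule second_derivative_symmetric_real[OF open_S z, of "\<lambda>z. Im (f z)" "\<lambda>z v. Im (D1 z v)" u "\<lambda>z v. Im (D2 u z v)" v "\<lambda>z u. Im (D2 v z u)"])
       (auto intro!: derivative_intros has_derivative_D1 has_derivative_D2 continuous_intros continuous_D2)
qed

lemma bilinear_D2:
  assumes z: "z \<in> S"
  shows "bilinear (\<lambda>u v. D2 u z v)"
  unfolding bilinear_def
proof (intro conjI allI)
  show "linear (\<lambda>v. D2 u z v)" for u by (rule linear_D2[OF z])
  show "linear (\<lambda>u. D2 u z v)" for v
    using linear_D2[OF z, of v] by (simp add: D2_symmetric[OF z, of _ v])
qed

end

text \<open>This symmetry is the closedness of the form that \<open>conjugate_function\<close>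
  integrates. Both sides are bilinear, so it is checked on basis vectors.\<close>

lemma (in C2_function) D2_Jmul:
  assumes ph: "\<And>j k. d_z j (d_zbar k f) z = 0" and z: "z \<in> S"
  shows "D2 (Jmul u) z v = D2 (Jmul v) z u"
proof -
  define B where "B u v = D2 u z v" for u v
  have bB: "bilinear B" unfolding B_def by (rule bilinear_D2[OF z])
  have sym: "B u v = B v u" for u v unfolding B_def by (rule D2_symmetric[OF z])
  have mixed: "B (axis k 1) (axis j 1) + B (axis k \<i>) (axis j \<i>) + \<i> * (B (axis k \<i>) (axis j 1) - B (axis k 1) (axis j \<i>)) = 0" for j k
  proof -
    have "((\<lambda>z. d_zbar k f z) has_derivative (\<lambda>u. (D2 (axis k 1) z u + \<i> * D2 (axis k \<i>) z u) / 2)) (at z)"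
      unfolding d_zbar_def D1_def[symmetric]
      by (rule derivative_eq_intros has_derivative_D2[OF z] refl | simp)+
    then have "frechet_derivative (d_zbar k f) (at z) = (\<lambda>u. (B (axis k 1) u + \<i> * B (axis k \<i>) u) / 2)"
      unfolding B_def by (rule frechet_derivative_at[symmetric])
    then show ?thesis using ph[where j = j and k = k] by (simp add: d_z_def algebra_simps add_divide_distrib)
  qed
  \<comment> \<open>\<open>B\<close> is complex valued, so \<open>mixed\<close> cannot be split by
    taking real parts. Exchanging \<open>j\<close> and \<open>k\<close> keeps its first bracket and
    changes the sign of the second, which separates them.\<close>
  have QR: "B (axis k 1) (axis j 1) + B (axis k \<i>) (axis j \<i>) = 0" "B (axis k \<i>) (axis j 1) = B (axis k 1) (axis j \<i>)" for j k
  proof -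
    note m1 = mixed[where j = k and k = j] and m2 = mixed[where j = j and k = k]
    have m2': "B (axis k 1) (axis j 1) + B (axis k \<i>) (axis j \<i>) - \<i> * (B (axis k \<i>) (axis j 1) - B (axis k 1) (axis j \<i>)) = 0"
      using m1 by (simp add: sym[of "axis j _"] algebra_simps)
    from m2 m2' have "2 * (B (axis k 1) (axis j 1) + B (axis k \<i>) (axis j \<i>)) = 0" by algebra
    then show 1: "B (axis k 1) (axis j 1) + B (axis k \<i>) (axis j \<i>) = 0"
      by (simp only: mult_eq_0_iff) simp
    from m2 1 show "B (axis k \<i>) (axis j 1) = B (axis k 1) (axis j \<i>)" by simp
  qed
  have lin: "linear (\<lambda>u. B u v)" "linear (B v)" for v using bB by (auto simp: bilinear_def)
  have "(\<lambda>u v. B (Jmul u) v) = (\<lambda>u v. B (Jmul v) u)"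
  proof (rule bilinear_eq_stdbasis)
    show "bilinear (\<lambda>u v. B (Jmul u) v)" "bilinear (\<lambda>u v. B (Jmul v) u)"
      using lin linear_compose[OF Jmul_linear lin(1), unfolded o_def] by (auto simp: bilinear_def)
    fix a b :: "complex ^ 'n" assume "a \<in> Basis" "b \<in> Basis"
    then obtain k j where a: "a = axis k 1 \<or> a = axis k \<i>" and b: "b = axis j 1 \<or> b = axis j \<i>"
      by (auto simp: Basis_vec_def Basis_complex_def)
    have neg: "B (- x) y = - B x y" "B x (- y) = - B x y" for x y
      using linear_neg[OF lin(1)] linear_neg[OF lin(2)] by auto
    have q: "B (axis k \<i>) (axis j \<i>) = - B (axis k 1) (axis j 1)" using QR(1)[of k j] by (simp add: eq_neg_iff_add_eq_0 add.commute)
    show "B (Jmul a) b = B (Jmul b) a"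
      using a b QR(2)[of k j] q sym by (elim disjE) (simp_all add: Jmul_axis neg)
  qed
  then show ?thesis unfolding B_def by (meson fun_cong)
qed

text \<open>Pluriharmonicity makes the form \<open>v \<mapsto> D1 z (Jmul v)\<close> closed; its primitive is the integral along the
  ray from \<open>0\<close>.\<close>

lemma (in C2_function) conjugate_function:
  assumes S: "S = polydisc" and ph: "\<And>j k z. z \<in> S \<Longrightarrow> d_z j (d_zbar k f) z = 0"
  obtains K where "K 0 = 0" "\<And>z. z \<in> S \<Longrightarrow> (K has_derivative (\<lambda>v. D1 z (Jmul v))) (at z)"
proof -
  \<comment> \<open>The integrand \<open>D1 (t *\<^sub>R z) (Jmul z)\<close>, expanded in the basis
    because second derivatives are given for fixed first directions only.\<close>
  define F where "F z t = (\<Sum>b\<in>Basis. (Jmul z \<bullet> b) *\<^sub>R D1 (t *\<^sub>R z) b)" for z and t :: real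
  define fx where "fx z t v = (\<Sum>b\<in>Basis. (Jmul v \<bullet> b) *\<^sub>R D1 (t *\<^sub>R z) b + (Jmul z \<bullet> b) *\<^sub>R D2 b (t *\<^sub>R z) (t *\<^sub>R v))" for z v and t :: real
  have inS: "t *\<^sub>R z \<in> S" if "z \<in> S" "t \<in> {0..1}" for z t
    using that unfolding S by (auto intro: scale_in_polydisc)
  have blJ: "bounded_linear (Jmul :: complex ^ 'n \<Rightarrow> complex ^ 'n)"
    using Jmul_linear by (simp add: linear_conv_bounded_linear)
  have Fder: "((\<lambda>z. F z t) has_derivative fx z t) (at z)" if "z \<in> S" "t \<in> {0..1}" for z t
  proof -
    have "((\<lambda>z. t *\<^sub>R z) has_derivative (\<lambda>v. t *\<^sub>R v)) (at z)"
      by (auto intro!: derivative_eq_intros)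
    from has_derivative_compose[OF this has_derivative_D2[OF inS[OF that]]]
    have d: "((\<lambda>z. D1 (t *\<^sub>R z) b) has_derivative (\<lambda>v. D2 b (t *\<^sub>R z) (t *\<^sub>R v))) (at z)" for b .
    have dJ: "((\<lambda>z. Jmul z \<bullet> b) has_derivative (\<lambda>v. Jmul v \<bullet> b)) (at z)" for b
      by (intro has_derivative_inner_left bounded_linear_imp_has_derivative[OF blJ])
    show ?thesis
      unfolding F_def fx_def[abs_def]
      by (intro has_derivative_sum) (auto intro!: derivative_eq_intros d dJ bounded_linear_imp_has_derivative[OF blJ] simp: add.commute)
  qed
  have bl: "bounded_linear (fx z t)" if "z \<in> S" "t \<in> {0..1}" for z t
    using Fder[OF that] by (rule has_derivative_bounded_linear)
  define FX where "FX z t = Blinfun (fx z t)" for z t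
  have FX: "blinfun_apply (FX z t) = fx z t" if "z \<in> S" "t \<in> {0..1}" for z t
    unfolding FX_def by (rule bounded_linear_Blinfun_apply[OF bl[OF that]])
  have cscale: "continuous_on (S \<times> {0..1}) (\<lambda>w. \<phi> (snd w *\<^sub>R fst w))" if "continuous_on S \<phi>"
    for \<phi> :: "complex ^ 'n \<Rightarrow> complex"
    by (rule continuous_on_compose2[OF that]) (use inS in \<open>auto intro!: continuous_intros\<close>)
  have contFX: "continuous_on (S \<times> cbox 0 1) (\<lambda>(z, t). FX z t)"
  proof (rule continuous_on_blinfun_componentwise)
    fix v :: "complex ^ 'n"
    have "continuous_on (S \<times> {0..1}) (\<lambda>w. fx (fst w) (snd w) v)"
    proof -
      have D2s: "D2 b (snd w *\<^sub>R fst w) (snd w *\<^sub>R v) = snd w *\<^sub>R D2 b (snd w *\<^sub>R fst w) v" if "w \<in> S \<times> {0..1}" for w b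
        using that linear_cmul[OF linear_D2[OF inS]] by (auto simp: mem_Times_iff)
      have cJ: "continuous_on A Jmul" for A :: "(complex ^ 'n) set"
        by (rule linear_continuous_on[OF blJ])
      have "continuous_on (S \<times> {0..1}) (\<lambda>w. \<Sum>b\<in>Basis. (Jmul v \<bullet> b) *\<^sub>R D1 (snd w *\<^sub>R fst w) b
           + (Jmul (fst w) \<bullet> b) *\<^sub>R (snd w *\<^sub>R D2 b (snd w *\<^sub>R fst w) v))"
        by (intro continuous_intros cscale continuous_D1 continuous_D2 continuous_on_compose2[OF cJ[of UNIV]]) auto
      then show ?thesis
        unfolding fx_def by (rule continuous_on_eq) (simp add: D2s)
    qed
    then show "continuous_on (S \<times> cbox 0 1) (\<lambda>w. blinfun_apply (case w of (z, t) \<Rightarrow> FX z t) v)"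
      unfolding cbox_interval by (rule continuous_on_eq) (auto simp: FX)
  qed
  have Fint: "F z integrable_on cbox 0 1" if "z \<in> S" for z
  proof -
    have "continuous_on {0..1} (\<lambda>t. D1 (t *\<^sub>R z) b)" for b
      by (rule continuous_on_compose2[OF continuous_D1]) (use inS that in \<open>auto intro!: continuous_intros\<close>)
    then show ?thesis
      unfolding F_def cbox_interval by (intro integrable_continuous_real continuous_intros) auto
  qed
  define K where "K z = integral (cbox 0 1) (F z)" for z
  have conv: "convex S" unfolding S by (rule convex_polydisc)
  have Kder: "(K has_derivative (\<lambda>v. D1 z (Jmul v))) (at z)" if z: "z \<in> S" for z
  proof -
    have "(K has_derivative blinfun_apply (integral (cbox 0 1) (FX z))) (at z within S)"
      unfolding K_def
      by (rule leibniz_rule[OF _ Fint contFX z conv])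
         (use FX Fder in \<open>auto intro: has_derivative_at_withinI\<close>)
    then have 1: "(K has_derivative blinfun_apply (integral (cbox 0 1) (FX z))) (at z)"
      using at_within_open[OF z open_S] by simp
    have "blinfun_apply (integral (cbox 0 1) (FX z)) = (\<lambda>v. D1 z (Jmul v))"
    proof
      fix v
      have iFX: "FX z integrable_on cbox 0 1"
      proof (rule integrable_continuous)
        have "continuous_on (cbox 0 1) (\<lambda>t. case (z, t) of (z, t) \<Rightarrow> FX z t)"
          by (rule continuous_on_compose2[OF contFX]) (use z in \<open>auto intro!: continuous_intros\<close>)
        then show "continuous_on (cbox 0 1) (FX z)" by simp
      qed
      have "blinfun_apply (integral (cbox 0 1) (FX z)) v = integral (cbox 0 1) (\<lambda>t. blinfun_apply (FX z t) v)"
        by (rule blinfun_apply_integral[OF iFX])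
      also have "\<dots> = integral {0..1} (\<lambda>t. D1 (t *\<^sub>R z) (Jmul v) + t *\<^sub>R D2 (Jmul v) (t *\<^sub>R z) z)"
      proof (unfold cbox_interval, rule integral_cong)
        fix t :: real assume t: "t \<in> {0..1}"
        note tz = inS[OF z t]
        have e1: "(\<Sum>b\<in>Basis. (x \<bullet> b) *\<^sub>R L b) = L x" if "linear L" for L :: "complex ^ 'n \<Rightarrow> complex" and x
          using linear_sum[OF that, of "\<lambda>b. (x \<bullet> b) *\<^sub>R b" Basis] linear_cmul[OF that]
          by (simp add: euclidean_representation)
        have "fx z t v = D1 (t *\<^sub>R z) (Jmul v) + (\<Sum>b\<in>Basis. (Jmul z \<bullet> b) *\<^sub>R D2 b (t *\<^sub>R z) (t *\<^sub>R v))"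
          unfolding fx_def sum.distrib using e1[OF linear_D1[OF tz]] by simp
        also have "(\<Sum>b\<in>Basis. (Jmul z \<bullet> b) *\<^sub>R D2 b (t *\<^sub>R z) (t *\<^sub>R v)) = D2 (Jmul z) (t *\<^sub>R z) (t *\<^sub>R v)"
          by (rule e1) (use bilinear_D2[OF tz] in \<open>simp add: bilinear_def\<close>)
        also have "\<dots> = t *\<^sub>R D2 (Jmul z) (t *\<^sub>R z) v"
          using linear_cmul[OF linear_D2[OF tz]] .
        \<comment> \<open>Closedness enters here: it makes the integrand the derivative in
          \<open>t\<close> of \<open>t *\<^sub>R D1 (t *\<^sub>R z) (Jmul v)\<close>.\<close>
        also have "D2 (Jmul z) (t *\<^sub>R z) v = D2 (Jmul v) (t *\<^sub>R z) z"
          by (rule D2_Jmul[OF ph[OF tz] tz])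
        finally show "blinfun_apply (FX z t) v = D1 (t *\<^sub>R z) (Jmul v) + t *\<^sub>R D2 (Jmul v) (t *\<^sub>R z) z"
          using FX[OF z t] by simp
      qed
      also have "\<dots> = 1 *\<^sub>R D1 (1 *\<^sub>R z) (Jmul v) - 0 *\<^sub>R D1 (0 *\<^sub>R z) (Jmul v)"
      proof (rule integral_unique, rule fundamental_theorem_of_calculus)
        fix t :: real assume t: "t \<in> {0..1}"
        note tz = inS[OF z t]
        have "((\<lambda>t. t *\<^sub>R z) has_derivative (\<lambda>d. d *\<^sub>R z)) (at t within {0..1})"
          by (auto intro!: derivative_eq_intros)
        from has_derivative_compose[OF this has_derivative_D2[OF tz]]
        have d: "((\<lambda>t. D1 (t *\<^sub>R z) (Jmul v)) has_derivative (\<lambda>d. D2 (Jmul v) (t *\<^sub>R z) (d *\<^sub>R z))) (at t within {0..1})" .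
        have "D2 (Jmul v) (t *\<^sub>R z) (d *\<^sub>R z) = d *\<^sub>R D2 (Jmul v) (t *\<^sub>R z) z" for d
          using linear_cmul[OF linear_D2[OF tz]] .
        with d show "((\<lambda>t. t *\<^sub>R D1 (t *\<^sub>R z) (Jmul v)) has_vector_derivative
            D1 (t *\<^sub>R z) (Jmul v) + t *\<^sub>R D2 (Jmul v) (t *\<^sub>R z) z) (at t within {0..1})"
          unfolding has_vector_derivative_def
          by (auto intro!: derivative_eq_intros simp: scaleR_add_right scaleR_left_commute add.commute)
      qed simp
      finally show "blinfun_apply (integral (cbox 0 1) (FX z)) v = D1 z (Jmul v)" by simp
    qed
    with 1 show ?thesis by simp
  qed
  have "F 0 = (\<lambda>_. 0)" by (simp add: F_def fun_eq_iff)
  then have "K 0 = 0" by (simp add: K_def)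
  with Kder show thesis using that by blast
qed

definition complex_differentiable_on :: "(complex ^ 'n::finite) set \<Rightarrow> (complex ^ 'n \<Rightarrow> complex) \<Rightarrow> bool" where
  "complex_differentiable_on S g \<longleftrightarrow> (\<forall>z\<in>S. \<exists>g'. (g has_derivative g') (at z) \<and> (\<forall>v. g' (Jmul v) = \<i> * g' v))"

text \<open>The differential of \<open>K\<close> is that of \<open>f\<close> composed with
  \<open>Jmul\<close>, so \<open>f - \<i> * K\<close> has a complex linear differential and
  \<open>f + \<i> * K\<close> an antilinear one. The value \<open>f 0\<close> is shifted into
  \<open>g\<close> to make \<open>h\<close> vanish at \<open>0\<close>.\<close>

lemma pluriharmonic_decomposition:
  fixes f :: "complex ^ 'n::finite \<Rightarrow> complex"
  assumes "pluriharmonic_on polydisc f"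
  obtains g h where "complex_differentiable_on polydisc g" "complex_differentiable_on polydisc h"
    "\<And>z. z \<in> polydisc \<Longrightarrow> f z = g z + cnj (h z)" "h 0 = 0"
proof -
  interpret C2_function f polydisc
    using assms open_polydisc by unfold_locales (simp_all add: pluriharmonic_on_def)
  obtain K where K: "K 0 = 0" "\<And>z. z \<in> polydisc \<Longrightarrow> (K has_derivative (\<lambda>v. D1 z (Jmul v))) (at z)"
    using conjugate_function[OF refl] assms by (auto simp: pluriharmonic_on_def)
  define g where "g z = (f z + f 0 - \<i> * K z) / 2" for z
  define h where "h z = cnj ((f z - f 0 + \<i> * K z) / 2)" for z
  show thesis
  proof (rule that[of g h])
    show "complex_differentiable_on polydisc g"
      unfolding complex_differentiable_on_def
    proof (intro ballI exI conjI allI)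
      fix z :: "complex ^ 'n" assume z: "z \<in> polydisc"
      show "(g has_derivative (\<lambda>v. (D1 z v - \<i> * D1 z (Jmul v)) / 2)) (at z)"
        unfolding g_def by (rule derivative_eq_intros has_derivative_D1[OF z] K(2)[OF z] refl | simp)+
      fix v show "(D1 z (Jmul v) - \<i> * D1 z (Jmul (Jmul v))) / 2 = \<i> * ((D1 z v - \<i> * D1 z (Jmul v)) / 2)"
        using linear_neg[OF linear_D1[OF z]] by (simp add: Jmul_Jmul algebra_simps)
    qed
    show "complex_differentiable_on polydisc h"
      unfolding complex_differentiable_on_def
    proof (intro ballI exI conjI allI)
      fix z :: "complex ^ 'n" assume z: "z \<in> polydisc"
      show "(h has_derivative (\<lambda>v. cnj ((D1 z v + \<i> * D1 z (Jmul v)) / 2))) (at z)"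
        unfolding h_def by (rule has_derivative_cnj derivative_eq_intros has_derivative_D1[OF z] K(2)[OF z] refl | simp)+
      fix v show "cnj ((D1 z (Jmul v) + \<i> * D1 z (Jmul (Jmul v))) / 2) = \<i> * cnj ((D1 z v + \<i> * D1 z (Jmul v)) / 2)"
        using linear_neg[OF linear_D1[OF z]] by (simp add: Jmul_Jmul algebra_simps)
    qed
    show "f z = g z + cnj (h z)" for z by (simp add: g_def h_def field_simps)
    show "h 0 = 0" by (simp add: h_def K)
  qed
qed

section \<open>Product form of the measures\<close>

definition vec_measure :: "'a::euclidean_space measure \<Rightarrow> ('a ^ 'n::finite) measure" where
  "vec_measure M = distr (\<Pi>\<^sub>M k\<in>UNIV. M) borel (\<lambda>x. \<chi> k. x k)"

lemma sets_vec_measure [measurable_cong, simp]: "sets (vec_measure M) = sets borel"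
  by (simp add: vec_measure_def)

lemma vec_lambda_measurable_PiM:
  assumes "sets M = sets borel"
  shows "(\<lambda>x. \<chi> k::'n::finite. x k) \<in> borel_measurable (\<Pi>\<^sub>M k\<in>UNIV. M :: 'a::euclidean_space measure)"
proof (rule borel_measurable_vec_lambda)
  fix k :: 'n
  have "(\<lambda>x. x k) \<in> measurable (\<Pi>\<^sub>M k\<in>UNIV. M) M" by (rule measurable_component_singleton) simp
  then show "(\<lambda>x. x k) \<in> borel_measurable (\<Pi>\<^sub>M k\<in>UNIV. M)"
    using assms by (simp cong: measurable_cong_sets)
qed

lemma nn_integral_vec_measure:
  assumes "sets M = sets borel" "F \<in> borel_measurable borel"
  shows "(\<integral>\<^sup>+z. F z \<partial>vec_measure M) = (\<integral>\<^sup>+x. F (\<chi> k. x k) \<partial>(\<Pi>\<^sub>M k\<in>UNIV. M))"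
  unfolding vec_measure_def
  by (rule nn_integral_distr[OF vec_lambda_measurable_PiM[OF assms(1)]]) (use assms in simp)

lemma prod_Basis_vec:
  "(\<Prod>b\<in>Basis. g b) = (\<Prod>k\<in>UNIV. \<Prod>u\<in>Basis. g (axis (k::'n::finite) (u::'a::euclidean_space)))"
proof -
  have "(\<Prod>b\<in>Basis. g b) = (\<Prod>w\<in>UNIV \<times> Basis. g (axis (fst w) (snd w) :: 'a ^ 'n))"
  proof (rule prod.reindex_cong[of "\<lambda>w. axis (fst w) (snd w)"])
    show "inj_on (\<lambda>w. axis (fst w) (snd w) :: 'a ^ 'n) (UNIV \<times> Basis)"
      by (auto simp: inj_on_def axis_eq_axis)
    have "(\<lambda>w. axis (fst w) (snd w)) ` (UNIV \<times> Basis) = (\<Union>k. \<Union>u\<in>Basis. {axis k u :: 'a ^ 'n})" by force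
    then show "Basis = (\<lambda>w. axis (fst w) (snd w) :: 'a ^ 'n) ` (UNIV \<times> Basis)" by (simp add: Basis_vec_def)
  qed auto
  then show ?thesis by (simp add: prod.cartesian_product split_beta)
qed

lemma vec_measure_lborel: "vec_measure lborel = (lborel :: ('a::euclidean_space ^ 'n::finite) measure)"
proof (rule lborel_eqI[symmetric])
  interpret product_sigma_finite "\<lambda>_ :: 'n. lborel :: 'a measure"
    by unfold_locales
  fix l u :: "'a ^ 'n" assume le: "\<And>b. b \<in> Basis \<Longrightarrow> l \<bullet> b \<le> u \<bullet> b"
  have lek: "(l $ k) \<bullet> b \<le> (u $ k) \<bullet> b" if "b \<in> Basis" for k b
    using le[of "axis k b"] that by (auto simp: inner_axis Basis_vec_def)
  have "(\<lambda>x. \<chi> k. x k) -` box l u \<inter> space (\<Pi>\<^sub>M k\<in>UNIV. lborel) = (\<Pi>\<^sub>E k\<in>UNIV. box (l $ k) (u $ k))"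
    by (auto simp: mem_box Basis_vec_def inner_axis space_PiM PiE_def Pi_iff)
  then have "emeasure (vec_measure lborel) (box l u) = (\<Prod>k\<in>UNIV. emeasure lborel (box (l $ k) (u $ k)))"
    unfolding vec_measure_def
    by (subst emeasure_distr[OF vec_lambda_measurable_PiM]) (auto simp: emeasure_PiM)
  also have "\<dots> = (\<Prod>k\<in>UNIV. ennreal (\<Prod>b\<in>Basis. (u $ k - l $ k) \<bullet> b))"
    using lek by (intro prod.cong refl emeasure_lborel_box)
  also have "\<dots> = ennreal (\<Prod>k\<in>UNIV. \<Prod>b\<in>Basis. (u $ k - l $ k) \<bullet> b)"
    using lek by (intro prod_ennreal prod_nonneg) (auto simp: inner_diff_left)
  also have "(\<Prod>k\<in>UNIV. \<Prod>b\<in>Basis. (u $ k - l $ k) \<bullet> b) = (\<Prod>b\<in>Basis. (u - l) \<bullet> b)"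
    by (simp add: prod_Basis_vec inner_axis)
  finally show "emeasure (vec_measure lborel) (box l u) = (\<Prod>b\<in>Basis. (u - l) \<bullet> b)" .
qed simp

lemma PiM_density_lborel:
  fixes f :: "'a::euclidean_space \<Rightarrow> ennreal"
  assumes f [measurable]: "f \<in> borel_measurable borel" and sf: "sigma_finite_measure (density lborel f)"
  shows "density (\<Pi>\<^sub>M k\<in>UNIV. lborel) (\<lambda>x. \<Prod>k\<in>UNIV. f (x k)) = (\<Pi>\<^sub>M k\<in>(UNIV::'n::finite set). density lborel f)"
proof -
  interpret L: product_sigma_finite "\<lambda>_ :: 'n. lborel :: 'a measure" by unfold_locales
  interpret D: product_sigma_finite "\<lambda>_ :: 'n. density lborel f"
    by (rule product_sigma_finite.intro) (rule sf)
  show ?thesis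
  proof (rule D.PiM_eqI)
    show "sets (density (\<Pi>\<^sub>M k\<in>(UNIV::'n set). lborel) (\<lambda>x. \<Prod>k\<in>UNIV. f (x k))) = sets (\<Pi>\<^sub>M k\<in>UNIV. density lborel f)"
      by (simp cong: sets_PiM_cong)
    fix A :: "'n \<Rightarrow> 'a set" assume A: "\<And>i. i \<in> UNIV \<Longrightarrow> A i \<in> sets (density lborel f)"
    then have [measurable]: "A i \<in> sets borel" for i by simp
    have ind: "indicator (\<Pi>\<^sub>E i\<in>UNIV. A i) x = (\<Prod>i\<in>UNIV. indicator (A i) (x i) :: ennreal)" for x
    proof (cases "\<forall>i. x i \<in> A i")
      case False
      then obtain i where "x i \<notin> A i" by blast
      then have "(\<Prod>i\<in>UNIV. indicator (A i) (x i) :: ennreal) = 0"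
        by (intro prod_zero bexI[of _ i]) auto
      then show ?thesis using \<open>x i \<notin> A i\<close> by (auto simp: indicator_def PiE_def)
    qed (auto simp: indicator_def PiE_def)
    have "emeasure (density (\<Pi>\<^sub>M k\<in>(UNIV::'n set). lborel) (\<lambda>x. \<Prod>k\<in>UNIV. f (x k))) (\<Pi>\<^sub>E i\<in>UNIV. A i)
       = (\<integral>\<^sup>+x. (\<Prod>k\<in>UNIV. f (x k)) * indicator (\<Pi>\<^sub>E i\<in>UNIV. A i) x \<partial>(\<Pi>\<^sub>M k\<in>(UNIV::'n set). lborel))"
      by (subst emeasure_density) (auto intro!: borel_measurable_prod_ennreal sets_PiM_I_finite)
    also have "\<dots> = (\<integral>\<^sup>+x. (\<Prod>k\<in>UNIV. f (x k) * indicator (A k) (x k)) \<partial>(\<Pi>\<^sub>M k\<in>(UNIV::'n set). lborel))"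
      by (simp add: ind prod.distrib)
    also have "\<dots> = (\<Prod>k\<in>UNIV. \<integral>\<^sup>+x. f x * indicator (A k) x \<partial>lborel)"
      by (rule L.product_nn_integral_prod) auto
    also have "\<dots> = (\<Prod>k\<in>UNIV. emeasure (density lborel f) (A k))"
      by (simp add: emeasure_density)
    finally show "emeasure (density (\<Pi>\<^sub>M k\<in>(UNIV::'n set). lborel) (\<lambda>x. \<Prod>k\<in>UNIV. f (x k))) (\<Pi>\<^sub>E i\<in>UNIV. A i)
       = (\<Prod>k\<in>UNIV. emeasure (density lborel f) (A k))" .
  qed simp
qed

lemma nn_integral_vec_density:
  fixes f :: "'a::euclidean_space \<Rightarrow> ennreal" and F :: "'a ^ 'n::finite \<Rightarrow> ennreal"
  assumes f [measurable]: "f \<in> borel_measurable borel" and sf: "sigma_finite_measure (density lborel f)"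
    and F [measurable]: "F \<in> borel_measurable borel"
  shows "(\<integral>\<^sup>+x. F (\<chi> k. x k) \<partial>(\<Pi>\<^sub>M k\<in>UNIV. density lborel f)) = (\<integral>\<^sup>+z. (\<Prod>k\<in>UNIV. f (z $ k)) * F z \<partial>lborel)"
proof -
  have [measurable]: "(\<lambda>x. \<chi> k::'n. x k) \<in> borel_measurable (\<Pi>\<^sub>M k\<in>UNIV. lborel :: 'a measure)"
    by (rule vec_lambda_measurable_PiM) simp
  have "(\<integral>\<^sup>+x. F (\<chi> k. x k) \<partial>(\<Pi>\<^sub>M k\<in>UNIV. density lborel f))
     = (\<integral>\<^sup>+x. (\<Prod>k\<in>UNIV. f (x k)) * F (\<chi> k. x k) \<partial>(\<Pi>\<^sub>M k\<in>UNIV. lborel))"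
    unfolding PiM_density_lborel[OF f sf, symmetric]
    by (rule nn_integral_density) (auto intro!: borel_measurable_prod_ennreal)
  also have "\<dots> = (\<integral>\<^sup>+z. (\<Prod>k\<in>UNIV. f (z $ k)) * F z \<partial>vec_measure lborel)"
    by (subst nn_integral_vec_measure) (auto intro!: borel_measurable_prod_ennreal borel_measurable_times_ennreal)
  finally show ?thesis by (simp add: vec_measure_lborel)
qed

lemma coordinate_measures_circle: "coordinate_measures circle"
  by (rule coordinate_measures.intro[OF prob_space_circle sets_circle])

lemma coordinate_measures_disc: "2 \<le> m \<Longrightarrow> coordinate_measures (disc_measure m)"
  by (rule coordinate_measures.intro[OF prob_space_disc_measure sets_disc_measure])

text \<open>The uniform measure on the cube of angles has a product density, and \<open>cis\<close>
  acts on each coordinate separately, so the image is the product of the circle measures.\<close>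

lemma nn_integral_torus_haar:
  fixes F :: "complex ^ 'n::finite \<Rightarrow> ennreal"
  assumes F [measurable]: "F \<in> borel_measurable borel"
  shows "(\<integral>\<^sup>+\<omega>. F \<omega> \<partial>torus_haar) = (\<integral>\<^sup>+x. F (\<chi> k. x k) \<partial>(\<Pi>\<^sub>M k\<in>UNIV. circle))"
proof -
  define f :: "real \<Rightarrow> ennreal" where "f x = ennreal (indicator {0..2*pi} x / (2 * pi))" for x
  define D where "D = {\<theta> :: real ^ 'n. \<forall>k. 0 \<le> \<theta> $ k \<and> \<theta> $ k \<le> 2 * pi}"
  have [measurable]: "f \<in> borel_measurable borel" unfolding f_def by measurable
  have fU: "density lborel f = uniform_measure lborel {0..2*pi}"
    unfolding uniform_measure_eq_density f_def ..
  interpret U: prob_space "density lborel f"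
    unfolding fU by (rule prob_space_uniform_measure) auto
  have Dcbox: "D = cbox 0 (\<chi> k. 2 * pi)"
    by (auto simp: D_def mem_box_cart)
  have eD: "emeasure lborel D = ennreal ((2 * pi) ^ CARD('n))"
  proof -
    have "(\<Prod>b\<in>Basis. ((\<chi> k. 2 * pi) - 0 :: real ^ 'n) \<bullet> b) = (2 * pi) ^ CARD('n)"
      by (simp add: prod_Basis_vec inner_axis)
    then show ?thesis
      unfolding Dcbox by (subst emeasure_lborel_cbox) (auto simp: Basis_vec_def inner_axis simp del: power_mult_distrib)
  qed
  have cism: "(\<lambda>\<theta>. \<chi> k. cis (\<theta> $ k)) \<in> borel_measurable (borel :: (real ^ 'n) measure)"
    by (intro borel_measurable_vec_lambda) measurable
  have Fc: "(\<lambda>\<theta>. F (\<chi> k. cis (\<theta> $ k))) \<in> borel_measurable (borel :: (real ^ 'n) measure)"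
    using measurable_compose[OF cism F] .
  have "(\<integral>\<^sup>+\<omega>. F \<omega> \<partial>torus_haar) = (\<integral>\<^sup>+\<theta>. F (\<chi> k. cis (\<theta> $ k)) \<partial>uniform_measure lborel D)"
    unfolding torus_haar_def D_def[symmetric]
  proof (rule nn_integral_distr)
    show "(\<lambda>\<theta>. \<chi> k. cis (\<theta> $ k)) \<in> measurable (uniform_measure lborel D) (restrict_space borel torus)"
      using cism by (intro measurable_restrict_space2) (auto simp: torus_def)
    show "F \<in> borel_measurable (distr (uniform_measure lborel D) (restrict_space borel torus) (\<lambda>\<theta>. \<chi> k. cis (\<theta> $ k)))"
      by (simp add: measurable_restrict_space1)
  qed
  also have "\<dots> = (\<integral>\<^sup>+\<theta>. F (\<chi> k. cis (\<theta> $ k)) * indicator D \<theta> \<partial>lborel) / emeasure lborel D"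
    by (rule nn_integral_uniform_measure) (use Fc Dcbox in auto)
  also have "\<dots> = (\<integral>\<^sup>+\<theta>. (\<Prod>k\<in>UNIV. f (\<theta> $ k)) * F (\<chi> k. cis (\<theta> $ k)) \<partial>lborel)"
  proof -
    have "(\<Prod>k\<in>UNIV. f (\<theta> $ k)) = indicator D \<theta> / emeasure lborel D" for \<theta> :: "real ^ 'n"
    proof -
      have "(\<Prod>k\<in>UNIV. f (\<theta> $ k)) = ennreal (\<Prod>k\<in>(UNIV::'n set). indicator {0..2*pi} (\<theta> $ k) / (2 * pi))"
        unfolding f_def by (intro prod_ennreal) auto
      also have "(\<Prod>k\<in>(UNIV::'n set). indicator {0..2*pi} (\<theta> $ k) / (2 * pi)) = indicator D \<theta> / (2 * pi) ^ CARD('n)"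
        by (auto simp: indicator_def D_def prod_dividef)
      finally show ?thesis by (simp add: eD divide_ennreal[symmetric] ennreal_indicator)
    qed
    then have "(\<Prod>k\<in>UNIV. f (\<theta> $ k)) * F (\<chi> k. cis (\<theta> $ k)) = F (\<chi> k. cis (\<theta> $ k)) * indicator D \<theta> / emeasure lborel D" for \<theta> :: "real ^ 'n"
      by (simp add: divide_ennreal_def mult_ac)
    then show ?thesis
      using Fc by (simp add: nn_integral_divide Dcbox)
  qed
  also have "\<dots> = (\<integral>\<^sup>+x. F (\<chi> k. cis (x k)) \<partial>(\<Pi>\<^sub>M k\<in>(UNIV::'n set). density lborel f))"
    by (subst nn_integral_vec_density[symmetric, of f "\<lambda>\<theta>. F (\<chi> k. cis (\<theta> $ k))"]) (use Fc in \<open>auto intro: U.sigma_finite_measure_axioms\<close>)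
  also have "\<dots> = (\<integral>\<^sup>+x. F (\<chi> k. x k) \<partial>(\<Pi>\<^sub>M k\<in>(UNIV::'n set). circle))"
  proof -
    have dc: "distr (density lborel f) circle cis = circle"
      using distr_cong[OF refl sets_circle refl, of "density lborel f" cis] by (simp add: circle_def fU)
    have cm: "cis \<in> measurable (density lborel f) circle"
      by (simp cong: measurable_cong_sets)
    have "(\<Pi>\<^sub>M k\<in>(UNIV::'n set). circle) = (\<Pi>\<^sub>M k\<in>(UNIV::'n set). distr (density lborel f) circle cis)"
      by (simp only: dc)
    also have "\<dots> = distr (\<Pi>\<^sub>M k\<in>(UNIV::'n set). density lborel f) (\<Pi>\<^sub>M k\<in>UNIV. circle) (compose UNIV cis)"
      by (rule distr_PiM_finite_prob_space'[symmetric]) (auto intro: cm prob_space_circle U.prob_space_axioms)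
    finally have eq: "(\<Pi>\<^sub>M k\<in>(UNIV::'n set). circle) = distr (\<Pi>\<^sub>M k\<in>(UNIV::'n set). density lborel f) (\<Pi>\<^sub>M k\<in>UNIV. circle) (compose UNIV cis)" .
    have "compose UNIV cis \<in> measurable (\<Pi>\<^sub>M k\<in>(UNIV::'n set). density lborel f) (\<Pi>\<^sub>M k\<in>UNIV. circle)"
      unfolding compose_def
    proof (intro measurable_restrict)
      fix k :: 'n
      show "(\<lambda>x. cis (x k)) \<in> measurable (\<Pi>\<^sub>M k\<in>(UNIV::'n set). density lborel f) circle"
        by (rule measurable_compose[OF measurable_component_singleton[of k UNIV "\<lambda>_. density lborel f"] cm]) simp
    qed
    then show ?thesis
      by (subst eq, subst nn_integral_distr)
        (auto simp: compose_def restrict_def intro: measurable_compose[OF vec_lambda_measurable_PiM F])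
  qed
  finally show ?thesis .
qed

text \<open>The normalising constant and the indicator of the polydisc also split into one factor
  per coordinate.\<close>

lemma nn_integral_weighted_measure:
  fixes F :: "complex ^ 'n::finite \<Rightarrow> ennreal"
  assumes m: "2 \<le> m" and F [measurable]: "F \<in> borel_measurable borel"
  shows "(\<integral>\<^sup>+z. F z \<partial>weighted_measure m) = (\<integral>\<^sup>+x. F (\<chi> k. x k) \<partial>(\<Pi>\<^sub>M k\<in>UNIV. disc_measure m))"
proof -
  interpret D: prob_space "disc_measure m" by (rule prob_space_disc_measure[OF m])
  let ?w = "\<lambda>z :: complex ^ 'n. ennreal ((real m - 1) ^ CARD('n) / pi ^ CARD('n) * (\<Prod>k\<in>UNIV. (1 - (norm (z $ k))\<^sup>2) ^ (m - 2)))"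
  have pd: "polydisc \<in> sets (borel :: (complex ^ 'n) measure)"
    by (rule borel_open[OF open_polydisc])
  have wm [measurable]: "?w \<in> borel_measurable borel"
    by (intro measurable_compose[OF _ measurable_ennreal] borel_measurable_continuous_onI continuous_intros)
  have "(\<integral>\<^sup>+z. F z \<partial>weighted_measure m) = (\<integral>\<^sup>+z. ?w z * F z \<partial>restrict_space lborel polydisc)"
    unfolding weighted_measure_def
    by (rule nn_integral_density) (auto intro!: measurable_restrict_space1)
  also have "\<dots> = (\<integral>\<^sup>+z. ?w z * F z * indicator polydisc z \<partial>lborel)"
    by (rule nn_integral_restrict_space) (use pd in simp)
  also have "\<dots> = (\<integral>\<^sup>+z. (\<Prod>k\<in>UNIV. ennreal (disc_density m (z $ k))) * F z \<partial>lborel)"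
  proof (rule nn_integral_cong)
    fix z :: "complex ^ 'n"
    have "(\<Prod>k\<in>UNIV. ennreal (disc_density m (z $ k))) = ennreal (\<Prod>k\<in>UNIV. disc_density m (z $ k))"
      using m by (intro prod_ennreal) (auto simp: disc_density_def indicator_def power_le_one)
    also have "(\<Prod>k\<in>UNIV. disc_density m (z $ k))
      = indicator polydisc z * ((real m - 1) ^ CARD('n) / pi ^ CARD('n) * (\<Prod>k\<in>UNIV. (1 - (norm (z $ k))\<^sup>2) ^ (m - 2)))"
      by (auto simp: disc_density_def indicator_def polydisc_def prod.distrib prod_dividef)
    finally show "?w z * F z * indicator polydisc z = (\<Prod>k\<in>UNIV. ennreal (disc_density m (z $ k))) * F z"
      by (auto simp: indicator_def)
  qed
  also have "\<dots> = (\<integral>\<^sup>+x. F (\<chi> k. x k) \<partial>(\<Pi>\<^sub>M k\<in>UNIV. disc_measure m))"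
    unfolding disc_measure_def
    by (rule nn_integral_vec_density[symmetric])
      (use D.sigma_finite_measure_axioms in \<open>auto simp: disc_measure_def\<close>)
  finally show ?thesis .
qed

section \<open>Inequalities on the polydisc\<close>

definition retr :: "complex \<Rightarrow> complex" where
  "retr z = z /\<^sub>R max 1 (norm z)"

definition clip :: "complex ^ 'n \<Rightarrow> complex ^ 'n" where
  "clip z = (\<chi> k. retr (z $ k))"

definition closed_polydisc :: "(complex ^ 'n) set" where
  "closed_polydisc = {z. \<forall>k. norm (z $ k) \<le> 1}"

lemma retr_id: "norm z \<le> 1 \<Longrightarrow> retr z = z"
  by (simp add: retr_def max_def)

lemma norm_retr_le: "norm (retr z) \<le> 1"
  by (auto simp: retr_def max_def field_simps)

lemma continuous_on_retr: "continuous_on A retr"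
  unfolding retr_def by (intro continuous_intros) auto

lemma clip_id: "z \<in> closed_polydisc \<Longrightarrow> clip z = z"
  by (simp add: clip_def closed_polydisc_def retr_id vec_eq_iff)

lemma clip_in: "clip z \<in> closed_polydisc"
  by (simp add: clip_def closed_polydisc_def norm_retr_le)

lemma clip_upd: "clip (upd z k x) = upd (clip z) k (retr x)"
  by (simp add: clip_def upd_def vec_eq_iff)

lemma continuous_on_clip: "continuous_on A clip"
  unfolding clip_def
  by (intro continuous_on_vec_lambda continuous_on_compose2[OF continuous_on_retr[of UNIV]] continuous_intros) auto

lemma continuous_on_upd: "continuous_on A (upd z k)"
proof -
  have "continuous_on A (\<lambda>x. if j = k then x else z $ j)" for j
    by (cases "j = k") (auto intro: continuous_intros)
  then show ?thesis unfolding upd_def[abs_def] by (rule continuous_on_vec_lambda)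
qed

lemma compact_closed_polydisc: "compact (closed_polydisc :: (complex ^ 'n::finite) set)"
proof -
  have "closed (closed_polydisc :: (complex ^ 'n) set)"
    unfolding closed_polydisc_def by (intro closed_Collect_all closed_Collect_le continuous_intros)
  moreover have "bounded (closed_polydisc :: (complex ^ 'n) set)"
    unfolding bounded_iff
  proof (intro exI ballI)
    fix z :: "complex ^ 'n" assume z: "z \<in> closed_polydisc"
    have "norm z \<le> (\<Sum>k\<in>UNIV. norm (z $ k))" by (simp add: norm_vec_def L2_set_le_sum)
    also have "\<dots> \<le> (\<Sum>k\<in>(UNIV :: 'n set). 1)" using z by (intro sum_mono) (auto simp: closed_polydisc_def)
    finally show "norm z \<le> real CARD('n)" by simp
  qed
  ultimately show ?thesis by (simp add: compact_eq_bounded_closed)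
qed

lemma scale_clip_in_polydisc: "0 < r \<Longrightarrow> r < 1 \<Longrightarrow> w \<in> closed_polydisc \<Longrightarrow> r *\<^sub>R w \<in> polydisc"
  by (auto simp: closed_polydisc_def polydisc_def intro: le_less_trans[OF mult_left_mono[of _ 1 r]])

text \<open>Precomposition with the retraction onto the closed polydisc makes the dilated functions
  globally continuous and bounded.\<close>

definition dilate :: "real \<Rightarrow> (complex ^ 'n \<Rightarrow> 'b) \<Rightarrow> complex ^ 'n \<Rightarrow> 'b" where
  "dilate r g z = g (r *\<^sub>R clip z)"

lemma complex_differentiable_continuous:
  "complex_differentiable_on S g \<Longrightarrow> continuous_on S g"
  unfolding complex_differentiable_on_def
  by (intro continuous_at_imp_continuous_on ballI) (blast intro: has_derivative_continuous)

lemma continuous_on_dilate: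
  assumes r: "0 < r" "r < 1" and g: "continuous_on polydisc g"
  shows "continuous_on UNIV (dilate r g)"
  unfolding dilate_def
  by (rule continuous_on_compose2[OF g])
    (use r in \<open>auto intro!: continuous_intros continuous_on_clip scale_clip_in_polydisc clip_in\<close>)

text \<open>\<open>clip\<close> is idempotent, so every value is already taken on the compact closed
  polydisc.\<close>

lemma bounded_dilate_comp:
  fixes Q :: "'b::topological_space \<Rightarrow> real"
  assumes c: "continuous_on UNIV (\<lambda>z. Q (dilate r g z))"
  obtains B where "\<And>z :: complex ^ 'n::finite. \<bar>Q (dilate r g z)\<bar> \<le> B"
proof -
  have cc: "clip (clip z) = clip z" for z :: "complex ^ 'n" by (rule clip_id[OF clip_in])
  have "compact ((\<lambda>z. Q (dilate r g z)) ` closed_polydisc)"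
    by (intro compact_continuous_image continuous_on_subset[OF c] compact_closed_polydisc) auto
  then obtain B where B: "\<And>z. z \<in> closed_polydisc \<Longrightarrow> \<bar>Q (dilate r g z)\<bar> \<le> B"
    by (force dest!: compact_imp_bounded simp: bounded_iff)
  have "\<bar>Q (dilate r g z)\<bar> \<le> B" for z :: "complex ^ 'n"
    using B[OF clip_in[of z]] by (simp add: dilate_def cc)
  then show thesis by (rule that)
qed

lemma slice_disc_algebra:
  fixes g :: "complex ^ 'n::finite \<Rightarrow> complex"
  assumes g: "complex_differentiable_on polydisc g" and r: "0 < r" "r < 1"
  shows "disc_algebra (\<lambda>x. dilate r g (upd z k x))"
  unfolding disc_algebra_def
proof
  show "continuous_on UNIV (\<lambda>x. dilate r g (upd z k x))"
    by (rule continuous_on_compose2[OF continuous_on_dilate[OF r complex_differentiable_continuous[OF g]] continuous_on_upd]) simp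
  show "(\<lambda>x. dilate r g (upd z k x)) holomorphic_on ball 0 1"
  proof (rule holomorphic_transform)
    show "(\<lambda>x. g (r *\<^sub>R upd (clip z) k x)) holomorphic_on ball 0 1"
      unfolding holomorphic_on_open[OF open_ball]
    proof (intro ballI)
      fix x :: complex assume x: "x \<in> ball 0 1"
      have "upd (clip z) k x \<in> closed_polydisc"
        using x clip_in[of z] by (auto simp: upd_def closed_polydisc_def)
      then obtain g' where g': "(g has_derivative g') (at (r *\<^sub>R upd (clip z) k x))" "\<And>v. g' (Jmul v) = \<i> * g' v"
        using g scale_clip_in_polydisc[OF r] unfolding complex_differentiable_on_def by blast
      have lin: "linear g'" by (rule has_derivative_linear[OF g'(1)])
      have eq: "(\<lambda>x. r *\<^sub>R upd (clip z) k x) = (\<lambda>x. r *\<^sub>R (upd (clip z) k 0 + axis k x))"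
        by (auto simp: upd_def axis_def vec_eq_iff)
      have "linear (\<lambda>y :: complex. axis k y :: complex ^ 'n)"
        by (rule linearI) (auto simp: axis_def vec_eq_iff)
      then have "((\<lambda>x. axis k x :: complex ^ 'n) has_derivative (\<lambda>y. axis k y)) (at x)"
        by (intro bounded_linear_imp_has_derivative) (simp add: linear_conv_bounded_linear)
      from has_derivative_scaleR_right[OF has_derivative_add[OF has_derivative_const[of "upd (clip z) k 0"] this], of r]
      have "((\<lambda>x. r *\<^sub>R upd (clip z) k x) has_derivative (\<lambda>y. r *\<^sub>R axis k y)) (at x)"
        unfolding eq by simp
      from has_derivative_compose[OF this g'(1)]
      have d: "((\<lambda>x. g (r *\<^sub>R upd (clip z) k x)) has_derivative (\<lambda>y. g' (r *\<^sub>R axis k y))) (at x)" .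
      \<comment> \<open>Commutation with \<open>Jmul\<close> makes the real derivative along one
        complex coordinate a multiplication by a complex number.\<close>
      have "g' (r *\<^sub>R axis k y) = g' (r *\<^sub>R axis k 1) * y" for y
      proof -
        have "axis k y = Re y *\<^sub>R axis k 1 + Im y *\<^sub>R (Jmul (axis k 1) :: complex ^ 'n)"
          unfolding Jmul_axis by (auto simp: axis_def vec_eq_iff complex_eq_iff)
        then have "g' (axis k y) = Re y *\<^sub>R g' (axis k 1) + Im y *\<^sub>R (\<i> * g' (axis k 1))"
          using g'(2) by (simp add: linear_add[OF lin] linear_cmul[OF lin])
        also have "\<dots> = g' (axis k 1) * y"
          by (simp add: complex_eq_iff algebra_simps)
        finally show ?thesis by (simp add: linear_cmul[OF lin])
      qed
      then have "(\<lambda>y. g' (r *\<^sub>R axis k y)) = times (g' (r *\<^sub>R axis k 1))" by (rule ext)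
      from d[unfolded this] show "\<exists>f'. ((\<lambda>x. g (r *\<^sub>R upd (clip z) k x)) has_field_derivative f') (at x)"
        unfolding has_field_derivative_def by (rule exI)
    qed
    show "g (r *\<^sub>R upd (clip z) k x) = dilate r g (upd z k x)" if "x \<in> ball 0 1" for x
      using that by (simp add: dilate_def clip_upd retr_id)
  qed
qed

lemma powr_power_eq:
  fixes x :: real
  assumes "0 < m"
  shows "(x powr a) ^ m = x powr (a * real m)"
  using assms by (cases "x = 0") (auto simp: powr_powr simp flip: powr_realpow)

lemma vmerge_UNIV: "vmerge UNIV x z = (\<chi> k. x k)"
  by (simp add: vmerge_def)

lemma borel_measurable_comp_vec_lambda:
  assumes "coordinate_measures M" "f \<in> borel_measurable borel"
  shows "(\<lambda>x. f (\<chi> k::'n::finite. x k)) \<in> borel_measurable (\<Pi>\<^sub>M k\<in>UNIV. M)"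
  using measurable_compose[OF vec_lambda_measurable_PiM[OF coordinate_measures.sets_M[OF assms(1)]] assms(2)] .

text \<open>\<open>G * H\<close> vanishes only at the origin of the polydisc for certain, not at the
  centre of every slice, so \<open>riesz_type_disc\<close> cannot be tensorized. Instead its
  ingredients are: \<open>tensor_submean\<close> for the corrections,
  \<open>tensor_power_inequality\<close> with \<open>C = 1\<close> for \<open>X\<close>.\<close>

lemma riesz_type_polydisc:
  fixes g h :: "complex ^ 'n::finite \<Rightarrow> complex"
  assumes m: "2 \<le> m" and p: "1 < p" and r: "0 < r" "r < 1"
    and g: "complex_differentiable_on polydisc g" and h: "complex_differentiable_on polydisc h"
    and h0: "h 0 = 0"
  defines "F \<equiv> dilate r (\<lambda>z. g z + cnj (h z))"
  shows "(\<integral>x. norm (F (\<chi> k. x k)) powr (p * real m) \<partial>(\<Pi>\<^sub>M k\<in>UNIV. disc_measure m))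
    \<le> (const_R p m powr p * (\<integral>x. norm (F (\<chi> k. x k)) powr p \<partial>(\<Pi>\<^sub>M k\<in>UNIV. circle))) ^ m"
proof -
  define G where "G = dilate r g"
  define H where "H = dilate r h"
  have FGH: "F z = G z + cnj (H z)" for z by (simp add: F_def G_def H_def dilate_def)
  note cG = continuous_on_dilate[OF r complex_differentiable_continuous[OF g], folded G_def]
  note cH = continuous_on_dilate[OF r complex_differentiable_continuous[OF h], folded H_def]
  note sG = slice_disc_algebra[OF g r, folded G_def]
  note sH = slice_disc_algebra[OF h r, folded H_def]
  have GH0: "G 0 * H 0 = 0" by (simp add: H_def dilate_def clip_id closed_polydisc_def h0)
  have cQ: "continuous_on UNIV (\<lambda>z. Q (G z, H z))" if "continuous_on UNIV Q" for Q :: "complex \<times> complex \<Rightarrow> real"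
    by (rule continuous_on_compose2[OF that]) (auto intro!: continuous_intros cG cH)
  have bQ: "\<exists>B. \<forall>z. \<bar>Q (G z, H z)\<bar> \<le> B" if Q: "continuous_on UNIV Q" for Q :: "complex \<times> complex \<Rightarrow> real"
  proof -
    have eq: "dilate r (\<lambda>z. (g z, h z)) = (\<lambda>z. (G z, H z))" by (simp add: dilate_def G_def H_def fun_eq_iff)
    have "continuous_on UNIV (\<lambda>z. Q (dilate r (\<lambda>z. (g z, h z)) z))"
      unfolding eq by (rule cQ[OF Q])
    then obtain B where "\<And>z. \<bar>Q (dilate r (\<lambda>z. (g z, h z)) z)\<bar> \<le> B" by (rule bounded_dilate_comp) blast
    then show ?thesis unfolding eq by blast
  qed
  have int: "integrable (\<Pi>\<^sub>M k\<in>(UNIV :: 'n set). M) (\<lambda>x. Q (G (\<chi> k. x k), H (\<chi> k. x k)))"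
    if M: "coordinate_measures M" and Q: "continuous_on UNIV Q" for M and Q :: "complex \<times> complex \<Rightarrow> real"
  proof -
    interpret prob_space "\<Pi>\<^sub>M k\<in>(UNIV :: 'n set). M" by (rule coordinate_measures.prob_space_PiM_coordinates[OF M])
    obtain B where "\<And>z. \<bar>Q (G z, H z)\<bar> \<le> B" using bQ[OF Q] by blast
    then show ?thesis
      by (intro integrable_bounded borel_measurable_comp_vec_lambda[OF M] borel_measurable_continuous_onI cQ[OF Q])
  qed
  have sub: "0 \<le> (\<integral>x. homog s \<phi> (c * (G (\<chi> k. x k) * H (\<chi> k. x k))) \<partial>(\<Pi>\<^sub>M k\<in>(UNIV :: 'n set). M))"
    if M: "coordinate_measures M" and s: "0 < s" and \<phi>: "continuous_on {0..pi} \<phi>"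
      and slice: "\<And>F. disc_algebra F \<Longrightarrow> homog s \<phi> (F 0) \<le> (\<integral>t. homog s \<phi> (F t) \<partial>M)" for M s \<phi> c
  proof -
    define v where "v z = homog s \<phi> (c * (G z * H z))" for z
    have cQ': "continuous_on UNIV (\<lambda>w. homog s \<phi> (c * (fst w * snd w)))"
      by (rule continuous_on_compose2[OF continuous_on_homog[OF s \<phi>]]) (auto intro!: continuous_intros)
    obtain B where B: "\<And>z. \<bar>v z\<bar> \<le> B"
      using bQ[OF cQ'] by (auto simp: v_def)
    have vm: "v \<in> borel_measurable borel"
      using cQ[OF cQ'] by (intro borel_measurable_continuous_onI) (simp add: v_def[abs_def])
    have "v (vmerge UNIV (\<lambda>_. 0) 0) \<le> (\<integral>x. v (vmerge UNIV x 0) \<partial>(\<Pi>\<^sub>M k\<in>UNIV. M))"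
    proof (rule tensor_submean[OF M vm B])
      fix z k
      have "disc_algebra (\<lambda>t. c * (G (upd z k t) * H (upd z k t)))"
        by (intro disc_algebra_mult sG sH) (simp add: disc_algebra_def)
      from slice[OF this] show "v (upd z k 0) \<le> (\<integral>t. v (upd z k t) \<partial>M)" by (simp add: v_def)
    qed
    moreover have "vmerge UNIV (\<lambda>_. 0) (0 :: complex ^ 'n) = 0" by (simp add: vmerge_def vec_eq_iff)
    ultimately show ?thesis using GH0 by (auto simp: v_def homog_def vmerge_UNIV)
  qed
  note MD = coordinate_measures_disc[OF m]
  note MC = coordinate_measures_circle
  show ?thesis
    unfolding FGH
  proof (rule riesz_type_abstract[OF p m])
    show "integrable (\<Pi>\<^sub>M k\<in>(UNIV :: 'n set). disc_measure m) (\<lambda>x. Q (G (\<chi> k. x k), H (\<chi> k. x k)))"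
      "integrable (\<Pi>\<^sub>M k\<in>(UNIV :: 'n set). circle) (\<lambda>x. Q (G (\<chi> k. x k), H (\<chi> k. x k)))"
      if "continuous_on UNIV Q" for Q :: "complex \<times> complex \<Rightarrow> real"
      by (intro int that MD MC)+
    show "0 \<le> (\<integral>x. homog s (phi_hi s) (G (\<chi> k. x k) * H (\<chi> k. x k)) \<partial>(\<Pi>\<^sub>M k\<in>UNIV. disc_measure m))" if "1 \<le> s" for s
      using sub[OF MD _ continuous_on_phi_hi, of s s 1] submean_phi_hi_disc[OF m that] that by simp
    show "0 \<le> (\<integral>x. homog s (phi_hi s) (- (G (\<chi> k. x k) * H (\<chi> k. x k))) \<partial>(\<Pi>\<^sub>M k\<in>UNIV. circle))" if "1 \<le> s" for s
      using sub[OF MC _ continuous_on_phi_hi, of s s "- 1"] submean_phi_hi[OF that] that by simp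
    show "0 \<le> (\<integral>x. homog s (phi_lo s) (G (\<chi> k. x k) * H (\<chi> k. x k)) \<partial>(\<Pi>\<^sub>M k\<in>UNIV. circle))" if "0 < s" "s \<le> 1" for s
      using sub[OF MC _ continuous_on_phi_lo, of s s 1] submean_phi_lo[OF that] that by simp
    define X where "X z = ((norm (G z))\<^sup>2 + (norm (H z))\<^sup>2) powr (p / 2)" for z
    have cQX: "continuous_on UNIV (\<lambda>w::complex \<times> complex. ((norm (fst w))\<^sup>2 + (norm (snd w))\<^sup>2) powr (p / 2))"
      using p by (intro continuous_on_nonneg_powr continuous_intros) auto
    obtain B where B: "\<And>z. \<bar>X z\<bar> \<le> B" using bQ[OF cQX] by (auto simp: X_def)
    have X0: "0 \<le> X z" for z by (simp add: X_def)
    have Xm: "X z ^ m = ((norm (G z))\<^sup>2 + (norm (H z))\<^sup>2) powr (p / 2 * real m)" for z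
      unfolding X_def using m by (intro powr_power_eq) simp
    have "(\<integral>x. X (vmerge UNIV x 0) ^ m \<partial>(\<Pi>\<^sub>M k\<in>UNIV. disc_measure m))
      \<le> 1 ^ card (UNIV :: 'n set) * (\<integral>x. X (vmerge UNIV x 0) \<partial>(\<Pi>\<^sub>M k\<in>UNIV. circle)) ^ m"
    proof (rule tensor_power_inequality[OF MD MC])
      show "X \<in> borel_measurable borel"
        using cQ[OF cQX] by (intro borel_measurable_continuous_onI) (simp add: X_def[abs_def])
      show "X z \<le> B" for z using B[of z] by linarith
      show "(\<integral>t. X (upd z k t) ^ m \<partial>disc_measure m) \<le> 1 * (\<integral>t. X (upd z k t) \<partial>circle) ^ m" for z k
        unfolding Xm using carleman_pair[OF m _ sG[of z k] sH[of z k], of "p / 2"] p by (simp add: X_def)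
    qed (use m X0 in auto)
    then show "(\<integral>x. ((norm (G (\<chi> k. x k)))\<^sup>2 + (norm (H (\<chi> k. x k)))\<^sup>2) powr (p / 2 * real m) \<partial>(\<Pi>\<^sub>M k\<in>UNIV. disc_measure m))
       \<le> (\<integral>x. ((norm (G (\<chi> k. x k)))\<^sup>2 + (norm (H (\<chi> k. x k)))\<^sup>2) powr (p / 2) \<partial>(\<Pi>\<^sub>M k\<in>UNIV. circle)) ^ m"
      unfolding Xm vmerge_UNIV by (simp add: X_def)
  qed
qed

text \<open>\<open>carleman_harmonic\<close> applies to every slice, whatever its value at the
  centre, and is tensorized as it stands; each coordinate contributes a factor
  \<open>(const_D m)\<^sup>2\<close> inside the \<open>m\<close>-th power.\<close>

lemma carleman_harmonic_polydisc:
  fixes g h :: "complex ^ 'n::finite \<Rightarrow> complex"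
  assumes m: "2 \<le> m" and p: "2 \<le> p" and r: "0 < r" "r < 1"
    and g: "complex_differentiable_on polydisc g" and h: "complex_differentiable_on polydisc h"
  defines "F \<equiv> dilate r (\<lambda>z. g z + cnj (h z))"
  shows "(\<integral>x. norm (F (\<chi> k. x k)) powr (p * real m) \<partial>(\<Pi>\<^sub>M k\<in>UNIV. disc_measure m))
    \<le> (const_D m ^ (2 * CARD('n)) * (\<integral>x. norm (F (\<chi> k. x k)) powr p \<partial>(\<Pi>\<^sub>M k\<in>UNIV. circle))) ^ m"
proof -
  define w where "w z = norm (F z) powr p" for z
  have F: "F z = dilate r g z + cnj (dilate r h z)" for z by (simp add: F_def dilate_def)
  have cF: "continuous_on UNIV F"
    unfolding F_def
    by (intro continuous_on_dilate r continuous_intros complex_differentiable_continuous g h)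
  have cw: "continuous_on UNIV w"
    unfolding w_def using p by (intro continuous_on_nonneg_powr continuous_intros cF) auto
  obtain B where B: "\<And>z. \<bar>w z\<bar> \<le> B"
    using bounded_dilate_comp[of "\<lambda>y. norm y powr p" r "\<lambda>z. g z + cnj (h z)"] cw
    by (auto simp: w_def[abs_def] F_def)
  have wm: "w z ^ m = norm (F z) powr (p * real m)" for z
    unfolding w_def using m by (intro powr_power_eq) simp
  have "(\<integral>x. w (vmerge UNIV x 0) ^ m \<partial>(\<Pi>\<^sub>M k\<in>UNIV. disc_measure m))
      \<le> (((const_D m)\<^sup>2) ^ m) ^ card (UNIV :: 'n set) * (\<integral>x. w (vmerge UNIV x 0) \<partial>(\<Pi>\<^sub>M k\<in>UNIV. circle)) ^ m"
  proof (rule tensor_power_inequality[OF coordinate_measures_disc[OF m] coordinate_measures_circle])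
    show "w \<in> borel_measurable borel" using cw by (rule borel_measurable_continuous_onI)
    show "w z \<le> B" for z using B[of z] by linarith
    show "(\<integral>t. w (upd z k t) ^ m \<partial>disc_measure m) \<le> ((const_D m)\<^sup>2) ^ m * (\<integral>t. w (upd z k t) \<partial>circle) ^ m" for z k
      unfolding wm power_mult_distrib[symmetric]
      using carleman_harmonic[OF m p slice_disc_algebra[OF g r, of z k] slice_disc_algebra[OF h r, of z k]]
      by (simp add: w_def F)
  qed (use m in \<open>auto simp: w_def\<close>)
  then show ?thesis
    unfolding wm vmerge_UNIV
    by (simp add: w_def power_mult_distrib power_mult[symmetric] mult_ac)
qed

lemma gamma_type_polydisc:
  fixes g h :: "complex ^ 'n::finite \<Rightarrow> complex"
  assumes m: "2 \<le> m" and p: "1 < p" and r: "0 < r" "r < 1"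
    and g: "complex_differentiable_on polydisc g" and h: "complex_differentiable_on polydisc h"
    and h0: "h 0 = 0"
  defines "F \<equiv> dilate r (\<lambda>z. g z + cnj (h z))"
  shows "(\<integral>x. norm (F (\<chi> k. x k)) powr (p * real m) \<partial>(\<Pi>\<^sub>M k\<in>UNIV. disc_measure m))
    \<le> (const_Gamma p m CARD('n) powr p * (\<integral>x. norm (F (\<chi> k. x k)) powr p \<partial>(\<Pi>\<^sub>M k\<in>UNIV. circle))) ^ m"
proof (cases "const_Gamma p m CARD('n) = const_R p m")
  case True
  then show ?thesis using riesz_type_polydisc[OF m p r g h h0] by (simp add: F_def)
next
  case False
  then have p2: "2 \<le> p" and \<Gamma>: "const_Gamma p m CARD('n) = const_D m powr (2 * real CARD('n) / p)"
    by (auto simp: const_Gamma_def min_def split: if_splits)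
  have D: "0 < const_D m" using const_R_pos[of 2 m] m by (simp add: const_R_two)
  \<comment> \<open>The exponent \<open>2 * n / p\<close> in \<open>const_Gamma\<close> is made so
    that the \<open>p\<close>-th power is the product of the coordinate factors.\<close>
  have "const_Gamma p m CARD('n) powr p = const_D m powr (2 * real CARD('n))"
    using p by (simp add: \<Gamma> powr_powr)
  also have "\<dots> = const_D m ^ (2 * CARD('n))"
    using powr_realpow[OF D, of "2 * CARD('n)"] by simp
  finally show ?thesis using carleman_harmonic_polydisc[OF m p2 r g h] by (simp add: F_def)
qed

text \<open>\<open>F\<close> agrees with the dilate of \<open>f\<close> on the closed polydisc,
  which contains both the polydisc and the torus. The torus integral is the \<open>p\<close>-th
  power of \<open>hp_mean p f r\<close>, hence bounded through the supremum over all radii.\<close>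

lemma dilated_inequality:
  fixes f :: "complex ^ 'n::finite \<Rightarrow> complex"
  assumes m: "2 \<le> m" and p: "1 < p" and f: "f \<in> hp_space p" and r: "0 < r" "r < 1"
  shows "(\<integral>\<^sup>+z. ennreal ((norm (f (r *\<^sub>R z)) powr p) ^ m) \<partial>weighted_measure m)
    \<le> ennreal ((const_Gamma p m CARD('n) powr p * hp_norm p f powr p) ^ m)"
proof -
  have ph: "pluriharmonic_on polydisc f" and bdd: "bdd_above (hp_mean p f ` {0<..<1})"
    using f by (auto simp: hp_space_def)
  obtain g h where g: "complex_differentiable_on polydisc g" and h: "complex_differentiable_on polydisc h"
    and fgh: "\<And>z. z \<in> polydisc \<Longrightarrow> f z = g z + cnj (h z)" and h0: "h 0 = 0"
    using pluriharmonic_decomposition[OF ph] by blast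
  define F where "F = dilate r (\<lambda>z. g z + cnj (h z))"
  have Ff: "F z = f (r *\<^sub>R z)" if "z \<in> closed_polydisc" for z
    using that scale_clip_in_polydisc[OF r that] by (simp add: F_def dilate_def clip_id fgh)
  have cF: "continuous_on UNIV F"
    unfolding F_def
    by (intro continuous_on_dilate r continuous_intros complex_differentiable_continuous g h)
  have cFp: "continuous_on UNIV (\<lambda>z. norm (F z) powr q)" if "0 < q" for q
    using that by (intro continuous_on_nonneg_powr continuous_intros cF) auto
  have bFp: "\<exists>B. \<forall>z. \<bar>norm (F z) powr q\<bar> \<le> B" if "0 < q" for q
    using bounded_dilate_comp[of "\<lambda>y. norm y powr q" r "\<lambda>z. g z + cnj (h z)"] cFp[OF that]
    unfolding F_def by metis
  have nn: "(\<integral>\<^sup>+x. ennreal (norm (F (\<chi> k. x k)) powr q) \<partial>(\<Pi>\<^sub>M k\<in>(UNIV::'n set). M))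
     = ennreal (\<integral>x. norm (F (\<chi> k. x k)) powr q \<partial>(\<Pi>\<^sub>M k\<in>(UNIV::'n set). M))"
    if M: "coordinate_measures M" and q: "0 < q" for M q
  proof (rule nn_integral_eq_integral)
    interpret prob_space "\<Pi>\<^sub>M k\<in>(UNIV :: 'n set). M" by (rule coordinate_measures.prob_space_PiM_coordinates[OF M])
    obtain B where "\<And>z. \<bar>norm (F z) powr q\<bar> \<le> B" using bFp[OF q] by blast
    then show "integrable (\<Pi>\<^sub>M k\<in>(UNIV::'n set). M) (\<lambda>x. norm (F (\<chi> k. x k)) powr q)"
      by (intro integrable_bounded borel_measurable_comp_vec_lambda[OF M] borel_measurable_continuous_onI cFp[OF q])
  qed simp
  have pm: "0 < p * real m" "0 < p" "0 < m" using p m by auto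
  have spaces: "space (weighted_measure m) = (polydisc :: (complex ^ 'n) set)" "space torus_haar = (torus :: (complex ^ 'n) set)"
    by (simp_all add: weighted_measure_def torus_haar_def space_restrict_space)
  have "(\<integral>\<^sup>+z. ennreal ((norm (f (r *\<^sub>R z)) powr p) ^ m) \<partial>weighted_measure m)
     = (\<integral>\<^sup>+z. ennreal (norm (F z) powr (p * real m)) \<partial>weighted_measure m)"
    using pm by (intro nn_integral_cong)
      (auto simp: spaces Ff polydisc_def closed_polydisc_def less_imp_le powr_power_eq)
  also have "\<dots> = (\<integral>\<^sup>+x. ennreal (norm (F (\<chi> k. x k)) powr (p * real m)) \<partial>(\<Pi>\<^sub>M k\<in>UNIV. disc_measure m))"
    by (rule nn_integral_weighted_measure[OF m])
      (intro measurable_compose[OF _ measurable_ennreal] borel_measurable_continuous_onI cFp pm)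
  also have "\<dots> = ennreal (\<integral>x. norm (F (\<chi> k. x k)) powr (p * real m) \<partial>(\<Pi>\<^sub>M k\<in>UNIV. disc_measure m))"
    by (rule nn[OF coordinate_measures_disc[OF m] pm(1)])
  also have "\<dots> \<le> ennreal ((const_Gamma p m CARD('n) powr p * (\<integral>x. norm (F (\<chi> k. x k)) powr p \<partial>(\<Pi>\<^sub>M k\<in>UNIV. circle))) ^ m)"
    unfolding F_def by (intro ennreal_leI gamma_type_polydisc m p r g h h0)
  also have "\<dots> \<le> ennreal ((const_Gamma p m CARD('n) powr p * hp_norm p f powr p) ^ m)"
  proof (intro ennreal_leI power_mono mult_left_mono)
    define I where "I = (\<integral>x. norm (F (\<chi> k. x k)) powr p \<partial>(\<Pi>\<^sub>M k\<in>(UNIV::'n set). circle))"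
    have I0: "0 \<le> I" by (simp add: I_def)
    have "(\<integral>\<omega>. norm (f (r *\<^sub>R \<omega>)) powr p \<partial>torus_haar) = (\<integral>\<omega>. norm (F \<omega>) powr p \<partial>torus_haar)"
      by (intro Bochner_Integration.integral_cong refl) (simp add: spaces Ff torus_def closed_polydisc_def)
    also have "\<dots> = enn2real (\<integral>\<^sup>+\<omega>. ennreal (norm (F \<omega>) powr p) \<partial>torus_haar)"
    proof (rule integral_eq_nn_integral)
      show "(\<lambda>\<omega>. norm (F \<omega>) powr p) \<in> borel_measurable torus_haar"
        unfolding torus_haar_def
        using measurable_restrict_space1[OF borel_measurable_continuous_onI[OF cFp[OF pm(2)]], of torus] by simp
    qed simp
    also have "(\<integral>\<^sup>+\<omega>. ennreal (norm (F \<omega>) powr p) \<partial>torus_haar)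
       = (\<integral>\<^sup>+x. ennreal (norm (F (\<chi> k. x k)) powr p) \<partial>(\<Pi>\<^sub>M k\<in>(UNIV::'n set). circle))"
      by (rule nn_integral_torus_haar)
        (intro measurable_compose[OF _ measurable_ennreal] borel_measurable_continuous_onI cFp pm)
    also have "\<dots> = ennreal I" unfolding I_def by (rule nn[OF coordinate_measures_circle pm(2)])
    finally have "hp_mean p f r = I powr (1 / p)" using I0 by (simp add: hp_mean_def)
    moreover have "hp_mean p f r \<le> hp_norm p f"
      unfolding hp_norm_def using bdd r by (intro cSUP_upper) auto
    ultimately have "(I powr (1 / p)) powr p \<le> hp_norm p f powr p"
      using pm by (intro powr_mono2) auto
    then show "(\<integral>x. norm (F (\<chi> k. x k)) powr p \<partial>(\<Pi>\<^sub>M k\<in>(UNIV::'n set). circle)) \<le> hp_norm p f powr p"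
      using pm I0 by (simp add: powr_powr I_def[symmetric])
  qed auto
  finally show ?thesis .
qed

section \<open>From one function to a product of \<open>m\<close> functions\<close>

lemma prod_le_mean_power:
  fixes x :: "'i \<Rightarrow> real"
  assumes "finite S" "S \<noteq> {}" and x: "\<And>i. i \<in> S \<Longrightarrow> 0 \<le> x i"
  shows "(\<Prod>i\<in>S. x i) \<le> (\<Sum>i\<in>S. x i ^ card S) / card S"
proof -
  have c: "0 < card S" using assms by (simp add: card_gt_0_iff)
  have "(\<Prod>i\<in>S. x i) = root (card S) ((\<Prod>i\<in>S. x i) ^ card S)"
    using c x by (simp add: real_root_power_cancel prod_nonneg)
  also have "\<dots> = root (card S) (\<Prod>i\<in>S. x i ^ card S)"
    by (simp add: prod_power_distrib)
  also have "\<dots> = (\<Prod>i\<in>S. x i ^ card S) powr (1 / card S)"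
    using c x by (subst root_powr_inverse) (auto intro!: prod_nonneg simp: inverse_eq_divide)
  also have "\<dots> \<le> (\<Sum>i\<in>S. x i ^ card S) / card S"
    using arith_geom_mean[of S "\<lambda>i. x i ^ card S"] assms by (simp add: sum_divide_distrib)
  finally show ?thesis .
qed

text \<open>Hoelder's inequality for \<open>card S\<close> factors with equal exponents. Each factor
  is divided by \<open>B i + e\<close>, which is positive even when \<open>B i = 0\<close>; after
  this normalisation the arithmetic mean integrates to at most \<open>1\<close>, and
  \<open>e\<close> tends to \<open>0\<close>.\<close>

lemma nn_integral_prod_le:
  fixes F :: "'i \<Rightarrow> 'a \<Rightarrow> real"
  assumes S: "finite S" "S \<noteq> {}"
    and F [measurable]: "\<And>i. i \<in> S \<Longrightarrow> F i \<in> borel_measurable M" and F0: "\<And>i x. 0 \<le> F i x"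
    and B: "\<And>i. i \<in> S \<Longrightarrow> 0 \<le> B i"
    and le: "\<And>i. i \<in> S \<Longrightarrow> (\<integral>\<^sup>+x. ennreal (F i x ^ card S) \<partial>M) \<le> ennreal (B i ^ card S)"
  shows "(\<integral>\<^sup>+x. ennreal (\<Prod>i\<in>S. F i x) \<partial>M) \<le> ennreal (\<Prod>i\<in>S. B i)"
proof -
  have c: "0 < card S" using S by (simp add: card_gt_0_iff)
  define I where "I = (\<integral>\<^sup>+x. ennreal (\<Prod>i\<in>S. F i x) \<partial>M)"
  have step: "I \<le> ennreal (\<Prod>i\<in>S. B i + e)" if e: "0 < e" for e
  proof -
    define b where "b i = B i + e" for i
    have b: "0 < b i" if "i \<in> S" for i using B[OF that] e by (simp add: b_def)
    define P where "P = (\<Prod>i\<in>S. b i)"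
    have P: "0 < P" unfolding P_def using b by (intro prod_pos) auto
    have "I \<le> (\<integral>\<^sup>+x. (\<Sum>i\<in>S. ennreal (P / card S / b i ^ card S) * ennreal (F i x ^ card S)) \<partial>M)"
      unfolding I_def
    proof (rule nn_integral_mono)
      fix x
      have "(\<Prod>i\<in>S. F i x) = P * (\<Prod>i\<in>S. F i x / b i)"
        using P by (simp add: P_def prod_dividef)
      also have "\<dots> \<le> P * ((\<Sum>i\<in>S. (F i x / b i) ^ card S) / card S)"
        using P b F0 S by (intro mult_left_mono prod_le_mean_power) (auto intro: divide_nonneg_pos)
      also have "\<dots> = (\<Sum>i\<in>S. P / card S / b i ^ card S * F i x ^ card S)"
        by (simp add: sum_distrib_left sum_divide_distrib power_divide mult_ac)
      finally have "ennreal (\<Prod>i\<in>S. F i x) \<le> ennreal (\<Sum>i\<in>S. P / card S / b i ^ card S * F i x ^ card S)"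
        by (rule ennreal_leI)
      also have "\<dots> = (\<Sum>i\<in>S. ennreal (P / card S / b i ^ card S * F i x ^ card S))"
        using P b F0 by (intro sum_ennreal[symmetric] mult_nonneg_nonneg) (auto simp: less_imp_le)
      also have "\<dots> = (\<Sum>i\<in>S. ennreal (P / card S / b i ^ card S) * ennreal (F i x ^ card S))"
        using P b F0 by (intro sum.cong refl ennreal_mult) (auto simp: less_imp_le)
      finally show "ennreal (\<Prod>i\<in>S. F i x) \<le> (\<Sum>i\<in>S. ennreal (P / card S / b i ^ card S) * ennreal (F i x ^ card S))" .
    qed
    also have "\<dots> = (\<Sum>i\<in>S. ennreal (P / card S / b i ^ card S) * (\<integral>\<^sup>+x. ennreal (F i x ^ card S) \<partial>M))"
      by (subst nn_integral_sum) (auto intro!: sum.cong nn_integral_cmult)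
    also have "\<dots> \<le> (\<Sum>i\<in>S. ennreal (P / card S))"
    proof (rule sum_mono)
      fix i assume i: "i \<in> S"
      have "(\<integral>\<^sup>+x. ennreal (F i x ^ card S) \<partial>M) \<le> ennreal (b i ^ card S)"
        using le[OF i] B[OF i] e by (auto intro!: order_trans[OF le[OF i]] ennreal_leI power_mono simp: b_def)
      then have "ennreal (P / card S / b i ^ card S) * (\<integral>\<^sup>+x. ennreal (F i x ^ card S) \<partial>M)
         \<le> ennreal (P / card S / b i ^ card S) * ennreal (b i ^ card S)"
        by (rule mult_left_mono) simp
      also have "\<dots> = ennreal (P / card S)"
        using P b[OF i] by (simp flip: ennreal_mult')
      finally show "ennreal (P / card S / b i ^ card S) * (\<integral>\<^sup>+x. ennreal (F i x ^ card S) \<partial>M) \<le> ennreal (P / card S)" .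
    qed
    also have "\<dots> = ennreal (\<Sum>i\<in>S. P / card S)" using P by (intro sum_ennreal) auto
    also have "(\<Sum>i\<in>S. P / card S) = P" using c by simp
    finally show ?thesis by (simp add: P_def b_def)
  qed
  have "I \<noteq> \<infinity>" using step[of 1] by (auto simp: top_unique)
  then obtain a where a: "I = ennreal a" "0 \<le> a" by (cases I) auto
  have "a \<le> (\<Prod>i\<in>S. B i)"
  proof (rule le_of_le_limit_at_right_0)
    show "((\<lambda>e. \<Prod>i\<in>S. B i + e) \<longlongrightarrow> (\<Prod>i\<in>S. B i)) (at_right 0)"
      by (rule tendsto_eq_intros refl | simp)+
    show "a \<le> (\<Prod>i\<in>S. B i + e)" if "0 < e" for e
      using step[OF that] B that a by (subst (asm) a(1), subst (asm) ennreal_le_iff) (auto intro!: prod_nonneg add_nonneg_nonneg)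
  qed
  then show ?thesis using a(1) by (simp add: I_def[symmetric] ennreal_leI)
qed

theorem theorem1p1:
  fixes m :: nat and p :: "nat \<Rightarrow> real" and f :: "nat \<Rightarrow> complex ^ 'n \<Rightarrow> complex"
  assumes "m \<ge> 2"
    and "\<And>j. j \<in> {1..m} \<Longrightarrow> 1 < p j"
    and "\<And>j. j \<in> {1..m} \<Longrightarrow> f j \<in> hp_space (p j)"
  shows "(\<integral>\<^sup>+ z. ennreal (\<Prod>j=1..m. norm (f j z) powr p j) \<partial>weighted_measure m)
    \<le> ennreal ((\<Prod>j=1..m. const_Gamma (p j) m CARD('n) powr p j) *
        (\<Prod>j=1..m. hp_norm (p j) (f j) powr p j))"
proof -
  note m = assms(1) and p = assms(2) and f = assms(3)
  have space: "space (weighted_measure m) = (polydisc :: (complex ^ 'n) set)"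
    and sets: "sets (weighted_measure m) = sets (restrict_space borel (polydisc :: (complex ^ 'n) set))"
    by (simp_all add: weighted_measure_def space_restrict_space cong: sets_restrict_space_cong)
  have cf: "continuous_on polydisc (f j)" if "j \<in> {1..m}" for j
    using f[OF that] unfolding hp_space_def pluriharmonic_on_def C2_on_def C1_on_def
    by (auto intro!: continuous_at_imp_continuous_on differentiable_imp_continuous_within)
  define r where "r i = 1 - 1 / (real i + 2)" for i :: nat
  have r: "0 < r i" "r i < 1" for i by (auto simp: r_def divide_less_eq)
  have rlim: "r \<longlonglongrightarrow> 1" unfolding r_def by real_asymp
  have scale: "r i *\<^sub>R z \<in> polydisc" if "z \<in> polydisc" for i and z :: "complex ^ 'n"
    using that r[of i] by (intro scale_in_polydisc) auto
  have meas: "(\<lambda>z. norm (f j (r i *\<^sub>R z)) powr p j) \<in> borel_measurable (weighted_measure m)" if j: "j \<in> {1..m}" for i j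
  proof -
    have "continuous_on polydisc (\<lambda>z. norm (f j (r i *\<^sub>R z)) powr p j)"
      using p[OF j] scale
      by (intro continuous_on_nonneg_powr continuous_intros continuous_on_compose2[OF cf[OF j]]) auto
    then have "(\<lambda>z. norm (f j (r i *\<^sub>R z)) powr p j) \<in> borel_measurable (restrict_space borel polydisc)"
      by (rule borel_measurable_continuous_on_restrict)
    then show ?thesis by (simp cong: measurable_cong_sets[OF sets refl])
  qed
  let ?C = "\<Prod>j=1..m. const_Gamma (p j) m CARD('n) powr p j * hp_norm (p j) (f j) powr p j"
  \<comment> \<open>Taken over the index set \<open>{1..m}\<close>, whose cardinality is the
    exponent \<open>m\<close> in \<open>dilated_inequality\<close>.\<close>
  have bound: "(\<integral>\<^sup>+z. ennreal (\<Prod>j=1..m. norm (f j (r i *\<^sub>R z)) powr p j) \<partial>weighted_measure m) \<le> ennreal ?C" for i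
    by (rule nn_integral_prod_le)
      (use m dilated_inequality[OF m p f r(1)[of i] r(2)[of i]] meas in auto)
  have "(\<integral>\<^sup>+ z. ennreal (\<Prod>j=1..m. norm (f j z) powr p j) \<partial>weighted_measure m)
    = (\<integral>\<^sup>+ z. liminf (\<lambda>i. ennreal (\<Prod>j=1..m. norm (f j (r i *\<^sub>R z)) powr p j)) \<partial>weighted_measure m)"
  proof (rule nn_integral_cong)
    fix z :: "complex ^ 'n" assume "z \<in> space (weighted_measure m)"
    then have z: "z \<in> polydisc" by (simp add: space)
    have "(\<lambda>i. f j (r i *\<^sub>R z)) \<longlonglongrightarrow> f j z" if j: "j \<in> {1..m}" for j
    proof -
      have c: "isCont (f j) z" by (rule bspec[OF continuous_on_eq_continuous_at[OF open_polydisc, THEN iffD1, OF cf[OF j]] z])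
      have "(\<lambda>i. r i *\<^sub>R z) \<longlonglongrightarrow> z" using tendsto_scaleR[OF rlim tendsto_const[of z]] by simp
      then show ?thesis by (rule isCont_tendsto_compose[OF c])
    qed
    then have "(\<lambda>i. \<Prod>j=1..m. norm (f j (r i *\<^sub>R z)) powr p j) \<longlonglongrightarrow> (\<Prod>j=1..m. norm (f j z) powr p j)"
      using p by (intro tendsto_prod tendsto_powr' tendsto_norm tendsto_const) (auto intro: order.strict_trans[OF zero_less_one])
    then have "(\<lambda>i. ennreal (\<Prod>j=1..m. norm (f j (r i *\<^sub>R z)) powr p j)) \<longlonglongrightarrow> ennreal (\<Prod>j=1..m. norm (f j z) powr p j)"
      by (rule tendsto_ennrealI)
    then show "ennreal (\<Prod>j=1..m. norm (f j z) powr p j) = liminf (\<lambda>i. ennreal (\<Prod>j=1..m. norm (f j (r i *\<^sub>R z)) powr p j))"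
      by (simp add: lim_imp_Liminf)
  qed
  also have "\<dots> \<le> liminf (\<lambda>i. \<integral>\<^sup>+ z. ennreal (\<Prod>j=1..m. norm (f j (r i *\<^sub>R z)) powr p j) \<partial>weighted_measure m)"
    by (intro nn_integral_liminf measurable_compose[OF _ measurable_ennreal] borel_measurable_prod meas)
  also have "\<dots> \<le> ennreal ?C"
    by (rule order_trans[OF Liminf_le_Limsup Limsup_bounded]) (use bound in auto)
  finally show ?thesis by (simp add: prod.distrib)
qed

end
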